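(* Let $X=\mathbb{P}^1\setminus\{0,1,\infty\}$ and $j:X\to\mathbb{A}^1$ the inclusion. Let $\overline{\mathcal{L}_0}=[t;t]$, $\overline{\mathcal{L}_1}=[t;1-t]$ in $\mathcal{N}^1_{\mathbb{A}^1}(1)$, with restrictions $\mathcal{L}_0,\mathcal{L}_1\in\mathcal{N}^1_X(1)$ to $X$. Put $\overline b=\overline{\mathcal{L}_0}\,\overline{\mathcal{L}_1}$, $b=\mathcal{L}_0\,\mathcal{L}_1$, and $$\overline{\mathcal{L}_{01}}=\mu^*(\overline b),\quad\overline{\mathcal{L}^1_{01}}=\nu^*(\overline b),\quad\mathcal{L}_{01}=j^*(\overline{\mathcal{L}_{01}}),\quad\mathcal{L}^1_{01}=j^*(\overline{\mathcal{L}^1_{01}}),$$ where $\mu^*,\nu^*$ are the pull-backs by the multiplication and twisted multiplication (defined in the context). Then: (1) $\mathcal{L}_{01}$ and $\mathcal{L}^1_{01}$ are equidimensional over $X$, that is, elements of $\mathcal{N}^{eq,1}_X(2)$; respectively $\overline{\mathcal{L}_{01}}$ and $\overline{\mathcal{L}^1_{01}}$ are equidimensional over $\mathbb{A}^1$ (elements of $\mathcal{N}^{eq,1}_{\mathbb{A}^1}(2)$). (2) $\partial(\mathcal{L}_{01})=\partial(\mathcal{L}^1_{01})=b=\mathcal{L}_0\,\mathcal{L}_1$ and $\partial_{\mathbb{A}^1}(\overline{\mathcal{L}_{01}})=\partial_{\mathbb{A}^1}(\overline{\mathcal{L}^1_{01}})=\overline b=\overline{\mathcal{L}_0}\,\overline{\mathcal{L}_1}$.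 (3) The cycle $\overline{\mathcal{L}_{01}}$ (resp. $\overline{\mathcal{L}^1_{01}}$) extends $\mathcal{L}_{01}$ (resp. $\mathcal{L}^1_{01}$) over $\mathbb{A}^1$ and has an empty fiber at $0$ (resp. at $1$).
   Context: The base field is $\mathbb{Q}$. Put $\square^1=\mathbb{P}^1\setminus\{1\}$ and $\square^n=(\square^1)^n$ with affine coordinates $u_1,\dots,u_n$. A face $F$ of $\square^n$ is a subvariety given by equations $u_{i_k}=\varepsilon_k$ with $\varepsilon_k\in\{0,\infty\}$. Let $Y$ be a smooth irreducible quasi-projective variety over $\mathbb{Q}$ (here $Y=\mathbb{A}^1$ or $Y=X$). $\mathcal{Z}^p(Y,n)$ is the free abelian group on the closed irreducible subvarieties $Z\subset Y\times\square^n$ of codimension $p$ such that for every face $F$, $Z\cap(Y\times F)$ is empty or of codimension $p$ in $Y\times F$. The group $G_n=(\mathbb{Z}/2\mathbb{Z})^n\rtimes\mathfrak{S}_n$ acts on $\square^n$ (permutation of factors, and $u\mapsto1/u$ on each factor); extend the sign character of $\mathfrak{S}_n$ to $G_n\to\{\pm1\}$ by letting each generator of a $\mathbb{Z}/2\mathbb{Z}$ have sign $-1$, and let $\mathcal{A}lt_n\in\mathbb{Q}[G_n]$ be the corresponding projector. Set $\mathcal{N}^k_Y(p)=\mathcal{A}lt_{2p-k}(\mathcal{Z}^p(Y,2p-k)\otimes\mathbb{Q})$, $\mathcal{N}^\bullet_Y=\bigoplus_{p\ge0}\mathcal{N}^\bullet_Y(p)$ ($k$ is the cohomological degree, $p$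 the weight), with differential $\partial=\partial_Y=\sum_i(-1)^{i-1}(\partial_i^0-\partial_i^\infty)$ raising $k$ by one, $\partial_i^\varepsilon$ being the pull-back to the face $u_i=\varepsilon$. Exterior product of cycles (concatenating the cube factors), pull-back along the diagonal of $Y$ and $\mathcal{A}lt$ give a product making $\mathcal{N}^\bullet_Y$ a graded commutative differential graded algebra. A morphism to $Y$ is equidimensional of relative dimension $r$ if every irreducible component of the source dominates $Y$ and every nonempty fiber has pure dimension $r$ (empty fibers are allowed). $\mathcal{Z}^p_{eq}(Y,n)$ is the free abelian group generated by the irreducible closed $Z\subset Y\times\square^n$ such that for every face $F$, $Z\cap(Y\times F)$ is empty or $Z\cap(Y\times F)\to Y$ is equidimensional of relative dimension $\dim(F)-p$; $\mathcal{N}^{eq,k}_Y(p)=\mathcal{A}lt_{2p-k}(\mathcal{Z}^p_{eq}(Y,2p-k)\otimes\mathbb{Q})\subset\mathcal{N}^k_Y(p)$. The fiber at $x\in Y$ of a generator $Z$ is $Z\cap(\{x\}\times\square^n)$, extended to $\mathcal{A}lt(\sum q_iZ_i)$ linearly. Notation: $[t;f_1,\dots,f_n]$ denotes the image under $\mathcal{A}lt_n$ of the cycle in $Y\times\square^n$ parametrized by $t\in Y$ and the coordinates $u_i=f_i$; e.g. $[t;t]$ and $[t;1-t]$ are the graphs of $t\mapsto t$ and $t\mapsto1-t$ restricted to $\mathbb{A}^1\times\square^1$. Definition of $\mu^*,\nu^*:\mathcal{N}^{eq,k}_{\mathbb{A}^1}(p)\to\mathcal{N}^{eq,k-1}_{\mathbb{A}^1}(p)$: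 let $\tau:\square^1\to\mathbb{A}^1$, $u\mapsto\frac1{1-u}$; $m:\mathbb{A}^1\times\mathbb{A}^1\to\mathbb{A}^1$ the multiplication; $\theta:\mathbb{A}^1\to\mathbb{A}^1$, $t\mapsto1-t$. With $n=2p-k$, let $\widetilde m=(m\circ(\mathrm{id}\times\tau))\times\mathrm{id}_{\square^n}:\mathbb{A}^1\times\square^1\times\square^n\to\mathbb{A}^1\times\square^n$ and $\widehat m=(\theta\times\mathrm{id}_{\square^n})\circ\widetilde m\circ(\theta\times\mathrm{id}_{\square^{n+1}})$. Let $h$ view a cycle on $(\mathbb{A}^1\times\square^1)\times\square^n$ as a cycle on $\mathbb{A}^1\times\square^{n+1}$ (the extra $\square^1$ being the first cubical factor). Then $\mu^*=h\circ\widetilde m^*$ and $\nu^*=h\circ\widehat m^*$, extended $\mathbb{Q}$-linearly and followed by $\mathcal{A}lt$. The cycle $\overline b=[t;t,1-t]$ lies in $\mathcal{N}^{eq,2}_{\mathbb{A}^1}(2)$, so these maps apply to it. *)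

theory Defs
  imports
    "HOL-Library.Poly_Mapping"
    "HOL-Library.Extended_Nat"
    "HOL-Computational_Algebra.Fraction_Field"
    "HOL-Combinatorics.Permutations"
    "HOL-Algebra.Ideal"
begin

section \<open>Coordinate rings\<close>

text \<open>
  The function \<open>\<tau>(u) = 1/(1-u)\<close> identifies \<open>\<box>\<^sup>1 = P\<^sup>1 - {1}\<close> with the affine line, so
  \<open>(A\<^sup>1)\<^sup>a \<times> \<box>\<^sup>n\<close> is the spectrum of the polynomial ring over the rationals in the base
  coordinates \<open>T 1, \<dots>, T a\<close> and the functions \<open>V i = 1/(1-u\<^sub>i)\<close> for \<open>1 \<le> i \<le> n\<close>.
  In this coordinate the point \<open>u = 0\<close> is \<open>V = 1\<close>, the point \<open>u = \<infinity>\<close> is \<open>V = 0\<close>, and the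
  involution \<open>u \<mapsto> 1/u\<close> is \<open>V \<mapsto> 1 - V\<close>.
\<close>

datatype coord = T nat | V nat

text \<open>The order on coordinates plays no mathematical role: the library needs some linear order
  on the variables to make the polynomial ring an integral domain.\<close>

fun coord_code :: "coord \<Rightarrow> int" where
  "coord_code (T i) = - 1 - int i"
| "coord_code (V i) = int i"

lemma coord_code_inject: "coord_code x = coord_code y \<Longrightarrow> x = y"
  by (cases x; cases y) auto

instantiation coord :: linorder
begin

definition less_eq_coord :: "coord \<Rightarrow> coord \<Rightarrow> bool" where
  "x \<le> y \<longleftrightarrow> coord_code x \<le> coord_code y"

definition less_coord :: "coord \<Rightarrow> coord \<Rightarrow> bool" where
  "x < y \<longleftrightarrow> coord_code x < coord_code y"

instance
  by standard (auto simp: less_eq_coord_def less_coord_def coord_code_inject)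

end

type_synonym qpoly = "(coord \<Rightarrow>\<^sub>0 nat) \<Rightarrow>\<^sub>0 rat"

definition const :: "rat \<Rightarrow> qpoly" where
  "const r = Poly_Mapping.single 0 r"

definition var :: "coord \<Rightarrow> qpoly" where
  "var c = Poly_Mapping.single (Poly_Mapping.single c 1) 1"

definition coords :: "nat \<Rightarrow> nat \<Rightarrow> coord set" where
  "coords a n = T ` {1..a} \<union> V ` {1..n}"

definition coord_ring :: "nat \<Rightarrow> nat \<Rightarrow> qpoly ring" where
  "coord_ring a n =
     \<lparr>carrier = {p. \<forall>m \<in> Poly_Mapping.keys p. Poly_Mapping.keys m \<subseteq> coords a n},
      mult = (*), one = 1, zero = 0, add = (+)\<rparr>"

text \<open>\<open>eval_poly c s p\<close> applies \<open>c\<close> to the coefficients of \<open>p\<close> and substitutes \<open>s x\<close>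
  for each variable \<open>x\<close>.\<close>

definition eval_poly :: "(rat \<Rightarrow> 'b::comm_ring_1) \<Rightarrow> (coord \<Rightarrow> 'b) \<Rightarrow> qpoly \<Rightarrow> 'b" where
  "eval_poly c s p =
     (\<Sum>m \<in> Poly_Mapping.keys p. c (Poly_Mapping.lookup p m) *
        (\<Prod>x \<in> Poly_Mapping.keys m. s x ^ Poly_Mapping.lookup m x))"

text \<open>A morphism of affine varieties is given by its comorphism, which is a substitution.\<close>

definition substitute :: "(coord \<Rightarrow> qpoly) \<Rightarrow> qpoly \<Rightarrow> qpoly" where
  "substitute s = eval_poly const s"

definition to_frac :: "qpoly \<Rightarrow> qpoly fract" where
  "to_frac p = Fract p 1"


section \<open>Points, components and dimension\<close>

text \<open>
  Points are scheme points, that is prime ideals. An irreducible closed subvariety is represented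
  by its generic point, so \<open>P \<subseteq> Q\<close> says that the subvariety of \<open>P\<close> contains that of \<open>Q\<close>.
\<close>

type_synonym point = "qpoly set"

definition Spec :: "qpoly ring \<Rightarrow> point set" where
  "Spec R = {P. primeideal P R}"

text \<open>The generic points of the irreducible components of a set of points.\<close>

definition irred_components :: "point set \<Rightarrow> point set" where
  "irred_components S = {Q \<in> S. \<forall>P \<in> S. P \<subseteq> Q \<longrightarrow> P = Q}"

text \<open>Krull dimension of the closure of the point \<open>Q\<close> in the subspace \<open>S\<close>.\<close>

definition dim_closure :: "point set \<Rightarrow> point \<Rightarrow> enat" where
  "dim_closure S Q =
     Sup {enat k | k c. c 0 = Q \<and> (\<forall>i \<le> k. c i \<in> S) \<and> (\<forall>i < k. c i \<subset> c (Suc i))}"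

text \<open>The base varieties are open subsets of the affine line; \<open>X\<close> is
  \<open>P\<^sup>1 - {0, 1, \<infinity>} = A\<^sup>1 - {0, 1}\<close>.\<close>

definition A1 :: "point set" where
  "A1 = Spec (coord_ring 1 0)"

definition X :: "point set" where
  "X = {x \<in> A1. var (T 1) \<notin> x \<and> 1 - var (T 1) \<notin> x}"

definition rational_point :: "rat \<Rightarrow> point" where
  "rational_point q = {p \<in> carrier (coord_ring 1 0). eval_poly (\<lambda>r. r) (\<lambda>_. q) p = 0}"

text \<open>The image in the affine line of a point of \<open>A\<^sup>1 \<times> \<box>\<^sup>n\<close>.\<close>

definition proj_base :: "point \<Rightarrow> point" where
  "proj_base P = P \<inter> carrier (coord_ring 1 0)"

definition times_cube :: "point set \<Rightarrow> nat \<Rightarrow> point set" where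
  "times_cube Y n = {P \<in> Spec (coord_ring 1 n). proj_base P \<in> Y}"

text \<open>The locus in \<open>Y \<times> \<box>\<^sup>n\<close> of the irreducible closed subvariety with generic point \<open>Z\<close>.\<close>

definition locus :: "point set \<Rightarrow> nat \<Rightarrow> point \<Rightarrow> point set" where
  "locus Y n Z = {Q \<in> times_cube Y n. Z \<subseteq> Q}"


section \<open>Cycles and pull-backs\<close>

type_synonym cycle = "point \<Rightarrow>\<^sub>0 rat"

definition scale :: "rat \<Rightarrow> cycle \<Rightarrow> cycle" where
  "scale q z = Poly_Mapping.map ((*) q) z"

definition lin_ext :: "(point \<Rightarrow> cycle) \<Rightarrow> cycle \<Rightarrow> cycle" where
  "lin_ext f z = (\<Sum>Z \<in> Poly_Mapping.keys z. scale (Poly_Mapping.lookup z Z) (f Z))"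

definition local_ring :: "qpoly ring \<Rightarrow> point \<Rightarrow> qpoly fract ring" where
  "local_ring R Q =
     \<lparr>carrier = {Fract f g | f g. f \<in> carrier R \<and> g \<in> carrier R - Q},
      mult = (*), one = 1, zero = 0, add = (+)\<rparr>"

text \<open>The length of \<open>R\<^sub>Q / I R\<^sub>Q\<close>, for the ideal \<open>I\<close> generated by \<open>G\<close>: the maximal length of
  a chain of ideals of \<open>R\<^sub>Q\<close> containing \<open>I R\<^sub>Q\<close>. It is finite if \<open>Q\<close> is a minimal prime
  over \<open>I\<close>, which is the only case used.\<close>

definition local_length :: "qpoly ring \<Rightarrow> point \<Rightarrow> qpoly set \<Rightarrow> nat" where
  "local_length R Q G =
     Sup {k | k J. (\<forall>i \<le> k. ideal (J i) (local_ring R Q)) \<and>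
                   genideal (local_ring R Q) (to_frac ` G) \<subseteq> J 0 \<and>
                   (\<forall>i < k. J i \<subset> J (Suc i))}"

text \<open>The cycle of the closed subscheme cut out by \<open>G\<close> in the open subset \<open>U\<close> of \<open>Spec R\<close>.\<close>

definition scheme_cycle :: "qpoly ring \<Rightarrow> point set \<Rightarrow> qpoly set \<Rightarrow> cycle" where
  "scheme_cycle R U G =
     (\<Sum>Q \<in> irred_components {Q \<in> U. G \<subseteq> Q}. Poly_Mapping.single Q (of_nat (local_length R Q G)))"

text \<open>
  The pull-back, along the morphism from the open subset \<open>U\<close> of \<open>Spec R\<close> with comorphism \<open>\<phi>\<close>,
  sends a subvariety to the cycle of its scheme-theoretic inverse image. This is the flat pull-back
  for flat morphisms. For the inclusion of a divisor (a face \<open>u\<^sub>i = \<epsilon>\<close>, or the diagonal of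
  \<open>Y \<times> Y\<close>) it is the intersection product with any subvariety not contained in the divisor, as
  the higher Tor terms vanish.
\<close>

definition pull_back :: "qpoly ring \<Rightarrow> point set \<Rightarrow> (qpoly \<Rightarrow> qpoly) \<Rightarrow> cycle \<Rightarrow> cycle" where
  "pull_back R U \<phi> = lin_ext (\<lambda>Z. scheme_cycle R U (\<phi> ` Z))"

text \<open>The pull-back \<open>j\<^sup>*\<close> along an open immersion \<open>Y \<times> \<box>\<^sup>n \<rightarrow> A\<^sup>1 \<times> \<box>\<^sup>n\<close>.\<close>

definition restrict_to :: "point set \<Rightarrow> nat \<Rightarrow> cycle \<Rightarrow> cycle" where
  "restrict_to Y n = pull_back (coord_ring 1 n) (times_cube Y n) id"


section \<open>The alternating projector\<close>

text \<open>
  The element \<open>(S, \<sigma>)\<close> of \<open>G\<^sub>n\<close> has comorphism \<open>u\<^sub>i \<mapsto> u\<^sub>\<sigma>\<^sub>i\<close>, inverted for \<open>i \<in> S\<close>. The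
  image of a subvariety under an automorphism is the inverse image of its prime ideal under the
  comorphism.
\<close>

definition act :: "nat \<Rightarrow> nat set \<Rightarrow> (nat \<Rightarrow> nat) \<Rightarrow> point \<Rightarrow> point" where
  "act n S \<sigma> Z =
     {p \<in> carrier (coord_ring 1 n).
        substitute (\<lambda>x. case x of T i \<Rightarrow> var (T i)
                 | V i \<Rightarrow> if i \<in> S then 1 - var (V (\<sigma> i)) else var (V (\<sigma> i))) p \<in> Z}"

definition Alt :: "nat \<Rightarrow> cycle \<Rightarrow> cycle" where
  "Alt n z = scale (1 / (2 ^ n * fact n))
     (\<Sum>S \<in> Pow {1..n}. \<Sum>\<sigma> | \<sigma> permutes {1..n}.
        scale ((- 1) ^ card S * of_int (sign \<sigma>))
              (lin_ext (\<lambda>Z. Poly_Mapping.single (act n S \<sigma> Z) 1) z))"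


section \<open>Faces and the differential\<close>

datatype endpoint = Zero | Infty

fun tau :: "endpoint \<Rightarrow> rat" where
  "tau Zero = 1"
| "tau Infty = 0"

text \<open>The comorphism of the face inclusion \<open>\<box>\<^sup>n\<^sup>-\<^sup>1 \<rightarrow> \<box>\<^sup>n\<close> onto \<open>u\<^sub>i = \<epsilon>\<close>.\<close>

definition face_map :: "nat \<Rightarrow> endpoint \<Rightarrow> qpoly \<Rightarrow> qpoly" where
  "face_map i \<epsilon> = substitute (\<lambda>x. case x of T j \<Rightarrow> var (T j)
     | V j \<Rightarrow> if j < i then var (V j) else if j = i then const (tau \<epsilon>) else var (V (j - 1)))"

definition face_pull :: "point set \<Rightarrow> nat \<Rightarrow> nat \<Rightarrow> endpoint \<Rightarrow> cycle \<Rightarrow> cycle" where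
  "face_pull Y n i \<epsilon> = pull_back (coord_ring 1 (n - 1)) (times_cube Y (n - 1)) (face_map i \<epsilon>)"

text \<open>On cohomological degree \<open>k\<close> and weight \<open>p\<close> one has \<open>n = 2p - k\<close>.\<close>

definition differential :: "point set \<Rightarrow> nat \<Rightarrow> cycle \<Rightarrow> cycle" where
  "differential Y n z =
     (\<Sum>i \<in> {1..n}. scale ((- 1) ^ (i - 1)) (face_pull Y n i Zero z - face_pull Y n i Infty z))"

text \<open>A face prescribes the value of \<open>u\<^sub>i\<close> for \<open>i\<close> in the domain of a partial map.\<close>

type_synonym face = "nat \<Rightarrow> endpoint option"

definition faces :: "nat \<Rightarrow> face set" where
  "faces n = {F. dom F \<subseteq> {1..n}}"

definition face_dim :: "nat \<Rightarrow> face \<Rightarrow> nat" where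
  "face_dim n F = n - card (dom F)"

definition times_face :: "point set \<Rightarrow> nat \<Rightarrow> face \<Rightarrow> point set" where
  "times_face Y n F =
     {Q \<in> times_cube Y n. \<forall>i \<epsilon>. F i = Some \<epsilon> \<longrightarrow> var (V i) - const (tau \<epsilon>) \<in> Q}"


section \<open>Equidimensional cycles\<close>

definition dominates_base :: "point \<Rightarrow> bool" where
  "dominates_base W \<longleftrightarrow> proj_base W = {0}"

text \<open>The fiber over the scheme point \<open>x\<close> of the base, as a topological subspace.\<close>

definition fiber_pts :: "point set \<Rightarrow> point \<Rightarrow> point set" where
  "fiber_pts S x = {Q \<in> S. proj_base Q = x}"

definition equidimensional :: "point set \<Rightarrow> point set \<Rightarrow> int \<Rightarrow> bool" where
  "equidimensional Y S r \<longleftrightarrow>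
     (\<forall>W \<in> irred_components S. dominates_base W) \<and>
     (\<forall>x \<in> Y. \<forall>W \<in> irred_components (fiber_pts S x).
        \<exists>d::nat. dim_closure (fiber_pts S x) W = enat d \<and> int d = r)"

definition Zeq :: "point set \<Rightarrow> nat \<Rightarrow> nat \<Rightarrow> point set" where
  "Zeq Y p n =
     {Z \<in> times_cube Y n. \<forall>F \<in> faces n.
        locus Y n Z \<inter> times_face Y n F = {} \<or>
        equidimensional Y (locus Y n Z \<inter> times_face Y n F) (int (face_dim n F) - int p)}"

definition Neq :: "point set \<Rightarrow> nat \<Rightarrow> int \<Rightarrow> cycle set" where
  "Neq Y p k =
     (if k \<le> 2 * int p
      then Alt (nat (2 * int p - k)) `
             {z. Poly_Mapping.keys z \<subseteq> Zeq Y p (nat (2 * int p - k))}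
      else {0})"

text \<open>The fiber over a closed point \<open>x\<close>, extended linearly, as a cycle on \<open>Y \<times> \<box>\<^sup>n\<close> supported
  on \<open>{x} \<times> \<box>\<^sup>n\<close>.\<close>

definition fiber_cycle :: "point set \<Rightarrow> nat \<Rightarrow> point \<Rightarrow> cycle \<Rightarrow> cycle" where
  "fiber_cycle Y n x = lin_ext (\<lambda>Z. scheme_cycle (coord_ring 1 n) (times_cube Y n) (Z \<union> x))"

text \<open>Besides the vanishing of the linearly extended fiber, each subvariety occurring in the cycle is
  required to have an empty fiber, so that emptiness does not come from a cancellation.\<close>

definition empty_fiber :: "point set \<Rightarrow> nat \<Rightarrow> point \<Rightarrow> cycle \<Rightarrow> bool" where
  "empty_fiber Y n x z \<longleftrightarrow>
     (\<forall>Z \<in> Poly_Mapping.keys z. fiber_pts (locus Y n Z) x = {}) \<and> fiber_cycle Y n x z = 0"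


section \<open>Products\<close>

text \<open>Comorphisms of the projections from \<open>Y \<times> Y \<times> \<box>\<^sup>m\<^sup>+\<^sup>n\<close> to \<open>Y \<times> \<box>\<^sup>m\<close> (identity on variables)
  and to \<open>Y \<times> \<box>\<^sup>n\<close>.\<close>

definition proj2_map :: "nat \<Rightarrow> qpoly \<Rightarrow> qpoly" where
  "proj2_map m = substitute (\<lambda>x. case x of T i \<Rightarrow> var (T (i + 1)) | V i \<Rightarrow> var (V (m + i)))"

definition times_times_cube :: "point set \<Rightarrow> nat \<Rightarrow> point set" where
  "times_times_cube Y n =
     {P \<in> Spec (coord_ring 2 n).
        proj_base P \<in> Y \<and> {p \<in> carrier (coord_ring 1 0). proj2_map 0 p \<in> P} \<in> Y}"

definition exterior_product :: "point set \<Rightarrow> nat \<Rightarrow> nat \<Rightarrow> cycle \<Rightarrow> cycle \<Rightarrow> cycle" where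
  "exterior_product Y m n z w =
     lin_ext (\<lambda>Z. lin_ext (\<lambda>W.
        scheme_cycle (coord_ring 2 (m + n)) (times_times_cube Y (m + n)) (Z \<union> proj2_map m ` W)) w) z"

definition diagonal_map :: "qpoly \<Rightarrow> qpoly" where
  "diagonal_map = substitute (\<lambda>x. case x of T i \<Rightarrow> var (T 1) | V i \<Rightarrow> var (V i))"

definition cycle_product :: "point set \<Rightarrow> nat \<Rightarrow> nat \<Rightarrow> cycle \<Rightarrow> cycle \<Rightarrow> cycle" where
  "cycle_product Y m n z w =
     Alt (m + n) (pull_back (coord_ring 1 (m + n)) (times_cube Y (m + n)) diagonal_map
       (exterior_product Y m n z w))"


section \<open>Parametrized cycles and the maps \<open>\<mu>\<^sup>*\<close>, \<open>\<nu>\<^sup>*\<close>\<close>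

text \<open>\<open>[t; f\<^sub>1, \<dots>, f\<^sub>n]\<close> for rational functions \<open>f\<^sub>i \<noteq> 1\<close> of \<open>t = T 1\<close>. The prime ideal consists of
  the functions on \<open>A\<^sup>1 \<times> \<box>\<^sup>n\<close> vanishing identically after substituting \<open>u\<^sub>i = f\<^sub>i\<close>.\<close>

definition t :: "qpoly fract" where
  "t = to_frac (var (T 1))"

definition param_pt :: "qpoly fract list \<Rightarrow> point" where
  "param_pt fs =
     {p \<in> carrier (coord_ring 1 (length fs)).
        eval_poly (\<lambda>r. to_frac (const r))
          (\<lambda>x. case x of T i \<Rightarrow> t | V i \<Rightarrow> 1 / (1 - fs ! (i - 1))) p = 0}"

definition param :: "qpoly fract list \<Rightarrow> cycle" where
  "param fs = Alt (length fs) (Poly_Mapping.single (param_pt fs) 1)"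

text \<open>The comorphism of \<open>(t, u\<^sub>1, \<dots>, u\<^sub>n\<^sub>+\<^sub>1) \<mapsto> (t / (1 - u\<^sub>1), u\<^sub>2, \<dots>, u\<^sub>n\<^sub>+\<^sub>1)\<close>; the renumbering of
  the cubical coordinates is the identification \<open>(A\<^sup>1 \<times> \<box>\<^sup>1) \<times> \<box>\<^sup>n = A\<^sup>1 \<times> \<box>\<^sup>n\<^sup>+\<^sup>1\<close>.\<close>

definition mult_map :: "qpoly \<Rightarrow> qpoly" where
  "mult_map = substitute (\<lambda>x. case x of T i \<Rightarrow> var (T i) * var (V 1) | V i \<Rightarrow> var (V (i + 1)))"

definition theta_map :: "qpoly \<Rightarrow> qpoly" where
  "theta_map = substitute (\<lambda>x. case x of T i \<Rightarrow> 1 - var (T i) | V i \<Rightarrow> var (V i))"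

definition twisted_mult_map :: "qpoly \<Rightarrow> qpoly" where
  "twisted_mult_map = theta_map \<circ> mult_map \<circ> theta_map"

definition mu_pull :: "nat \<Rightarrow> cycle \<Rightarrow> cycle" where
  "mu_pull n z = Alt (n + 1) (pull_back (coord_ring 1 (n + 1)) (times_cube A1 (n + 1)) mult_map z)"

definition nu_pull :: "nat \<Rightarrow> cycle \<Rightarrow> cycle" where
  "nu_pull n z =
     Alt (n + 1) (pull_back (coord_ring 1 (n + 1)) (times_cube A1 (n + 1)) twisted_mult_map z)"

end

theory Submission
  imports Defs "HOL-Computational_Algebra.Polynomial"
begin

text \<open>
  Every cycle in sight is, up to the alternating projector, a single integral subvariety given by
  equations \<open>w\<^sub>c h\<^sub>c = 1\<close>, where \<open>w\<^sub>c\<close> is \<open>V\<^sub>c\<close> or \<open>1 - V\<^sub>c\<close> and \<open>h\<^sub>c\<close> is a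
  nonzero polynomial in the remaining coordinates; it is the graph of a rational map, hence
  integral, and it dominates the base. Both \<open>\<mu>\<^sup>*\<close> and \<open>\<nu>\<^sup>*\<close> turn the curve
  \<open>V\<^sub>1 (1 - t) = 1\<close>, \<open>V\<^sub>2 t = 1\<close> of \<open>b\<close> into a surface \<open>V\<^sub>2 u = 1\<close>, \<open>V\<^sub>3 (1 - u) = 1\<close> with
  \<open>u = \<alpha> + \<beta> V\<^sub>1\<close>, \<open>\<alpha> \<in> {0, 1}\<close> and \<open>\<alpha> + \<beta> = 1 - t\<close>. Its only nonempty face is \<open>V\<^sub>1 = 1\<close>, where
  \<open>u = 1 - t\<close> and the curve of \<open>b\<close> reappears. Projecting to \<open>(t, V\<^sub>1)\<close> identifies the
  surface with an open subset of the plane, so its nonempty fibers are open subsets of an affine line.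
\<close>

text \<open>The projector spreads each subvariety over its translates under the cube group, while
  pull-backs, faces and products are defined on whole prime ideals. Computations therefore run on
  generating sets whose shape the group preserves, and \<open>scheme_cycle\<close> is evaluated only
  where the generators generate a prime ideal (multiplicity one) or define the empty set.

  Products and both pull-backs respect the signs of translates, so one translate decides them. The
  differential needs a count: each of the 8 translates of b is a face of 6 of the 48 translates of
  the surface, always with the same sign, and 6/48 = 1/8.

  Faces are empty because u and 1 - u are units on the surface: V1 = 0 gives u = \<alpha>, V2 = 1
  gives u = 1, V3 = 1 gives u = 0, and V2 = 0 or V3 = 0 turns an equation into 0 = 1.

  Equidimensionality concerns every scheme point x of the base. The extension of x to Q[t][V1] is
  the generic point of a nonempty fibre; V1 = 1 or V1 = -1 supplies a second point because 2 is
  invertible; pseudo-division over Q[t] excludes chains of three points.\<close>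

locale unital_hom =
  fixes f :: "'a::comm_ring_1 \<Rightarrow> 'b::comm_ring_1"
  assumes one: "f 1 = 1"
    and add: "f (a + b) = f a + f b"
    and mult: "f (a * b) = f a * f b"
begin

lemma zero: "f 0 = 0"
  using add[of 0 0] by simp

lemma uminus: "f (- a) = - f a"
  using add[of a "- a"] by (simp add: zero eq_neg_iff_add_eq_0 add.commute)

lemma diff: "f (a - b) = f a - f b"
  using add[of a "- b"] by (simp add: uminus)

lemmas simps = zero one add mult uminus diff

end

lemma unital_hom_comp:
  assumes "unital_hom f" and "unital_hom g"
  shows "unital_hom (\<lambda>x. f (g x))"
  using assms by (simp add: unital_hom_def)

lemma unital_hom_id: "unital_hom (\<lambda>x. x)"
  by (simp add: unital_hom_def)


section \<open>Evaluation of polynomials\<close>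

lemma poly_mapping_sum_singles:
  fixes p :: "'a \<Rightarrow>\<^sub>0 'b::comm_monoid_add"
  shows "p = (\<Sum>m \<in> Poly_Mapping.keys p. Poly_Mapping.single m (Poly_Mapping.lookup p m))"
  by (rule poly_mapping_eqI)
     (auto simp: lookup_sum lookup_single when_def in_keys_iff sum.delta)

lemma prod_keys_add:
  fixes s :: "'a \<Rightarrow> 'b::comm_ring_1" and m m' :: "'a \<Rightarrow>\<^sub>0 nat"
  shows "(\<Prod>x \<in> Poly_Mapping.keys (m + m'). s x ^ Poly_Mapping.lookup (m + m') x) =
    (\<Prod>x \<in> Poly_Mapping.keys m. s x ^ Poly_Mapping.lookup m x) *
    (\<Prod>x \<in> Poly_Mapping.keys m'. s x ^ Poly_Mapping.lookup m' x)"
proof -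
  let ?U = "Poly_Mapping.keys m \<union> Poly_Mapping.keys m'"
  have *: "(\<Prod>x \<in> Poly_Mapping.keys k. s x ^ Poly_Mapping.lookup k x) =
      (\<Prod>x \<in> ?U. s x ^ Poly_Mapping.lookup k x)"
    if "Poly_Mapping.keys k \<subseteq> ?U" for k :: "'a \<Rightarrow>\<^sub>0 nat"
    by (rule prod.mono_neutral_left) (use that in \<open>auto simp: in_keys_iff\<close>)
  show ?thesis
    by (subst (1 2 3) *) (auto simp: Poly_Mapping.keys_add lookup_add power_add prod.distrib
        dest: subsetD[OF Poly_Mapping.keys_add])
qed

text \<open>The support of a sum can shrink by cancellation; over a common finite index set
  evaluation is additive term by term.\<close>

lemma eval_poly_superset:
  assumes "c 0 = 0" and "finite K" and "Poly_Mapping.keys p \<subseteq> K"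
  shows "eval_poly c s p = (\<Sum>m \<in> K. c (Poly_Mapping.lookup p m) *
    (\<Prod>x \<in> Poly_Mapping.keys m. s x ^ Poly_Mapping.lookup m x))"
  unfolding eval_poly_def
  by (rule sum.mono_neutral_left) (use assms in \<open>auto simp: in_keys_iff\<close>)

lemma eval_poly_add:
  assumes "unital_hom c"
  shows "eval_poly c s (p + q) = eval_poly c s p + eval_poly c s q"
proof -
  interpret unital_hom c by fact
  let ?K = "Poly_Mapping.keys p \<union> Poly_Mapping.keys q"
  show ?thesis
    by (subst (1 2 3) eval_poly_superset[where K = ?K])
       (auto simp: zero lookup_add add ring_distribs sum.distrib dest: subsetD[OF Poly_Mapping.keys_add])
qed

lemma eval_poly_single:
  assumes "unital_hom c"
  shows "eval_poly c s (Poly_Mapping.single m r) =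
    c r * (\<Prod>x \<in> Poly_Mapping.keys m. s x ^ Poly_Mapping.lookup m x)"
proof -
  interpret unital_hom c by fact
  show ?thesis
    by (subst eval_poly_superset[where K = "{m}"]) (auto simp: zero)
qed

lemma eval_poly_sum:
  assumes "unital_hom c"
  shows "eval_poly c s (\<Sum>x\<in>A. g x) = (\<Sum>x\<in>A. eval_poly c s (g x))"
  by (induction A rule: infinite_finite_induct)
     (simp_all add: eval_poly_add[OF assms], simp_all add: eval_poly_def)

lemma eval_poly_mult:
  assumes "unital_hom c"
  shows "eval_poly c s (p * q) = eval_poly c s p * eval_poly c s q"
proof -
  interpret unital_hom c by fact
  have single: "eval_poly c s (Poly_Mapping.single m a * Poly_Mapping.single k b) =
      eval_poly c s (Poly_Mapping.single m a) * eval_poly c s (Poly_Mapping.single k b)" for m k a b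
    by (simp add: mult_single eval_poly_single[OF assms] mult prod_keys_add)
  have "eval_poly c s (p * q) = eval_poly c s
    ((\<Sum>m \<in> Poly_Mapping.keys p. Poly_Mapping.single m (Poly_Mapping.lookup p m)) *
     (\<Sum>m \<in> Poly_Mapping.keys q. Poly_Mapping.single m (Poly_Mapping.lookup q m)))"
    using poly_mapping_sum_singles[of p] poly_mapping_sum_singles[of q] by simp
  also have "\<dots> = eval_poly c s
     (\<Sum>m \<in> Poly_Mapping.keys p. Poly_Mapping.single m (Poly_Mapping.lookup p m)) * eval_poly c s
     (\<Sum>m \<in> Poly_Mapping.keys q. Poly_Mapping.single m (Poly_Mapping.lookup q m))"
    by (simp only: sum_product eval_poly_sum[OF assms] single)
  finally show ?thesis
    using poly_mapping_sum_singles[of p] poly_mapping_sum_singles[of q] by simp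
qed

lemma unital_hom_eval_poly: "unital_hom c \<Longrightarrow> unital_hom (eval_poly c s)"
  using eval_poly_single[of c s 0 1]
  by unfold_locales (simp_all add: eval_poly_add eval_poly_mult unital_hom.one)

lemma eval_poly_const [simp]: "unital_hom c \<Longrightarrow> eval_poly c s (const r) = c r"
  by (simp add: const_def eval_poly_single)

lemma eval_poly_var [simp]: "unital_hom c \<Longrightarrow> eval_poly c s (var x) = s x"
  by (simp add: var_def eval_poly_single unital_hom.one)

lemma unital_hom_const: "unital_hom const"
  by unfold_locales (simp_all add: const_def single_add mult_single flip: single_one)

lemma unital_hom_to_frac: "unital_hom to_frac"
  by unfold_locales (simp_all add: to_frac_def One_fract_def)

lemma to_frac_eq_iff [simp]: "to_frac p = to_frac q \<longleftrightarrow> p = q"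
  by (simp add: to_frac_def eq_fract)

lemma to_frac_eq_0_iff [simp]: "to_frac p = 0 \<longleftrightarrow> p = 0"
  using to_frac_eq_iff[of p 0] unital_hom.zero[OF unital_hom_to_frac] by simp

lemma unital_hom_substitute: "unital_hom (substitute s)"
  unfolding substitute_def by (rule unital_hom_eval_poly[OF unital_hom_const])

lemma substitute_const [simp]: "substitute s (const r) = const r"
  by (simp add: substitute_def unital_hom_const)

lemma substitute_var [simp]: "substitute s (var x) = s x"
  by (simp add: substitute_def unital_hom_const)

lemmas substitute_simps [simp] = unital_hom.simps[OF unital_hom_substitute]


section \<open>Polynomials in a set of coordinates\<close>

definition polys_in :: "coord set \<Rightarrow> qpoly set" where
  "polys_in C = {p. \<forall>m \<in> Poly_Mapping.keys p. Poly_Mapping.keys m \<subseteq> C}"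

lemma carrier_coord_ring [simp]: "carrier (coord_ring a n) = polys_in (coords a n)"
  by (simp add: coord_ring_def polys_in_def)

lemma polys_in_const [simp]: "const r \<in> polys_in C"
  by (simp add: polys_in_def const_def)

lemma polys_in_var [simp]: "var x \<in> polys_in C \<longleftrightarrow> x \<in> C"
  by (simp add: polys_in_def var_def)

lemma polys_in_add [simp]: "p \<in> polys_in C \<Longrightarrow> q \<in> polys_in C \<Longrightarrow> p + q \<in> polys_in C"
  unfolding polys_in_def using Poly_Mapping.keys_add[of p q] by blast

lemma polys_in_mult [simp]:
  assumes "p \<in> polys_in C" and "q \<in> polys_in C"
  shows "p * q \<in> polys_in C"
  unfolding polys_in_def
proof (intro CollectI ballI)
  fix m assume "m \<in> Poly_Mapping.keys (p * q)"
  then obtain a b where "m = a + b" "a \<in> Poly_Mapping.keys p" "b \<in> Poly_Mapping.keys q"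
    using keys_mult[of p q] by blast
  with assms show "Poly_Mapping.keys m \<subseteq> C"
    using Poly_Mapping.keys_add[of a b] unfolding polys_in_def by blast
qed

lemma polys_in_0 [simp]: "0 \<in> polys_in C" and polys_in_1 [simp]: "1 \<in> polys_in C"
  by (simp_all add: polys_in_def)

lemma polys_in_uminus [simp]: "p \<in> polys_in C \<Longrightarrow> - p \<in> polys_in C"
  by (simp add: polys_in_def)

lemma polys_in_diff [simp]: "p \<in> polys_in C \<Longrightarrow> q \<in> polys_in C \<Longrightarrow> p - q \<in> polys_in C"
  using polys_in_add[of p C "- q"] by simp

lemma polys_in_mono: "C \<subseteq> D \<Longrightarrow> polys_in C \<subseteq> polys_in D"
  by (auto simp: polys_in_def)

text \<open>Each monomial is a product of powers of variables, so constants and variables generate.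
  Homomorphisms can then be compared, and their ranges bounded, on generators.\<close>

lemma polys_in_induct [consumes 1, case_names const var add mult]:
  assumes "p \<in> polys_in C"
    and const: "\<And>r. P (const r)"
    and var: "\<And>x. x \<in> C \<Longrightarrow> P (var x)"
    and add: "\<And>p q. p \<in> polys_in C \<Longrightarrow> q \<in> polys_in C \<Longrightarrow> P p \<Longrightarrow> P q \<Longrightarrow> P (p + q)"
    and mult: "\<And>p q. p \<in> polys_in C \<Longrightarrow> q \<in> polys_in C \<Longrightarrow> P p \<Longrightarrow> P q \<Longrightarrow> P (p * q)"
  shows "P p"
proof -
  define G where "G = {p \<in> polys_in C. P p}"
  have G_mult: "a \<in> G \<Longrightarrow> b \<in> G \<Longrightarrow> a * b \<in> G" for a b
    using mult by (auto simp: G_def)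
  have G_1: "1 \<in> G" and G_0: "0 \<in> G"
    using const[of 1] const[of 0] by (auto simp: G_def const_def single_one)
  have G_power: "a ^ n \<in> G" if "a \<in> G" for a n
    by (induction n) (use that G_1 G_mult in auto)
  have G_prod: "(\<Prod>x\<in>A. g x) \<in> G" if "\<And>x. x \<in> A \<Longrightarrow> g x \<in> G" for A and g :: "coord \<Rightarrow> qpoly"
    using that by (induction A rule: infinite_finite_induct) (use G_1 G_mult in auto)
  have G_sum: "(\<Sum>x\<in>A. g x) \<in> G" if "\<And>x. x \<in> A \<Longrightarrow> g x \<in> G" for A and g :: "_ \<Rightarrow> qpoly"
    using that
    by (induction A rule: infinite_finite_induct) (use G_0 add in \<open>auto simp: G_def\<close>)
  have single_sum: "Poly_Mapping.single (\<Sum>x\<in>A. e x) 1 = (\<Prod>x\<in>A. Poly_Mapping.single (e x) 1 :: qpoly)"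
    for A :: "coord set" and e
    by (induction A rule: infinite_finite_induct) (simp_all, metis mult_single mult_1)
  have single_power: "Poly_Mapping.single (Poly_Mapping.single x n) 1 = var x ^ n" for x n
  proof (induction n)
    case (Suc n)
    have "Poly_Mapping.single x (Suc n) = Poly_Mapping.single x 1 + Poly_Mapping.single x n"
      by (simp flip: single_add)
    then show ?case
      by (metis Suc mult_single mult_1 power_Suc var_def)
  qed simp
  have "Poly_Mapping.single m r \<in> G" if "Poly_Mapping.keys m \<subseteq> C" for m r
  proof -
    have "Poly_Mapping.single m (1::rat) =
        (\<Prod>x \<in> Poly_Mapping.keys m. var x ^ Poly_Mapping.lookup m x)"
      by (subst poly_mapping_sum_singles[of m]) (simp only: single_sum single_power)
    also have "\<dots> \<in> G"
      using that var by (intro G_prod G_power) (auto simp: G_def)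
    finally have "const r * Poly_Mapping.single m 1 \<in> G"
      using const by (intro G_mult) (auto simp: G_def)
    then show ?thesis
      by (simp add: const_def mult_single)
  qed
  then have "(\<Sum>m \<in> Poly_Mapping.keys p. Poly_Mapping.single m (Poly_Mapping.lookup p m)) \<in> G"
    using \<open>p \<in> polys_in C\<close> by (intro G_sum) (auto simp: polys_in_def)
  then show ?thesis
    using poly_mapping_sum_singles[of p] by (simp add: G_def)
qed

lemma unital_hom_eqI:
  assumes "unital_hom f" and "unital_hom g" and "p \<in> polys_in C"
    and "\<And>r. f (const r) = g (const r)" and "\<And>x. x \<in> C \<Longrightarrow> f (var x) = g (var x)"
  shows "f p = g p"
  using assms(3)
  by (induction p rule: polys_in_induct)
     (simp_all add: assms(4,5) unital_hom.add[OF assms(1)] unital_hom.add[OF assms(2)]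
        unital_hom.mult[OF assms(1)] unital_hom.mult[OF assms(2)])

lemma unital_hom_into:
  assumes "unital_hom f" and "p \<in> polys_in C" 
    and "\<And>r. f (const r) \<in> polys_in D" and "\<And>x. x \<in> C \<Longrightarrow> f (var x) \<in> polys_in D"
  shows "f p \<in> polys_in D"
  using assms(2)
  by (induction p rule: polys_in_induct)
     (simp_all add: assms(3,4) unital_hom.add[OF assms(1)] unital_hom.mult[OF assms(1)])

lemma substitute_in:
  assumes "p \<in> polys_in C" and "\<And>x. x \<in> C \<Longrightarrow> s x \<in> polys_in D"
  shows "substitute s p \<in> polys_in D"
  by (rule unital_hom_into[OF unital_hom_substitute assms(1)]) (use assms(2) in auto)

lemma polys_in_UNIV [simp]: "p \<in> polys_in UNIV"
  by (simp add: polys_in_def)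


section \<open>Ideals\<close>

text \<open>One ideal calculus serves the coordinate rings, the local rings inside the fraction
  field and, with carrier \<open>UNIV\<close>, the rings of univariate polynomials.\<close>

definition type_subring :: "'a::comm_ring_1 set \<Rightarrow> 'a ring" where
  "type_subring S = \<lparr>carrier = S, mult = (*), one = 1, zero = 0, add = (+)\<rparr>"

lemma type_subring_simps [simp]:
  "carrier (type_subring S) = S" "mult (type_subring S) = (*)" "one (type_subring S) = 1"
  "zero (type_subring S) = 0" "add (type_subring S) = (+)"
  by (simp_all add: type_subring_def)

definition closed_subring :: "'a::comm_ring_1 set \<Rightarrow> bool" where
  "closed_subring S \<longleftrightarrow> 1 \<in> S \<and> (\<forall>a \<in> S. \<forall>b \<in> S. a + b \<in> S \<and> a * b \<in> S \<and> - a \<in> S)"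

lemma closed_subring_zero: "closed_subring S \<Longrightarrow> 0 \<in> S"
  unfolding closed_subring_def by (metis add.right_inverse)

lemma cring_type_subring:
  assumes S: "closed_subring S"
  shows "cring (type_subring S)"
proof (rule cringI)
  show "abelian_group (type_subring S)"
    using S closed_subring_zero[OF S] unfolding closed_subring_def
    by (intro abelian_groupI) (auto simp: algebra_simps intro!: bexI[of _ "- x" for x])
  show "comm_monoid (type_subring S)"
    using S unfolding closed_subring_def
    by (intro comm_monoidI) (auto simp: algebra_simps)
qed (simp add: ring_distribs)

lemma ideal_type_subring_iff:
  assumes S: "closed_subring S"
  shows "ideal I (type_subring S) \<longleftrightarrow>
    I \<subseteq> S \<and> 0 \<in> I \<and> (\<forall>a \<in> I. \<forall>b \<in> I. a + b \<in> I) \<and> (\<forall>a \<in> I. \<forall>b \<in> S. b * a \<in> I)"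
    (is "_ \<longleftrightarrow> ?rhs")
proof
  interpret cring "type_subring S"
    by (rule cring_type_subring[OF S])
  show ?rhs if "ideal I (type_subring S)"
  proof -
    interpret I: ideal I "type_subring S" by fact
    show ?thesis
      using I.a_subset I.zero_closed I.a_closed I.I_l_closed by auto
  qed
  show "ideal I (type_subring S)" if I: ?rhs
  proof (rule idealI[OF ring_axioms])
    have minus: "\<ominus>\<^bsub>type_subring S\<^esub> a = - a" if "a \<in> S" for a
      using that S by (intro minus_equality) (auto simp: closed_subring_def)
    have "- a \<in> I" if "a \<in> I" for a
    proof -
      have "- 1 * a \<in> I"
        using I S that unfolding closed_subring_def by blast
      then show ?thesis by simp
    qed
    then show "subgroup I (add_monoid (type_subring S))"
      using I minus by (intro add.subgroupI) (auto simp: a_inv_def subset_iff)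
  qed (use I in \<open>auto simp: mult.commute\<close>)
qed

lemma primeideal_type_subring_iff:
  assumes S: "closed_subring S"
  shows "primeideal I (type_subring S) \<longleftrightarrow> ideal I (type_subring S) \<and> 1 \<notin> I \<and>
    (\<forall>a \<in> S. \<forall>b \<in> S. a * b \<in> I \<longrightarrow> a \<in> I \<or> b \<in> I)" (is "_ \<longleftrightarrow> ?rhs")
proof
  show ?rhs if "primeideal I (type_subring S)"
  proof -
    interpret primeideal I "type_subring S" by fact
    show ?thesis
      using is_ideal I_notcarr I_prime one_imp_carrier by auto
  qed
  show "primeideal I (type_subring S)" if ?rhs
    using that S
    by (intro primeidealI cring_type_subring) (auto simp: closed_subring_def)
qed

lemma coord_ring_type_subring: "coord_ring a n = type_subring (polys_in (coords a n))"
  by (simp add: type_subring_def coord_ring_def polys_in_def)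

lemma closed_subring_polys_in: "closed_subring (polys_in C)"
  by (simp add: closed_subring_def)

lemmas ideal_coord_ring_iff =
  ideal_type_subring_iff[OF closed_subring_polys_in, of _ "coords a n", folded coord_ring_type_subring] for a n

lemmas primeideal_coord_ring_iff =
  primeideal_type_subring_iff[OF closed_subring_polys_in, of _ "coords a n", folded coord_ring_type_subring] for a n

lemma cring_coord_ring: "cring (coord_ring a n)"
  unfolding coord_ring_type_subring by (rule cring_type_subring[OF closed_subring_polys_in])

lemma ring_coord_ring: "ring (coord_ring a n)"
  using cring_coord_ring cring.axioms(1) by blast

lemma primeidealD:
  assumes "primeideal P (coord_ring a n)"
  shows "P \<subseteq> polys_in (coords a n)" "0 \<in> P" "1 \<notin> P"
    "p \<in> P \<Longrightarrow> q \<in> P \<Longrightarrow> p + q \<in> P"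
    "p \<in> P \<Longrightarrow> q \<in> P \<Longrightarrow> p - q \<in> P"
    "p \<in> P \<Longrightarrow> q \<in> polys_in (coords a n) \<Longrightarrow> q * p \<in> P"
    "p \<in> P \<Longrightarrow> q \<in> polys_in (coords a n) \<Longrightarrow> p * q \<in> P"
    "p \<in> polys_in (coords a n) \<Longrightarrow> q \<in> polys_in (coords a n) \<Longrightarrow> p * q \<in> P \<Longrightarrow> p \<in> P \<or> q \<in> P"
proof -
  have *: "ideal P (coord_ring a n)" and prime: "1 \<notin> P"
      "\<And>p q. p \<in> polys_in (coords a n) \<Longrightarrow> q \<in> polys_in (coords a n) \<Longrightarrow> p * q \<in> P \<Longrightarrow> p \<in> P \<or> q \<in> P"
    using assms by (auto simp: primeideal_coord_ring_iff)
  have ideal: "P \<subseteq> polys_in (coords a n)" "0 \<in> P" "\<And>p q. p \<in> P \<Longrightarrow> q \<in> P \<Longrightarrow> p + q \<in> P"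
     "\<And>p q. p \<in> P \<Longrightarrow> q \<in> polys_in (coords a n) \<Longrightarrow> q * p \<in> P"
    using * by (auto simp: ideal_coord_ring_iff)
  show "P \<subseteq> polys_in (coords a n)" "0 \<in> P" "1 \<notin> P"
    "p \<in> P \<Longrightarrow> q \<in> P \<Longrightarrow> p + q \<in> P"
    "p \<in> P \<Longrightarrow> q \<in> polys_in (coords a n) \<Longrightarrow> q * p \<in> P"
    "p \<in> P \<Longrightarrow> q \<in> polys_in (coords a n) \<Longrightarrow> p * q \<in> P"
    "p \<in> polys_in (coords a n) \<Longrightarrow> q \<in> polys_in (coords a n) \<Longrightarrow> p * q \<in> P \<Longrightarrow> p \<in> P \<or> q \<in> P"
    by (simp_all add: ideal prime mult.commute[of p q])
  show "p - q \<in> P" if "p \<in> P" "q \<in> P"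
    using ideal(3)[OF that(1) ideal(4)[OF that(2), of "- 1"]] by simp
qed

section \<open>Ideals of coordinate rings given by generators\<close>

abbreviation gen :: "nat \<Rightarrow> nat \<Rightarrow> qpoly set \<Rightarrow> qpoly set" where
  "gen a n G \<equiv> genideal (coord_ring a n) G"

context
  fixes a n :: nat and G :: "qpoly set"
  assumes G: "G \<subseteq> polys_in (coords a n)"
begin

lemma ideal_gen: "ideal (gen a n G) (coord_ring a n)"
  by (rule ring.genideal_ideal[OF ring_coord_ring]) (simp add: G)

lemma gen_superset: "G \<subseteq> gen a n G"
  by (rule ring.genideal_self[OF ring_coord_ring]) (simp add: G)

lemma gen_memI: "p \<in> G \<Longrightarrow> p \<in> gen a n G"
  using gen_superset by blast

lemma gen_subset_polys_in: "gen a n G \<subseteq> polys_in (coords a n)"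
  using ideal_gen by (simp add: ideal_coord_ring_iff)

lemma gen_0: "0 \<in> gen a n G"
  using ideal_gen by (simp add: ideal_coord_ring_iff)

lemma gen_add: "p \<in> gen a n G \<Longrightarrow> q \<in> gen a n G \<Longrightarrow> p + q \<in> gen a n G"
  using ideal_gen by (simp add: ideal_coord_ring_iff)

lemma gen_mult: "p \<in> gen a n G \<Longrightarrow> q \<in> polys_in (coords a n) \<Longrightarrow> q * p \<in> gen a n G"
  using ideal_gen by (simp add: ideal_coord_ring_iff)

lemma gen_diff: "p \<in> gen a n G \<Longrightarrow> q \<in> gen a n G \<Longrightarrow> p - q \<in> gen a n G"
  using gen_add[of p "- 1 * q"] gen_mult[of q "- 1"] by simp

end

lemma gen_least: "ideal I (coord_ring a n) \<Longrightarrow> G \<subseteq> I \<Longrightarrow> gen a n G \<subseteq> I"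
  by (rule ring.genideal_minimal[OF ring_coord_ring])

lemma gen_eqI:
  assumes "G \<subseteq> polys_in (coords a n)" and "H \<subseteq> polys_in (coords a n)"
    and "G \<subseteq> gen a n H" and "H \<subseteq> gen a n G"
  shows "gen a n G = gen a n H"
  using assms by (intro equalityI gen_least ideal_gen)

lemma gen_hom_preimage:
  assumes \<phi>: "unital_hom \<phi>" and into: "\<And>p. p \<in> polys_in (coords a n) \<Longrightarrow> \<phi> p \<in> polys_in (coords b m)"
    and I: "ideal I (coord_ring b m)"
  shows "ideal {p \<in> polys_in (coords a n). \<phi> p \<in> I} (coord_ring a n)"
  using I into unfolding ideal_coord_ring_iff
  by (auto simp: unital_hom.simps[OF \<phi>])

text \<open>Pull-backs are defined with the image of a whole prime ideal; this reduces them to the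
  images of generators. Two homomorphisms occur because an exterior product joins equations coming
  from both factors.\<close>

lemma gen_image_gen:
  assumes \<phi>: "unital_hom \<phi>" and into: "\<And>p. p \<in> polys_in (coords a n) \<Longrightarrow> \<phi> p \<in> polys_in (coords b m)"
    and \<psi>: "unital_hom \<psi>" and into': "\<And>p. p \<in> polys_in (coords a' n') \<Longrightarrow> \<psi> p \<in> polys_in (coords b m)"
    and G: "G \<subseteq> polys_in (coords a n)" and H: "H \<subseteq> polys_in (coords a' n')"
  shows "gen b m (\<phi> ` gen a n G \<union> \<psi> ` gen a' n' H) = gen b m (\<phi> ` G \<union> \<psi> ` H)"
proof (rule gen_eqI)
  let ?I = "gen b m (\<phi> ` G \<union> \<psi> ` H)"
  show sub: "\<phi> ` gen a n G \<union> \<psi> ` gen a' n' H \<subseteq> polys_in (coords b m)"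
    using gen_subset_polys_in[OF G] gen_subset_polys_in[OF H] into into' by blast
  show sub': "\<phi> ` G \<union> \<psi> ` H \<subseteq> polys_in (coords b m)"
    using G H into into' by blast
  have "gen a n G \<subseteq> {p \<in> polys_in (coords a n). \<phi> p \<in> ?I}"
    using G gen_superset[OF sub'] by (intro gen_least gen_hom_preimage[OF \<phi> into ideal_gen[OF sub']]) auto
  moreover have "gen a' n' H \<subseteq> {p \<in> polys_in (coords a' n'). \<psi> p \<in> ?I}"
    using H gen_superset[OF sub'] by (intro gen_least gen_hom_preimage[OF \<psi> into' ideal_gen[OF sub']]) auto
  ultimately show "\<phi> ` gen a n G \<union> \<psi> ` gen a' n' H \<subseteq> ?I"
    by blast
  show "\<phi> ` G \<union> \<psi> ` H \<subseteq> gen b m (\<phi> ` gen a n G \<union> \<psi> ` gen a' n' H)"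
    using gen_superset[OF G] gen_superset[OF H] gen_superset[OF sub] by blast
qed

lemma gen_image_gen1:
  assumes \<phi>: "unital_hom \<phi>" and into: "\<And>p. p \<in> polys_in (coords a n) \<Longrightarrow> \<phi> p \<in> polys_in (coords b m)"
    and G: "G \<subseteq> polys_in (coords a n)"
  shows "gen b m (\<phi> ` gen a n G) = gen b m (\<phi> ` G)"
  using gen_image_gen[OF \<phi> into \<phi> into G G] by simp


section \<open>Multiplicities\<close>

text \<open>The point is that \<open>G\<close> generates the maximal ideal of \<open>R\<^sub>Q\<close>: above it there is only the
  unit ideal, which the chains in the definition of the length are allowed to contain.\<close>

lemma local_length_eq_1:
  assumes Q: "primeideal Q (coord_ring a n)" and GQ: "gen a n G = Q" and G: "G \<subseteq> polys_in (coords a n)"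
  shows "local_length (coord_ring a n) Q G = 1"
proof -
  note Q' = primeidealD[OF Q]
  let ?R = "polys_in (coords a n)"
  define S where "S = {Fract f g | f g. f \<in> ?R \<and> g \<in> ?R - Q}"
  define M where "M = {Fract f g | f g. f \<in> Q \<and> g \<in> ?R - Q}"
  have L: "local_ring (coord_ring a n) Q = type_subring S"
    by (simp add: local_ring_def type_subring_def S_def)
  have nz: "g \<noteq> 0" if "g \<in> ?R - Q" for g
    using that Q'(2) by auto
  have mem: "f * g \<in> ?R - Q" if "f \<in> ?R - Q" "g \<in> ?R - Q" for f g
    using that Q'(8)[of f g] by auto
  have S_memI: "Fract k l \<in> S" if "k \<in> ?R" "l \<in> ?R - Q" for k l
    using that unfolding S_def by blast
  have "closed_subring S"
    unfolding closed_subring_def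
  proof (intro conjI ballI)
    show "1 \<in> S"
      using Q'(3) unfolding S_def One_fract_def by (intro CollectI exI[of _ 1]) simp
    fix x y assume "x \<in> S" "y \<in> S"
    then obtain f g f' g' where x: "x = Fract f g" "f \<in> ?R" "g \<in> ?R - Q"
        and y: "y = Fract f' g'" "f' \<in> ?R" "g' \<in> ?R - Q"
      by (auto simp: S_def)
    note gg = mem[OF x(3) y(3)]
    have "x + y = Fract (f * g' + f' * g) (g * g')" "x * y = Fract (f * f') (g * g')" "- x = Fract (- f) g"
      using nz[OF x(3)] nz[OF y(3)] by (simp_all add: x y)
    then show "x + y \<in> S" "x * y \<in> S" "- x \<in> S"
      using gg x y by (auto intro!: S_memI)
  qed
  note ideal_iff = ideal_type_subring_iff[OF this]
  have M: "ideal M (type_subring S)"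
    unfolding ideal_iff
  proof (intro conjI ballI)
    show "M \<subseteq> S"
      using Q'(1) by (auto simp: M_def S_def)
    show "0 \<in> M"
      using Q'(2,3) polys_in_1[of "coords a n"] unfolding M_def Zero_fract_def by blast
    fix x assume "x \<in> M"
    then obtain f g where x: "x = Fract f g" "f \<in> Q" "g \<in> ?R - Q"
      by (auto simp: M_def)
    {
      fix y assume "y \<in> M"
      then obtain f' g' where y: "y = Fract f' g'" "f' \<in> Q" "g' \<in> ?R - Q"
        by (auto simp: M_def)
      have "x + y = Fract (f * g' + f' * g) (g * g')"
        using nz[OF x(3)] nz[OF y(3)] by (simp add: x y)
      moreover have "f * g' + f' * g \<in> Q"
        using x y by (auto intro!: Q'(4,7))
      ultimately show "x + y \<in> M"
        using mem[OF x(3) y(3)] unfolding M_def by blast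
    }
    fix y assume "y \<in> S"
    then obtain f' g' where y: "y = Fract f' g'" "f' \<in> ?R" "g' \<in> ?R - Q"
      by (auto simp: S_def)
    have "y * x = Fract (f' * f) (g' * g)"
      by (simp add: x y)
    then show "y * x \<in> M"
      using mem[OF y(3) x(3)] Q'(6)[OF x(2) y(2)] unfolding M_def by blast
  qed
  have "1 \<notin> M"
  proof
    assume "1 \<in> M"
    then obtain f g where "1 = Fract f g" "f \<in> Q" "g \<in> ?R - Q"
      by (auto simp: M_def)
    then show False
      using nz[of g] by (auto simp: One_fract_def eq_fract)
  qed
  have S: "ideal S (type_subring S)"
    using \<open>closed_subring S\<close> closed_subring_zero by (auto simp: ideal_iff closed_subring_def)
  let ?chain = "\<lambda>k J. (\<forall>i \<le> k. ideal (J i) (type_subring S)) \<and>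
                   genideal (type_subring S) (to_frac ` G) \<subseteq> J 0 \<and>
                   (\<forall>i < k. J i \<subset> J (Suc i))"
  show ?thesis
    unfolding local_length_def L
  proof (rule cSup_eq_maximum)
    have "to_frac ` G \<subseteq> M"
    proof -
      have "G \<subseteq> Q"
        using gen_superset[OF G] GQ by simp
      then show ?thesis
        using Q'(3) polys_in_1[of "coords a n"] unfolding M_def to_frac_def by blast
    qed
    then have "genideal (type_subring S) (to_frac ` G) \<subseteq> M"
      using M unfolding genideal_def by auto
    moreover have "M \<subset> S"
      using \<open>1 \<notin> M\<close> \<open>closed_subring S\<close> M by (auto simp: ideal_iff closed_subring_def)
    ultimately have "?chain 1 (\<lambda>i. if i = 0 then M else S)"
      using M S by auto
    then show "1 \<in> {k | k J. ?chain k J}"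
      by (intro CollectI exI[of _ 1] exI[of _ "\<lambda>i. if i = 0 then M else S"]) simp
    fix k assume "k \<in> {k | k J. ?chain k J}"
    then obtain J where J: "\<And>i. i \<le> k \<Longrightarrow> ideal (J i) (type_subring S)"
        "genideal (type_subring S) (to_frac ` G) \<subseteq> J 0"
        "\<And>i. i < k \<Longrightarrow> J i \<subset> J (Suc i)"
      by (elim CollectE exE conjE) auto
    \<comment> \<open>The elements of the coordinate ring that lie in \<open>J 0\<close> form an
      ideal containing \<open>G\<close>, hence containing \<open>Q\<close>.\<close>
    have "M \<subseteq> J 0"
    proof
      have J0: "ideal (J 0) (type_subring S)"
        using J(1) by simp
      have "ideal {p \<in> ?R. to_frac p \<in> J 0} (coord_ring a n)"
        unfolding ideal_coord_ring_iff
      proof (intro conjI ballI CollectI)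
        fix p q assume p: "p \<in> {p \<in> ?R. to_frac p \<in> J 0}"
        {
          assume "q \<in> {p \<in> ?R. to_frac p \<in> J 0}"
          then show "to_frac (p + q) \<in> J 0"
            using p J0 by (simp add: ideal_iff unital_hom.simps[OF unital_hom_to_frac])
        }
        assume "q \<in> ?R"
        then have "to_frac q \<in> S"
          using Q'(3) polys_in_1[of "coords a n"] unfolding S_def to_frac_def by blast
        then show "to_frac (q * p) \<in> J 0"
          using p J0 by (simp add: ideal_iff unital_hom.simps[OF unital_hom_to_frac])
      qed (use J0 in \<open>auto simp: ideal_iff unital_hom.simps[OF unital_hom_to_frac]\<close>)
      moreover have "to_frac ` G \<subseteq> J 0"
        using J(2) unfolding genideal_def by blast
      ultimately have "gen a n G \<subseteq> {p \<in> ?R. to_frac p \<in> J 0}"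
        using G by (intro gen_least) auto
      then have Q_J0: "to_frac f \<in> J 0" if "f \<in> Q" for f
        using that GQ by auto
      fix x assume "x \<in> M"
      then obtain f g where x: "x = Fract f g" "f \<in> Q" "g \<in> ?R - Q"
        by (auto simp: M_def)
      have "Fract 1 g \<in> S"
        using x(3) by (intro S_memI) auto
      then have "Fract 1 g * to_frac f \<in> J 0"
        using Q_J0[OF x(2)] J0 by (simp add: ideal_iff)
      then show "x \<in> J 0"
        by (simp add: x to_frac_def)
    qed
    show "k \<le> 1"
    proof (rule ccontr)
      assume "\<not> k \<le> 1"
      then have k: "J 0 \<subset> J 1" "J 1 \<subset> J 2" "ideal (J 1) (type_subring S)" "ideal (J 2) (type_subring S)"
        using J(3)[of 0] J(3)[of 1] J(1)[of 1] J(1)[of 2] by (auto simp: numeral_2_eq_2)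
      \<comment> \<open>Outside \<open>M\<close> every element of the local ring is a unit, so
        \<open>J 1\<close> is already the whole ring.\<close>
      from k(1) obtain x where x: "x \<in> J 1" "x \<notin> J 0"
        by blast
      then have "x \<in> S" "x \<notin> M"
        using k(3) \<open>M \<subseteq> J 0\<close> by (auto simp: ideal_iff)
      then obtain f g where fg: "x = Fract f g" "f \<in> ?R - Q" "g \<in> ?R - Q"
        by (auto simp: S_def M_def)
      then have "Fract g f \<in> S"
        by (intro S_memI) auto
      then have "Fract g f * x \<in> J 1"
        using x(1) k(3) by (simp add: ideal_iff)
      moreover have "Fract g f * x = 1"
        using nz fg by (simp add: One_fract_def eq_fract)
      ultimately have "S \<subseteq> J 1"
        using k(3) unfolding ideal_iff by (metis mult.right_neutral subsetI)
      then show False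
        using k(2,4) by (auto simp: ideal_iff)
    qed
  qed
qed

text \<open>Primality of the generated ideal settles support and multiplicity together: every point
  containing \<open>G\<close> contains \<open>Q\<close>, and \<open>G\<close> generates the maximal
  ideal of the local ring at \<open>Q\<close>.\<close>

lemma scheme_cycle_prime:
  assumes Q: "primeideal Q (coord_ring a n)" and GQ: "gen a n G = Q" and G: "G \<subseteq> polys_in (coords a n)"
    and "Q \<in> U" and "U \<subseteq> Spec (coord_ring a n)"
  shows "scheme_cycle (coord_ring a n) U G = Poly_Mapping.single Q 1"
proof -
  have "G \<subseteq> Q"
    using gen_superset[OF G] GQ by simp
  moreover have "Q \<subseteq> P" if "P \<in> U" "G \<subseteq> P" for P
    using gen_least[of P a n G] that assms primeideal.axioms(1)[of P] by (auto simp: Spec_def)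
  ultimately have "irred_components {Q \<in> U. G \<subseteq> Q} = {Q}"
    using \<open>Q \<in> U\<close> unfolding irred_components_def by blast
  then show ?thesis
    by (simp add: scheme_cycle_def local_length_eq_1[OF Q GQ G])
qed

lemma scheme_cycle_empty:
  assumes "\<And>Q. Q \<in> U \<Longrightarrow> \<not> G \<subseteq> Q"
  shows "scheme_cycle R U G = 0"
proof -
  have "{Q \<in> U. G \<subseteq> Q} = {}"
    using assms by blast
  then show ?thesis
    unfolding scheme_cycle_def irred_components_def by (simp only:) simp
qed

lemma scheme_cycle_unit:
  assumes "1 \<in> gen a n G" and "U \<subseteq> Spec (coord_ring a n)"
  shows "scheme_cycle (coord_ring a n) U G = 0"
proof (rule scheme_cycle_empty)
  fix Q assume "Q \<in> U"
  then have Q: "primeideal Q (coord_ring a n)"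
    using assms(2) by (auto simp: Spec_def)
  show "\<not> G \<subseteq> Q"
    using gen_least[OF primeideal.axioms(1)[OF Q], of G] primeidealD(3)[OF Q] assms(1) by blast
qed


section \<open>Graphs\<close>

text \<open>The closed subvariety on which the coordinates outside \<open>B\<close> are given by \<open>w c = 1 / h c\<close>.\<close>

locale graph =
  fixes a n :: nat and B :: "coord set" and w h :: "coord \<Rightarrow> qpoly"
  assumes B: "B \<subseteq> coords a n"
    and h_in: "\<And>c. c \<in> coords a n - B \<Longrightarrow> h c \<in> polys_in B"
    and h_nz: "\<And>c. c \<in> coords a n - B \<Longrightarrow> h c \<noteq> 0"
    and w: "\<And>c. c \<in> coords a n - B \<Longrightarrow> w c = var c \<or> w c = 1 - var c"
begin

definition gens :: "qpoly set" where
  "gens = (\<lambda>c. w c * h c - 1) ` (coords a n - B)"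

text \<open>Evaluation at the generic point of the graph: a coordinate outside \<open>B\<close>
  takes its value as a rational function of the coordinates in \<open>B\<close>.\<close>

definition ev :: "qpoly \<Rightarrow> qpoly fract" where
  "ev = eval_poly (\<lambda>r. to_frac (const r))
     (\<lambda>c. if c \<in> coords a n - B
          then if w c = var c then 1 / to_frac (h c) else 1 - 1 / to_frac (h c)
          else to_frac (var c))"

lemma polys_in_B: "polys_in B \<subseteq> polys_in (coords a n)"
  using B by (rule polys_in_mono)

lemma gens_in: "gens \<subseteq> polys_in (coords a n)"
proof -
  have "w c * h c - 1 \<in> polys_in (coords a n)" if "c \<in> coords a n - B" for c
    using w[OF that] h_in[OF that] polys_in_B that by auto
  then show ?thesis
    by (auto simp: gens_def)
qed

lemma unital_hom_frac_const: "unital_hom (\<lambda>r. to_frac (const r))"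
  by (rule unital_hom_comp[OF unital_hom_to_frac unital_hom_const])

lemma unital_hom_ev: "unital_hom ev"
  unfolding ev_def by (rule unital_hom_eval_poly[OF unital_hom_frac_const])

lemmas ev_simps = unital_hom.simps[OF unital_hom_ev]

lemma ev_base: "p \<in> polys_in B \<Longrightarrow> ev p = to_frac p"
  by (rule unital_hom_eqI[OF unital_hom_ev unital_hom_to_frac])
     (assumption, auto simp: ev_def eval_poly_const[OF unital_hom_frac_const] eval_poly_var[OF unital_hom_frac_const])

lemma ideal_ev: "ideal {p \<in> polys_in (coords a n). ev p = 0} (coord_ring a n)"
  by (auto simp: ideal_coord_ring_iff ev_simps)

lemma ev_gens: "p \<in> gens \<Longrightarrow> ev p = 0"
proof -
  assume "p \<in> gens"
  then obtain c where c: "c \<in> coords a n - B" and p: "p = w c * h c - 1"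
    by (auto simp: gens_def)
  have "ev (w c) = 1 / to_frac (h c)"
    using c w[OF c] unital_hom_frac_const
    by (cases "w c = var c") (auto simp: ev_def unital_hom.simps[OF unital_hom_eval_poly])
  then show ?thesis
    using h_nz[OF c] by (simp add: p ev_simps ev_base[OF h_in[OF c]])
qed

text \<open>Modulo \<open>gens\<close> a coordinate outside \<open>B\<close> is 1 / h or (h - 1) /
  h, so it becomes a polynomial in \<open>B\<close> after multiplication by \<open>h c\<close>. The
  multiplicative set \<open>S\<close> is left open because it has two uses: denominators invertible
  modulo \<open>gens\<close>, and denominators outside a given prime.\<close>

lemma clear_denominators:
  assumes "p \<in> polys_in (coords a n)"
    and S1: "1 \<in> S" and S_mult: "\<And>H K. H \<in> S \<Longrightarrow> K \<in> S \<Longrightarrow> H * K \<in> S" and S: "S \<subseteq> polys_in B"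
    and h: "\<And>c. c \<in> coords a n - B \<Longrightarrow> h c \<in> S"
  shows "\<exists>H b. H \<in> S \<and> b \<in> polys_in B \<and> H * p - b \<in> gen a n gens"
  using assms(1)
proof (induction p rule: polys_in_induct)
  case (const r)
  show ?case
    using S1 by (intro exI[of _ 1] exI[of _ "const r"]) (simp add: gen_0[OF gens_in])
next
  case (var c)
  show ?case
  proof (cases "c \<in> B")
    case True
    then show ?thesis
      using S1 by (intro exI[of _ 1] exI[of _ "var c"]) (simp add: gen_0[OF gens_in])
  next
    case False
    then have c: "c \<in> coords a n - B"
      using var by simp
    then have I: "w c * h c - 1 \<in> gen a n gens"
      by (intro gen_memI[OF gens_in]) (simp add: gens_def)
    have hB: "h c - 1 \<in> polys_in B"
      using h_in[OF c] by simp
    from w[OF c] show ?thesis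
    proof
      assume "w c = var c"
      then show ?thesis
        using I h[OF c] by (intro exI[of _ "h c"] exI[of _ 1]) (simp add: mult.commute)
    next
      assume w_c: "w c = 1 - var c"
      have "h c * var c - (h c - 1) = - 1 * (w c * h c - 1)"
        by (simp only: w_c) (simp add: algebra_simps)
      moreover have "- 1 * (w c * h c - 1) \<in> gen a n gens"
        by (intro gen_mult[OF gens_in] I) simp
      ultimately show ?thesis
        using hB h[OF c] by (intro exI[of _ "h c"] exI[of _ "h c - 1"] conjI) (simp_all only:)
    qed
  qed
next
  case (add p q)
  then obtain H b K d where Hb: "H \<in> S" "b \<in> polys_in B" "H * p - b \<in> gen a n gens"
    and Kd: "K \<in> S" "d \<in> polys_in B" "K * q - d \<in> gen a n gens"
    by blast
  have "H \<in> polys_in (coords a n)" "K \<in> polys_in (coords a n)"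
    using Hb(1) Kd(1) S polys_in_B by auto
  then have "K * (H * p - b) + H * (K * q - d) \<in> gen a n gens"
    by (intro gen_add[OF gens_in] gen_mult[OF gens_in] Hb Kd)
  moreover have "K * (H * p - b) + H * (K * q - d) = (H * K) * (p + q) - (K * b + H * d)"
    by (simp add: algebra_simps)
  moreover have "K * b + H * d \<in> polys_in B"
    using Hb(2) Kd(2) subsetD[OF S Hb(1)] subsetD[OF S Kd(1)] by simp
  ultimately show ?case
    using S_mult[OF Hb(1) Kd(1)]
    by (intro exI[of _ "H * K"] exI[of _ "K * b + H * d"] conjI) (simp_all only:)
next
  case (mult p q)
  then obtain H b K d where Hb: "H \<in> S" "b \<in> polys_in B" "H * p - b \<in> gen a n gens"
    and Kd: "K \<in> S" "d \<in> polys_in B" "K * q - d \<in> gen a n gens"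
    by blast
  have "K * q \<in> polys_in (coords a n)" "b \<in> polys_in (coords a n)"
    using Hb(2) Kd(1) S polys_in_B mult by auto
  then have "(K * q) * (H * p - b) + b * (K * q - d) \<in> gen a n gens"
    by (intro gen_add[OF gens_in] gen_mult[OF gens_in] Hb Kd)
  moreover have "(K * q) * (H * p - b) + b * (K * q - d) = (H * K) * (p * q) - b * d"
    by (simp add: algebra_simps)
  moreover have "b * d \<in> polys_in B"
    using Hb Kd by simp
  ultimately show ?case
    using S_mult[OF Hb(1) Kd(1)]
    by (intro exI[of _ "H * K"] exI[of _ "b * d"] conjI) (simp_all only:)
qed

lemma gen_eq_kernel: "gen a n gens = {p \<in> polys_in (coords a n). ev p = 0}"
proof
  show "gen a n gens \<subseteq> {p \<in> polys_in (coords a n). ev p = 0}"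
    using gens_in ev_gens by (intro gen_least ideal_ev) auto
  then have ev_gen: "ev p = 0" if "p \<in> gen a n gens" for p
    using that by auto
  \<comment> \<open>The denominators that the generators already make invertible; each
    \<open>h c\<close> is one of them.\<close>
  define S where "S = {H \<in> polys_in B. \<exists>u \<in> polys_in (coords a n). H * u - 1 \<in> gen a n gens}"
  have S_mult: "H * K \<in> S" if HK: "H \<in> S" "K \<in> S" for H K
  proof -
    obtain u v where u: "u \<in> polys_in (coords a n)" "H * u - 1 \<in> gen a n gens"
      and v: "v \<in> polys_in (coords a n)" "K * v - 1 \<in> gen a n gens"
      using HK by (auto simp: S_def)
    have "(K * v) * (H * u - 1) + (K * v - 1) \<in> gen a n gens"
      using HK polys_in_B u v
      by (intro gen_add[OF gens_in] gen_mult[OF gens_in]) (auto simp: S_def)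
    moreover have "(K * v) * (H * u - 1) + (K * v - 1) = (H * K) * (u * v) - 1"
      by (simp add: algebra_simps)
    ultimately show ?thesis
      using HK u v unfolding S_def by (intro CollectI conjI bexI[of _ "u * v"]) auto
  qed
  have h: "h c \<in> S" if "c \<in> coords a n - B" for c
  proof -
    have "w c * h c - 1 \<in> gen a n gens"
      using that by (intro gen_memI[OF gens_in]) (simp add: gens_def)
    moreover have "w c \<in> polys_in (coords a n)"
      using w[OF that] that by auto
    ultimately show ?thesis
      using h_in[OF that] by (auto simp: S_def mult.commute intro!: bexI[of _ "w c"])
  qed
  have S1: "1 \<in> S"
    by (auto simp: S_def gen_0[OF gens_in] intro!: bexI[of _ 1])
  show "{p \<in> polys_in (coords a n). ev p = 0} \<subseteq> gen a n gens"
  proof (intro subsetI)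
    fix p assume p: "p \<in> {p \<in> polys_in (coords a n). ev p = 0}"
    obtain H b where H: "H \<in> S" "b \<in> polys_in B" "H * p - b \<in> gen a n gens"
      using clear_denominators[of p S] p S1 S_mult h by (auto simp: S_def)
    have "b = 0"
      using ev_gen[OF H(3)] p ev_base[OF H(2)] by (simp add: ev_simps)
    obtain u where u: "u \<in> polys_in (coords a n)" "H * u - 1 \<in> gen a n gens"
      using H(1) by (auto simp: S_def)
    have "u * (H * p) - p * (H * u - 1) \<in> gen a n gens"
      using u H p \<open>b = 0\<close> by (intro gen_diff[OF gens_in gen_mult[OF gens_in] gen_mult[OF gens_in]]) auto
    then show "p \<in> gen a n gens"
      by (simp add: algebra_simps)
  qed
qed

lemma prime_gen: "primeideal (gen a n gens) (coord_ring a n)"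
  unfolding primeideal_coord_ring_iff gen_eq_kernel using ideal_ev by (auto simp: ev_simps)

lemma gen_base: "p \<in> polys_in B \<Longrightarrow> p \<in> gen a n gens \<longleftrightarrow> p = 0"
  using subsetD[OF polys_in_B, of p] unfolding gen_eq_kernel by (simp add: ev_base)

end


section \<open>Linear maps on cycles\<close>

lemma lookup_scale [simp]: "Poly_Mapping.lookup (scale q z) k = q * Poly_Mapping.lookup z k"
  by (simp add: scale_def Poly_Mapping.map.rep_eq when_def)

lemma scale_0 [simp]: "scale q 0 = 0" and scale_0_left [simp]: "scale 0 z = 0"
  and scale_1 [simp]: "scale 1 z = z" and scale_scale [simp]: "scale q (scale r z) = scale (q * r) z"
  and scale_minus_left [simp]: "scale (- q) z = - scale q z"
  and scale_minus_right [simp]: "scale q (- z) = - scale q z"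
  and scale_add_right: "scale q (z + z') = scale q z + scale q z'"
  and scale_diff_right: "scale q (z - z') = scale q z - scale q z'"
  and scale_add_left: "scale (q + r) z = scale q z + scale r z"
  by (rule poly_mapping_eqI; simp add: lookup_add lookup_minus algebra_simps)+

lemma scale_sum: "scale q (\<Sum>x\<in>A. f x) = (\<Sum>x\<in>A. scale q (f x))"
  by (induction A rule: infinite_finite_induct) (simp_all add: scale_add_right)

lemma sum_scale_const: "(\<Sum>x\<in>A. scale q z) = scale (of_nat (card A) * q) z"
  by (induction A rule: infinite_finite_induct) (simp_all add: scale_add_left ring_distribs)

locale cycle_linear =
  fixes F :: "cycle \<Rightarrow> cycle"
  assumes add: "F (z + z') = F z + F z'"
    and scale: "F (scale q z) = scale q (F z)"
begin

lemma zero: "F 0 = 0"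
  using scale[of 0 0] by simp

lemma sum: "F (\<Sum>x\<in>A. f x) = (\<Sum>x\<in>A. F (f x))"
  by (induction A rule: infinite_finite_induct) (simp_all add: add zero)

end

lemma lin_ext_superset:
  assumes "finite K" and "Poly_Mapping.keys z \<subseteq> K"
  shows "lin_ext f z = (\<Sum>Z\<in>K. Defs.scale (Poly_Mapping.lookup z Z) (f Z))"
  unfolding lin_ext_def
  by (rule sum.mono_neutral_left) (use assms in \<open>auto simp: in_keys_iff\<close>)

lemma cycle_linear_lin_ext: "cycle_linear (lin_ext f)"
proof
  show "lin_ext f (z + z') = lin_ext f z + lin_ext f z'" for z z'
    by (subst (1 2 3) lin_ext_superset[where K = "Poly_Mapping.keys z \<union> Poly_Mapping.keys z'"])
       (auto simp: lookup_add scale_add_left sum.distrib dest: subsetD[OF Poly_Mapping.keys_add])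
  show "lin_ext f (scale q z) = scale q (lin_ext f z)" for q z
    by (subst (1 2) lin_ext_superset[where K = "Poly_Mapping.keys z"])
       (auto simp: scale_sum in_keys_iff)
qed

lemma lin_ext_single [simp]: "lin_ext f (Poly_Mapping.single Z q) = scale q (f Z)"
  by (subst lin_ext_superset[where K = "{Z}"]) auto

lemma cycle_linear_sum_maps:
  "(\<And>i. i \<in> A \<Longrightarrow> cycle_linear (F i)) \<Longrightarrow> cycle_linear (\<lambda>z. \<Sum>i\<in>A. F i z)"
  by (auto simp: cycle_linear_def sum.distrib scale_sum)

lemma cycle_linear_scale: "cycle_linear F \<Longrightarrow> cycle_linear (\<lambda>z. scale q (F z))"
  by (auto simp: cycle_linear_def scale_add_right mult.commute)

lemma cycle_linear_diff: "cycle_linear F \<Longrightarrow> cycle_linear G \<Longrightarrow> cycle_linear (\<lambda>z. F z - G z)"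
  by (auto simp: cycle_linear_def scale_diff_right)

lemma cycle_linear_pull_back: "cycle_linear (pull_back R U \<phi>)"
  unfolding pull_back_def by (rule cycle_linear_lin_ext)

lemma cycle_linear_Alt: "cycle_linear (Alt n)"
  unfolding Alt_def by (intro cycle_linear_scale cycle_linear_sum_maps cycle_linear_lin_ext)

lemma cycle_linear_differential: "cycle_linear (differential Y n)"
  unfolding differential_def face_pull_def
  by (intro cycle_linear_scale cycle_linear_sum_maps cycle_linear_diff cycle_linear_pull_back)

declare One_nat_def [simp del]


section \<open>The action of the cube group\<close>

text \<open>The involution u to 1/u exchanges the two values. Equations written in these functions
  keep their shape under the cube group.\<close>

definition lit :: "bool \<Rightarrow> nat \<Rightarrow> qpoly" where
  "lit e i = (if e then 1 - var (V i) else var (V i))"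

text \<open>The flips \<open>E\<close> are indexed by target coordinates, which makes
  \<open>sub S\<close> at the inverse permutation inverse to the comorphism in \<open>act\<close>.
  It moves generators forward, where \<open>act\<close> takes preimages of ideals.\<close>

definition sub :: "nat set \<Rightarrow> (nat \<Rightarrow> nat) \<Rightarrow> qpoly \<Rightarrow> qpoly" where
  "sub E \<pi> = substitute (\<lambda>x. case x of T i \<Rightarrow> var (T i) | V i \<Rightarrow> lit (\<pi> i \<in> E) (\<pi> i))"

lemma unital_hom_sub: "unital_hom (sub E \<pi>)"
  unfolding sub_def by (rule unital_hom_substitute)

lemmas sub_simps [simp] = unital_hom.simps[OF unital_hom_sub]

lemma sub_const [simp]: "sub E \<pi> (const r) = const r"
  and sub_T [simp]: "sub E \<pi> (var (T i)) = var (T i)"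
  and sub_V: "sub E \<pi> (var (V i)) = lit (\<pi> i \<in> E) (\<pi> i)"
  by (simp_all add: sub_def)

lemma sub_lit [simp]: "sub E \<pi> (lit e i) = lit (e \<noteq> (\<pi> i \<in> E)) (\<pi> i)"
  by (auto simp: lit_def sub_V)

lemma coords_1: "coords 1 n = insert (T 1) (V ` {1..n})"
  by (simp add: coords_def)

lemma lit_in [simp]: "lit e i \<in> polys_in C \<longleftrightarrow> V i \<in> C"
proof
  assume *: "lit e i \<in> polys_in C"
  have "1 - lit e i \<in> polys_in C"
    using * by simp
  with * have "var (V i) \<in> polys_in C"
    by (cases e) (auto simp: lit_def)
  then show "V i \<in> C" by simp
qed (auto simp: lit_def)

lemma V_in_coords [simp]: "V i \<in> coords a n \<longleftrightarrow> 1 \<le> i \<and> i \<le> n"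
  and T_in_coords [simp]: "T i \<in> coords a n \<longleftrightarrow> 1 \<le> i \<and> i \<le> a"
  by (auto simp: coords_def)

lemma sub_in:
  assumes "\<pi> permutes {1..n}" and "p \<in> polys_in (coords 1 n)"
  shows "sub E \<pi> p \<in> polys_in (coords 1 n)"
  unfolding sub_def
proof (rule substitute_in[OF assms(2)])
  fix x assume "x \<in> coords 1 n"
  then show "(case x of T i \<Rightarrow> var (T i) | V i \<Rightarrow> lit (\<pi> i \<in> E) (\<pi> i)) \<in> polys_in (coords 1 n)"
    using permutes_in_image[OF assms(1)] by (cases x) auto
qed

text \<open>The group law of the semidirect product: flips indexed by images are transported along
  \<sigma>, and flipping twice cancels.\<close>

lemma sub_sub:
  assumes "inj \<sigma>"
  shows "sub S \<sigma> (sub E \<rho> p) = sub (sym_diff S (\<sigma> ` E)) (\<sigma> \<circ> \<rho>) p"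
proof (rule unital_hom_eqI[OF unital_hom_comp[OF unital_hom_sub unital_hom_sub] unital_hom_sub polys_in_UNIV])
  fix x
  show "sub S \<sigma> (sub E \<rho> (var x)) = sub (sym_diff S (\<sigma> ` E)) (\<sigma> \<circ> \<rho>) (var x)"
    using assms by (cases x) (auto simp: sub_V inj_image_mem_iff intro!: arg_cong2[of _ _ _ _ lit])
qed simp

text \<open>The comorphism in \<open>act\<close> is invertible, and a preimage under it is the image
  under its inverse.\<close>

lemma act_gen:
  assumes \<sigma>: "\<sigma> permutes {1..n}" and G: "G \<subseteq> polys_in (coords 1 n)"
  shows "act n S \<sigma> (gen 1 n G) = gen 1 n (sub S (inv_into UNIV \<sigma>) ` G)"
proof -
  define f where "f = substitute (\<lambda>x. case x of T i \<Rightarrow> var (T i)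
                 | V i \<Rightarrow> if i \<in> S then 1 - var (V (\<sigma> i)) else var (V (\<sigma> i)))"
  have hom: "unital_hom f"
    unfolding f_def by (rule unital_hom_substitute)
  note \<sigma>' = permutes_inv[OF \<sigma>]
  have into: "f p \<in> polys_in (coords 1 n)" if "p \<in> polys_in (coords 1 n)" for p
    unfolding f_def
  proof (rule substitute_in[OF that])
    fix x assume "x \<in> coords 1 n"
    then show "(case x of T i \<Rightarrow> var (T i) | V i \<Rightarrow> if i \<in> S then 1 - var (V (\<sigma> i)) else var (V (\<sigma> i)))
        \<in> polys_in (coords 1 n)"
      using permutes_in_image[OF \<sigma>] by (cases x) auto
  qed
  have f_sub: "f (sub S (inv_into UNIV \<sigma>) p) = p" for p
  proof (rule unital_hom_eqI[OF unital_hom_comp[OF hom unital_hom_sub] unital_hom_id polys_in_UNIV])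
    show "f (sub S (inv_into UNIV \<sigma>) (var x)) = var x" for x
      by (cases x) (auto simp: f_def sub_V lit_def permutes_inverses[OF \<sigma>])
  qed (simp add: f_def)
  have sub_f: "sub S (inv_into UNIV \<sigma>) (f p) = p" for p
  proof (rule unital_hom_eqI[OF unital_hom_comp[OF unital_hom_sub hom] unital_hom_id polys_in_UNIV])
    show "sub S (inv_into UNIV \<sigma>) (f (var x)) = var x" for x
      by (cases x) (auto simp: f_def sub_V lit_def permutes_inverses[OF \<sigma>])
  qed (simp add: f_def)
  have subG: "sub S (inv_into UNIV \<sigma>) ` G \<subseteq> polys_in (coords 1 n)"
    using G sub_in[OF \<sigma>'] by blast
  have "act n S \<sigma> (gen 1 n G) = {p \<in> polys_in (coords 1 n). f p \<in> gen 1 n G}"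
    by (simp add: act_def f_def)
  also have "\<dots> = gen 1 n (sub S (inv_into UNIV \<sigma>) ` G)"
  proof
    have "f ` sub S (inv_into UNIV \<sigma>) ` G \<subseteq> gen 1 n G"
      using gen_superset[OF G] by (auto simp: f_sub)
    then show "gen 1 n (sub S (inv_into UNIV \<sigma>) ` G) \<subseteq> {p \<in> polys_in (coords 1 n). f p \<in> gen 1 n G}"
      using subG by (intro gen_least gen_hom_preimage[OF hom into ideal_gen[OF G]]) auto
    show "{p \<in> polys_in (coords 1 n). f p \<in> gen 1 n G} \<subseteq> gen 1 n (sub S (inv_into UNIV \<sigma>) ` G)"
    proof
      fix p assume "p \<in> {p \<in> polys_in (coords 1 n). f p \<in> gen 1 n G}"
      then have "sub S (inv_into UNIV \<sigma>) (f p) \<in> sub S (inv_into UNIV \<sigma>) ` gen 1 n G"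
        by blast
      then have "p \<in> gen 1 n (sub S (inv_into UNIV \<sigma>) ` gen 1 n G)"
        using gen_superset[of "sub S (inv_into UNIV \<sigma>) ` gen 1 n G" 1 n] gen_subset_polys_in[OF G] sub_in[OF \<sigma>']
        by (auto simp: sub_f)
      then show "p \<in> gen 1 n (sub S (inv_into UNIV \<sigma>) ` G)"
        by (simp add: gen_image_gen1[OF unital_hom_sub sub_in[OF \<sigma>'] G])
    qed
  qed
  finally show ?thesis .
qed

section \<open>Alternating sums of translates of one subvariety\<close>

abbreviation prime_cycle :: "nat \<Rightarrow> qpoly set \<Rightarrow> cycle" where
  "prime_cycle n G \<equiv> Poly_Mapping.single (gen 1 n G) 1"

abbreviation cube_sign :: "nat set \<Rightarrow> (nat \<Rightarrow> nat) \<Rightarrow> rat" where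
  "cube_sign S \<sigma> \<equiv> (- 1) ^ card S * of_int (sign \<sigma>)"

lemma cube_sign_square: "cube_sign S \<sigma> * cube_sign S \<sigma> = 1"
proof -
  have "cube_sign S \<sigma> * cube_sign S \<sigma> = ((- 1) * (- 1)) ^ card S * of_int (sign \<sigma> * sign \<sigma>)"
    by (simp only: power_mult_distrib of_int_mult mult_ac)
  then show ?thesis
    by simp
qed

text \<open>A permutation and its inverse have the same sign, so reindexing the sum absorbs the
  inverse that \<open>act_gen\<close> introduces.\<close>

lemma Alt_prime_cycle:
  assumes G: "G \<subseteq> polys_in (coords 1 n)"
  shows "Alt n (prime_cycle n G) = scale (1 / (2 ^ n * fact n))
     (\<Sum>S \<in> Pow {1..n}. \<Sum>\<sigma> | \<sigma> permutes {1..n}. scale (cube_sign S \<sigma>) (prime_cycle n (sub S \<sigma> ` G)))"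
proof -
  have "(\<Sum>\<sigma> | \<sigma> permutes {1..n}. scale (cube_sign S \<sigma>)
      (lin_ext (\<lambda>Z. Poly_Mapping.single (act n S \<sigma> Z) 1) (prime_cycle n G))) =
    (\<Sum>\<sigma> | \<sigma> permutes {1..n}. scale (cube_sign S \<sigma>) (prime_cycle n (sub S \<sigma> ` G)))" for S
    by (subst (2) sum_permutations_inverse)
       (auto intro!: sum.cong simp: act_gen[OF _ G] sign_inverse permutes_imp_permutation[OF finite_atLeastAtMost])
  then show ?thesis
    by (simp add: Alt_def)
qed

text \<open>The sign of each translate occurs once in the projector and once in the hypothesis, so
  it squares to 1; the equal terms that remain cancel the normalisation.\<close>

lemma linear_Alt_prime_cycle:
  assumes F: "cycle_linear F" and G: "G \<subseteq> polys_in (coords 1 n)"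
    and eq: "\<And>S \<sigma>. S \<subseteq> {1..n} \<Longrightarrow> \<sigma> permutes {1..n} \<Longrightarrow>
      F (prime_cycle n (sub S \<sigma> ` G)) = scale (cube_sign S \<sigma>) Z"
  shows "F (Alt n (prime_cycle n G)) = Z"
proof -
  have "F (Alt n (prime_cycle n G)) = scale (1 / (2 ^ n * fact n))
     (\<Sum>S \<in> Pow {1..n}. \<Sum>\<sigma> | \<sigma> permutes {1..n}.
        scale (cube_sign S \<sigma>) (scale (cube_sign S \<sigma>) Z))"
    unfolding Alt_prime_cycle[OF G] cycle_linear.scale[OF F] cycle_linear.sum[OF F]
    by (intro arg_cong2[of _ _ _ _ scale] refl sum.cong) (use eq in auto)
  also have "\<dots> = scale (1 / (2 ^ n * fact n)) (\<Sum>S \<in> Pow {1..n}. \<Sum>\<sigma> | \<sigma> permutes {1..n}. scale 1 Z)"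
    unfolding scale_scale cube_sign_square by simp
  also have "\<dots> = Z"
    by (simp only: sum_scale_const scale_scale) (simp add: card_Pow card_permutations)
  finally show ?thesis .
qed

lemma sum_Pow_sym_diff:
  assumes "E \<subseteq> A"
  shows "(\<Sum>S\<in>Pow A. g (sym_diff S E)) = (\<Sum>S\<in>Pow A. g S)"
  by (rule sum.reindex_bij_witness[where i = "\<lambda>S. sym_diff S E" and j = "\<lambda>S. sym_diff S E"])
     (use assms in \<open>auto intro!: arg_cong[of _ _ g]\<close>)

lemma minus_one_power_sym_diff:
  assumes "finite S" and "finite E"
  shows "(- 1 :: rat) ^ card (sym_diff S E) = (- 1) ^ card S * (- 1) ^ card E"
proof -
  have "card (sym_diff S E) = card (S - E) + card (E - S)"
    by (rule card_Un_disjoint) (use assms in auto)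
  moreover have "card S = card (S - E) + card (S \<inter> E)"
    using card_Diff_subset_Int[of S E] card_mono[of S "S \<inter> E"] assms by simp
  moreover have "card E = card (E - S) + card (S \<inter> E)"
    using card_Diff_subset_Int[of E S] card_mono[of E "E \<inter> S"] assms by (simp add: Int_commute)
  ultimately show ?thesis
    by (simp add: power_add mult.assoc mult.left_commute flip: power_mult_distrib)
qed

text \<open>Right translation permutes the terms of the sum over the group, and the sign is a
  character.\<close>

lemma Alt_sub:
  assumes E: "E \<subseteq> {1..n}" and \<rho>: "\<rho> permutes {1..n}" and G: "G \<subseteq> polys_in (coords 1 n)"
  shows "Alt n (prime_cycle n (sub E \<rho> ` G)) = scale (cube_sign E \<rho>) (Alt n (prime_cycle n G))"
proof -
  let ?f = "\<lambda>S \<sigma>. scale (cube_sign S \<sigma>) (prime_cycle n (sub S \<sigma> ` G))"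
  have subG: "sub E \<rho> ` G \<subseteq> polys_in (coords 1 n)"
    using G sub_in[OF \<rho>] by blast
  have summand: "scale (cube_sign S \<sigma>) (prime_cycle n (sub S \<sigma> ` sub E \<rho> ` G)) =
      scale (cube_sign E \<rho>) (?f (sym_diff S (\<sigma> ` E)) (\<sigma> \<circ> \<rho>))"
    if S: "S \<subseteq> {1..n}" and \<sigma>: "\<sigma> permutes {1..n}" for S \<sigma>
  proof -
    have fin: "finite S" "finite E"
      using S E finite_subset by auto
    have "cube_sign (sym_diff S (\<sigma> ` E)) (\<sigma> \<circ> \<rho>) = cube_sign S \<sigma> * cube_sign E \<rho>"
      using fin card_image[OF permutes_inj_on[OF \<sigma>, of E]] \<sigma> \<rho>
      by (subst minus_one_power_sym_diff)
         (auto simp: sign_compose permutes_imp_permutation[OF finite_atLeastAtMost])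
    then have "cube_sign E \<rho> * cube_sign (sym_diff S (\<sigma> ` E)) (\<sigma> \<circ> \<rho>) =
        cube_sign S \<sigma> * (cube_sign E \<rho> * cube_sign E \<rho>)"
      by (simp only: mult_ac)
    then show ?thesis
      using permutes_inj[OF \<sigma>] by (simp only: scale_scale cube_sign_square image_image sub_sub mult_1_right)
  qed
  have "(\<Sum>S \<in> Pow {1..n}. \<Sum>\<sigma> | \<sigma> permutes {1..n}.
      scale (cube_sign S \<sigma>) (prime_cycle n (sub S \<sigma> ` sub E \<rho> ` G))) =
    scale (cube_sign E \<rho>) (\<Sum>\<sigma> | \<sigma> permutes {1..n}. \<Sum>S \<in> Pow {1..n}. ?f (sym_diff S (\<sigma> ` E)) (\<sigma> \<circ> \<rho>))"
    unfolding scale_sum by (subst sum.swap) (intro sum.cong refl summand; simp)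
  \<comment> \<open>The shift of the flips depends on \<sigma>, so it is undone for each fixed
    \<sigma> before the permutations themselves are reindexed.\<close>
  also have "(\<Sum>\<sigma> | \<sigma> permutes {1..n}. \<Sum>S \<in> Pow {1..n}. ?f (sym_diff S (\<sigma> ` E)) (\<sigma> \<circ> \<rho>)) =
      (\<Sum>\<sigma> | \<sigma> permutes {1..n}. \<Sum>S \<in> Pow {1..n}. ?f S (\<sigma> \<circ> \<rho>))"
  proof (rule sum.cong[OF refl], rule sum_Pow_sym_diff)
    fix \<sigma> assume "\<sigma> \<in> {\<sigma>. \<sigma> permutes {1..n}}"
    then show "\<sigma> ` E \<subseteq> {1..n}"
      using E permutes_image[of \<sigma> "{1..n}"] by auto
  qed
  also have "\<dots> = (\<Sum>S \<in> Pow {1..n}. \<Sum>\<sigma> | \<sigma> permutes {1..n}. ?f S \<sigma>)"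
    by (subst sum_permutations_compose_right[OF \<rho>, symmetric]) (rule sum.swap)
  finally show ?thesis
    by (simp only: Alt_prime_cycle[OF subG] Alt_prime_cycle[OF G] scale_scale mult.commute)
qed


section \<open>Integral subvarieties dominating the base\<close>

abbreviation tt :: qpoly where
  "tt \<equiv> var (T 1)"

lemma var_nonzero [simp]: "var x \<noteq> 0"
  by (auto simp: var_def dest!: arg_cong[where f = Poly_Mapping.keys])

lemma const_0 [simp]: "const 0 = 0" and const_1 [simp]: "const 1 = 1"
  by (simp_all add: const_def single_one)

lemma var_neq_1 [simp]: "var x \<noteq> 1" and one_neq_var [simp]: "1 \<noteq> var x"
proof -
  show *: "var x \<noteq> 1"
  proof
    assume "var x = 1"
    then have "substitute (\<lambda>_. 0) (var x) = substitute (\<lambda>_. 0) 1"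
      by (simp only:)
    then show False
      by simp
  qed
  show "1 \<noteq> var x"
    using * by metis
qed

text \<open>Dominating the base keeps the point inside \<open>times_cube Y n\<close> for every
  \<open>Y\<close> that contains the generic point \<open>{0}\<close>. This treats \<open>A1\<close>
  and \<open>X\<close> with one argument.\<close>

definition generic_point :: "nat \<Rightarrow> qpoly set \<Rightarrow> bool" where
  "generic_point n G \<longleftrightarrow> G \<subseteq> polys_in (coords 1 n) \<and> primeideal (gen 1 n G) (coord_ring 1 n) \<and>
     proj_base (gen 1 n G) = {0}"

lemma (in graph) proj_base_gen: "T 1 \<in> B \<Longrightarrow> proj_base (gen a n gens) = {0}"
proof -
  assume "T 1 \<in> B"
  then have "coords 1 0 \<subseteq> B"
    by (simp add: coords_1)
  then have "polys_in (coords 1 0) \<subseteq> polys_in B"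
    by (rule polys_in_mono)
  then show ?thesis
    using gen_base gen_0[OF gens_in] by (auto simp: proj_base_def)
qed

lemma graph_generic_point:
  assumes "graph 1 n B w h" and "T 1 \<in> B"
  shows "generic_point n ((\<lambda>c. w c * h c - 1) ` (coords 1 n - B))"
proof -
  interpret graph 1 n B w h by fact
  show ?thesis
    using gens_in prime_gen proj_base_gen[OF assms(2)] unfolding generic_point_def gens_def by blast
qed

lemma generic_point_in_times_cube: "generic_point n G \<Longrightarrow> {0} \<in> Y \<Longrightarrow> gen 1 n G \<in> times_cube Y n"
  by (simp add: generic_point_def times_cube_def Spec_def)

lemma zero_in_A1: "{0} \<in> A1"
  by (auto simp: A1_def Spec_def primeideal_coord_ring_iff ideal_coord_ring_iff)

lemma zero_in_X: "{0} \<in> X"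
  by (simp add: X_def zero_in_A1)

lemma times_cube_subset_Spec: "times_cube Y n \<subseteq> Spec (coord_ring 1 n)"
  by (auto simp: times_cube_def)

lemma pull_back_generic:
  assumes \<phi>: "unital_hom \<phi>"
    and into: "\<And>p. p \<in> polys_in (coords a m) \<Longrightarrow> \<phi> p \<in> polys_in (coords 1 n)"
    and G: "G \<subseteq> polys_in (coords a m)" and G': "generic_point n (\<phi> ` G)" and Y: "{0} \<in> Y"
  shows "pull_back (coord_ring 1 n) (times_cube Y n) \<phi> (Poly_Mapping.single (gen a m G) 1) =
    prime_cycle n (\<phi> ` G)"
proof -
  have "\<phi> ` gen a m G \<subseteq> polys_in (coords 1 n)"
    using gen_subset_polys_in[OF G] into by blast
  then have "scheme_cycle (coord_ring 1 n) (times_cube Y n) (\<phi> ` gen a m G) = prime_cycle n (\<phi> ` G)"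
    using G' generic_point_in_times_cube[OF G' Y] times_cube_subset_Spec gen_image_gen1[OF \<phi> into G]
    by (intro scheme_cycle_prime) (auto simp: generic_point_def)
  then show ?thesis
    by (simp add: pull_back_def)
qed

lemma pull_back_unit:
  assumes \<phi>: "unital_hom \<phi>"
    and into: "\<And>p. p \<in> polys_in (coords 1 m) \<Longrightarrow> \<phi> p \<in> polys_in (coords 1 n)"
    and G: "G \<subseteq> polys_in (coords 1 m)" and "1 \<in> gen 1 n (\<phi> ` G)"
  shows "pull_back (coord_ring 1 n) (times_cube Y n) \<phi> (prime_cycle m G) = 0"
  using assms(4) times_cube_subset_Spec gen_image_gen1[OF \<phi> into G]
  by (simp add: pull_back_def scheme_cycle_unit)

lemma restrict_generic:
  assumes "generic_point n G" and "{0} \<in> Y"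
  shows "restrict_to Y n (prime_cycle n G) = prime_cycle n G"
  using pull_back_generic[of id 1 n n G Y] assms
  by (simp add: restrict_to_def generic_point_def unital_hom_id id_def)

lemma restrict_Alt:
  assumes G: "G \<subseteq> polys_in (coords 1 n)"
    and gp: "\<And>S \<sigma>. \<sigma> permutes {1..n} \<Longrightarrow> generic_point n (sub S \<sigma> ` G)" and Y: "{0} \<in> Y"
  shows "restrict_to Y n (Alt n (prime_cycle n G)) = Alt n (prime_cycle n G)"
proof -
  interpret cycle_linear "restrict_to Y n"
    unfolding restrict_to_def by (rule cycle_linear_pull_back)
  show ?thesis
    unfolding Alt_prime_cycle[OF G] scale sum
    by (intro arg_cong2[of _ _ _ _ Defs.scale] sum.cong refl restrict_generic gp Y) auto
qed


section \<open>The cycle \<open>b\<close>\<close>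

text \<open>The curve with u1 = t and u2 = 1 - t has V1 = 1 / (1 - t) and V2 = 1 / t. The parameters
  \<open>B\<close> and \<open>C\<close> leave room for translates and for faces of the
  surfaces.\<close>

definition gens_b :: "qpoly \<Rightarrow> qpoly \<Rightarrow> qpoly set" where
  "gens_b B C = {B * (1 - tt) - 1, C * tt - 1}"

abbreviation b_gens :: "qpoly set" where
  "b_gens \<equiv> gens_b (lit False 1) (lit False 2)"

lemma gens_b_in: "V b \<in> coords 1 n \<Longrightarrow> V c \<in> coords 1 n \<Longrightarrow> gens_b (lit e b) (lit f c) \<subseteq> polys_in (coords 1 n)"
  by (auto simp: gens_b_def)

lemma generic_point_b:
  assumes "b \<in> {1..2}" "c \<in> {1..2}" "b \<noteq> c"
  shows "generic_point 2 (gens_b (lit e b) (lit f c))"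
proof -
  define w where "w = (\<lambda>x. if x = V b then lit e b else lit f c)"
  define h where "h = (\<lambda>x. if x = V b then 1 - tt else tt)"
  have diff: "coords 1 2 - {T 1} = {V b, V c}"
    using assms by (auto simp: coords_1)
  have "graph 1 2 {T 1} w h"
    by unfold_locales (use assms diff in \<open>auto simp: w_def h_def lit_def\<close>)
  from graph_generic_point[OF this] show ?thesis
    using assms by (simp add: diff gens_b_def w_def h_def)
qed

lemma permutes_2: "\<sigma> permutes {1..2::nat} \<Longrightarrow> \<sigma> = id \<or> \<sigma> = Transposition.transpose 1 2"
proof -
  assume "\<sigma> permutes {1..2::nat}"
  moreover have "{1..2::nat} = {1, 2}"
    by auto
  ultimately have "\<sigma> \<in> {p. p permutes insert 1 {2::nat}}"
    by simp
  then show ?thesis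
    unfolding permutes_insert by auto
qed

lemma sub_gens_b [simp]:
  "sub S \<sigma> ` gens_b (lit e b) (lit f c) =
    gens_b (lit (e \<noteq> (\<sigma> b \<in> S)) (\<sigma> b)) (lit (f \<noteq> (\<sigma> c \<in> S)) (\<sigma> c))"
  by (simp add: gens_b_def)

lemma generic_point_sub_b:
  assumes "\<sigma> permutes {1..2}"
  shows "generic_point 2 (sub S \<sigma> ` b_gens)"
  using permutes_in_image[OF assms, of 1] permutes_in_image[OF assms, of 2]
    inj_eq[OF permutes_inj[OF assms], of 1 2]
  unfolding sub_gens_b by (intro generic_point_b) auto

lemma param_t: "param [t] = Alt 1 (prime_cycle 1 {lit False 1 * (1 - tt) - 1})"
  and param_1_minus_t: "param [1 - t] = Alt 1 (prime_cycle 1 {lit False 1 * tt - 1})"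
proof -
  \<comment> \<open>The prime of a parametrized cycle is the kernel of evaluation at the generic
    point, which is the \<open>ev\<close> of the graph V1 = 1 / k.\<close>
  have point: "param_pt [f] = gen 1 1 {lit False 1 * k - 1}"
    if k: "k \<in> polys_in {T 1}" "k \<noteq> 0" and f: "1 - f = to_frac k" for f k
  proof -
    have diff: "coords 1 1 - {T 1} = {V 1}"
      by (auto simp: coords_1)
    interpret graph 1 1 "{T 1}" var "\<lambda>_. k"
      by unfold_locales (use k in auto)
    let ?s = "\<lambda>x. case x of T i \<Rightarrow> t | V i \<Rightarrow> 1 / (1 - [f] ! (i - 1))"
    have "eval_poly (\<lambda>r. to_frac (const r)) ?s p = ev p" if "p \<in> polys_in (coords 1 1)" for p
      by (rule unital_hom_eqI[OF unital_hom_eval_poly unital_hom_ev that])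
         (use f in \<open>auto simp: ev_def coords_1 unital_hom_frac_const t_def\<close>)
    then have "param_pt [f] = {p \<in> polys_in (coords 1 1). ev p = 0}"
      by (auto simp: param_pt_def One_nat_def)
    also have "\<dots> = gen 1 1 gens"
      by (rule gen_eq_kernel[symmetric])
    finally show ?thesis
      by (simp add: gens_def diff lit_def)
  qed
  note frac = unital_hom.simps[OF unital_hom_to_frac]
  show "param [t] = Alt 1 (prime_cycle 1 {lit False 1 * (1 - tt) - 1})"
    by (simp add: param_def point[of "1 - tt"] t_def frac One_nat_def[symmetric])
  show "param [1 - t] = Alt 1 (prime_cycle 1 {lit False 1 * tt - 1})"
    by (simp add: param_def point[of "tt"] t_def frac One_nat_def[symmetric])
qed

section \<open>The product of the two graphs\<close>

lemma cycle_linear_exterior_left: "cycle_linear (\<lambda>z. exterior_product Y m n z w)"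
  unfolding exterior_product_def by (rule cycle_linear_lin_ext)

lemma cycle_linear_exterior_right: "cycle_linear (\<lambda>w. exterior_product Y m n z w)"
  unfolding exterior_product_def lin_ext_def[of _ z]
  by (intro cycle_linear_sum_maps cycle_linear_scale cycle_linear_lin_ext)

lemma cycle_linear_comp: "cycle_linear F \<Longrightarrow> cycle_linear G \<Longrightarrow> cycle_linear (\<lambda>z. F (G z))"
  by (simp add: cycle_linear_def)

lemma cycle_linear_product_left: "cycle_linear (\<lambda>z. cycle_product Y m n z w)"
  unfolding cycle_product_def
  by (intro cycle_linear_comp[OF cycle_linear_Alt] cycle_linear_comp[OF cycle_linear_pull_back]
      cycle_linear_exterior_left)

lemma cycle_linear_product_right: "cycle_linear (\<lambda>w. cycle_product Y m n z w)"
  unfolding cycle_product_def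
  by (intro cycle_linear_comp[OF cycle_linear_Alt] cycle_linear_comp[OF cycle_linear_pull_back]
      cycle_linear_exterior_right)

text \<open>Before restriction to the diagonal the two equations use independent base coordinates,
  so the exterior product is itself a graph over \<open>T 1\<close>, \<open>T 2\<close>. The
  diagonal identifies them and leaves \<open>gens_b\<close>, again prime.\<close>

lemma product_prime_cycles:
  assumes Y: "{0} \<in> Y"
  shows "cycle_product Y 1 1 (prime_cycle 1 {lit e 1 * (1 - tt) - 1}) (prime_cycle 1 {lit f 1 * tt - 1}) =
    Alt 2 (prime_cycle 2 (gens_b (lit e 1) (lit f 2)))"
proof -
  define w where "w = (\<lambda>x. if x = V 1 then lit e 1 else lit f 2)"
  define h where "h = (\<lambda>x. if x = V 1 then 1 - tt else var (T 2))"
  define G where "G = {lit e 1 * (1 - tt) - 1, lit f 2 * var (T 2) - 1}"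
  have coords_2: "coords 2 2 = {T 1, T 2, V 1, V 2}"
    by (auto simp: coords_def)
  then have diff: "coords 2 2 - {T 1, T 2} = {V 1, V 2}"
    by auto
  interpret graph 2 2 "{T 1, T 2}" w h
    by unfold_locales (use diff in \<open>auto simp: coords_2 w_def h_def lit_def\<close>)
  have gens: "gens = G"
    unfolding gens_def diff by (simp add: w_def h_def G_def)
  have G_in: "G \<subseteq> polys_in (coords 2 2)"
    using gens_in gens by simp
  have unital_hom_proj2: "unital_hom (proj2_map m)" for m
    unfolding proj2_map_def by (rule unital_hom_substitute)
  have proj2_in: "proj2_map m p \<in> polys_in {T 2}" if "p \<in> polys_in (coords 1 0)" for m p
    unfolding proj2_map_def by (rule substitute_in[OF that]) (auto simp: coords_1)
  \<comment> \<open>Sending \<open>T 2\<close> back to \<open>T 1\<close> is a left inverse, so the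
    second projection of the surface in \<open>Y\<close> times \<open>Y\<close> is dominant as
    well.\<close>
  have proj2_eq_0: "p = 0" if "p \<in> polys_in (coords 1 0)" "proj2_map 0 p = 0" for p
  proof -
    have "substitute (\<lambda>_. tt) (proj2_map 0 p) = p"
      unfolding proj2_map_def
      by (rule unital_hom_eqI[OF unital_hom_comp[OF unital_hom_substitute unital_hom_substitute]
            unital_hom_id that(1)]) (auto simp: coords_1)
    then show ?thesis
      using that(2) by simp
  qed
  have "{p \<in> polys_in (coords 1 0). proj2_map 0 p \<in> gen 2 2 G} = {0}"
  proof -
    have "proj2_map 0 p \<in> gen 2 2 G \<longleftrightarrow> p = 0" if "p \<in> polys_in (coords 1 0)" for p
    proof -
      have "proj2_map 0 p \<in> polys_in {T 1, T 2}"
        using proj2_in[OF that, of 0] polys_in_mono[of "{T 2}" "{T 1, T 2}"] by auto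
      then show ?thesis
        using gen_base[of "proj2_map 0 p"] proj2_eq_0[OF that] gens
        by (auto simp: unital_hom.zero[OF unital_hom_proj2])
    qed
    then show ?thesis
      by auto
  qed
  then have U: "gen 2 2 G \<in> times_times_cube Y 2"
    using prime_gen proj_base_gen gens Y by (simp add: times_times_cube_def Spec_def)
  have proj2_into: "proj2_map 1 p \<in> polys_in (coords 2 2)" if "p \<in> polys_in (coords 1 1)" for p
    unfolding proj2_map_def by (rule substitute_in[OF that]) (auto simp: coords_1)
  have id_into: "p \<in> polys_in (coords 2 2)" if "p \<in> polys_in (coords 1 1)" for p
    using that polys_in_mono[of "coords 1 1" "coords 2 2"] by (auto simp: coords_def)
  have proj2_lit: "proj2_map 1 (lit f 1) = lit f 2"
    by (simp add: proj2_map_def lit_def)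
  have one: "{lit e 1 * (1 - tt) - 1} \<subseteq> polys_in (coords 1 1)" "{lit f 1 * tt - 1} \<subseteq> polys_in (coords 1 1)"
    by auto
  have "gen 2 2 (gen 1 1 {lit e 1 * (1 - tt) - 1} \<union> proj2_map 1 ` gen 1 1 {lit f 1 * tt - 1}) =
      gen 2 2 ({lit e 1 * (1 - tt) - 1} \<union> {proj2_map 1 (lit f 1 * tt - 1)})"
    using gen_image_gen[OF unital_hom_id id_into unital_hom_proj2 proj2_into one] by simp
  also have "proj2_map 1 (lit f 1 * tt - 1) = lit f 2 * var (T 2) - 1"
    using proj2_lit by (simp add: proj2_map_def)
  finally have "gen 2 2 (gen 1 1 {lit e 1 * (1 - tt) - 1} \<union> proj2_map 1 ` gen 1 1 {lit f 1 * tt - 1}) = gen 2 2 G"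
    by (simp add: G_def insert_commute)
  then have "scheme_cycle (coord_ring 2 2) (times_times_cube Y 2)
      (gen 1 1 {lit e 1 * (1 - tt) - 1} \<union> proj2_map 1 ` gen 1 1 {lit f 1 * tt - 1}) =
      Poly_Mapping.single (gen 2 2 G) 1"
    using prime_gen gens U gen_subset_polys_in[OF one(1)] gen_subset_polys_in[OF one(2)]
      proj2_into id_into by (intro scheme_cycle_prime) (auto simp: times_times_cube_def)
  then have ext: "exterior_product Y 1 1 (prime_cycle 1 {lit e 1 * (1 - tt) - 1})
      (prime_cycle 1 {lit f 1 * tt - 1}) = Poly_Mapping.single (gen 2 2 G) 1"
    by (simp add: exterior_product_def)
  have "diagonal_map ` G = gens_b (lit e 1) (lit f 2)"
    by (simp add: G_def gens_b_def diagonal_map_def lit_def)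
  moreover have "diagonal_map p \<in> polys_in (coords 1 2)" if "p \<in> polys_in (coords 2 2)" for p
    unfolding diagonal_map_def by (rule substitute_in[OF that]) (auto simp: coords_2)
  moreover have "unital_hom diagonal_map"
    unfolding diagonal_map_def by (rule unital_hom_substitute)
  ultimately have "pull_back (coord_ring 1 2) (times_cube Y 2) diagonal_map
      (Poly_Mapping.single (gen 2 2 G) 1) = prime_cycle 2 (gens_b (lit e 1) (lit f 2))"
    using pull_back_generic[of diagonal_map 2 2 2 G Y] G_in generic_point_b[of 1 2 e f] Y by simp
  then show ?thesis
    by (simp add: cycle_product_def ext)
qed

lemma product_L0_L1:
  assumes Y: "{0} \<in> Y"
  shows "cycle_product Y 1 1 (param [t]) (param [1 - t]) = Alt 2 (prime_cycle 2 b_gens)"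
proof -
  let ?G0 = "{lit False 1 * (1 - tt) - 1}" and ?G1 = "{lit False 1 * tt - 1}"
  let ?Z = "Alt 2 (prime_cycle 2 b_gens)"
  have id: "\<sigma> = id" if "\<sigma> permutes {1..1::nat}" for \<sigma>
    using that by simp
  have "cycle_product Y 1 1 (prime_cycle 1 (sub S id ` ?G0)) (prime_cycle 1 (sub S' id ` ?G1)) =
    scale (cube_sign S' id) (scale (cube_sign S id) ?Z)" if S: "S \<subseteq> {1..1}" "S' \<subseteq> {1..1}" for S S'
  proof -
    \<comment> \<open>Flips of the two one-dimensional cubes combine into a flip of the square, the
      second one moved to factor 2. Cardinalities add, so the signs multiply.\<close>
    define E where "E = S \<union> Suc ` S'"
    have E: "E \<subseteq> {1..2}"
      using S by (auto simp: E_def)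
    have "card E = card S + card S'"
      unfolding E_def using S finite_subset[OF S(1)] finite_subset[OF S(2)]
      by (subst card_Un_disjoint) (auto simp: card_image)
    then have sign: "cube_sign E id = cube_sign S' id * cube_sign S id"
      by (simp add: power_add)
    have mem: "1 \<in> E \<longleftrightarrow> 1 \<in> S" "2 \<in> E \<longleftrightarrow> 1 \<in> S'"
      using S by (auto simp: E_def One_nat_def image_iff numeral_2_eq_2)
    have "sub S id ` ?G0 = {lit (1 \<in> S) 1 * (1 - tt) - 1}" "sub S' id ` ?G1 = {lit (1 \<in> S') 1 * tt - 1}"
      by simp_all
    then have "cycle_product Y 1 1 (prime_cycle 1 (sub S id ` ?G0)) (prime_cycle 1 (sub S' id ` ?G1)) =
        Alt 2 (prime_cycle 2 (gens_b (lit (1 \<in> S) 1) (lit (1 \<in> S') 2)))"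
      by (simp only: product_prime_cycles[OF Y])
    also have "gens_b (lit (1 \<in> S) 1) (lit (1 \<in> S') 2) = sub E id ` b_gens"
      by (simp add: mem)
    also have "Alt 2 (prime_cycle 2 (sub E id ` b_gens)) = scale (cube_sign E id) ?Z"
      by (rule Alt_sub[OF E permutes_id gens_b_in]) auto
    finally show ?thesis
      by (simp only: sign scale_scale)
  qed
  then have "cycle_product Y 1 1 (prime_cycle 1 (sub S id ` ?G0)) (Alt 1 (prime_cycle 1 ?G1)) =
      scale (cube_sign S id) ?Z" if "S \<subseteq> {1..1}" for S
    using that id by (intro linear_Alt_prime_cycle[OF cycle_linear_product_right]) (auto dest!: id)
  then have "cycle_product Y 1 1 (Alt 1 (prime_cycle 1 ?G0)) (Alt 1 (prime_cycle 1 ?G1)) = ?Z"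
    by (intro linear_Alt_prime_cycle[OF cycle_linear_product_left]) (auto dest!: id)
  then show ?thesis
    by (simp only: param_t param_1_minus_t)
qed

lemma restrict_L0:
  assumes Y: "{0} \<in> Y"
  shows "restrict_to Y 1 (param [t]) = param [t]" and "restrict_to Y 1 (param [1 - t]) = param [1 - t]"
proof -
  have gp: "generic_point 1 {lit e 1 * k - 1}" if k: "k \<in> polys_in {T 1}" "k \<noteq> 0" for e k
  proof -
    have diff: "coords 1 1 - {T 1} = {V 1}"
      by (auto simp: coords_1)
    have "graph 1 1 {T 1} (\<lambda>_. lit e 1) (\<lambda>_. k)"
      by unfold_locales (use k diff in \<open>auto simp: lit_def\<close>)
    from graph_generic_point[OF this] show ?thesis
      by (simp add: diff)
  qed
  show "restrict_to Y 1 (param [t]) = param [t]"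
    unfolding param_t by (rule restrict_Alt[OF _ _ Y]) (auto intro!: gp)
  show "restrict_to Y 1 (param [1 - t]) = param [1 - t]"
    unfolding param_1_minus_t by (rule restrict_Alt[OF _ _ Y]) (auto intro!: gp)
qed


section \<open>The surfaces\<close>

text \<open>With \<open>u A = 1 - t A\<close> and \<open>u A = (1 - t) A\<close>, the generators below define the pull-backs of
  \<open>b\<close> under the multiplication and the twisted multiplication.\<close>

locale surface =
  fixes \<alpha> \<beta> :: qpoly
  assumes \<alpha>: "\<alpha> = 0 \<or> \<alpha> = 1" and \<alpha>\<beta>: "\<alpha> + \<beta> = 1 - tt"
begin

definition u :: "qpoly \<Rightarrow> qpoly" where
  "u A = \<alpha> + \<beta> * A"

definition gens_M :: "qpoly \<Rightarrow> qpoly \<Rightarrow> qpoly \<Rightarrow> qpoly set" where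
  "gens_M A B C = {B * u A - 1, C * (1 - u A) - 1}"

lemma \<beta>: "\<beta> = 1 - tt - \<alpha>"
  using \<alpha>\<beta> by (simp add: algebra_simps)

lemma u_1 [simp]: "u 1 = 1 - tt" and u_0: "u 0 = 0 \<or> u 0 = 1"
  using \<alpha> \<alpha>\<beta> unfolding u_def by auto

lemma u_in [simp]: "A \<in> polys_in C \<Longrightarrow> T 1 \<in> C \<Longrightarrow> u A \<in> polys_in C"
  using \<alpha> unfolding u_def unfolding \<beta> by auto

text \<open>Both \<alpha> and \<beta> are integral polynomials in t, hence fixed by such a
  homomorphism.\<close>

lemma hom_u: "unital_hom f \<Longrightarrow> f tt = tt \<Longrightarrow> f (u A) = u (f A)"
  using \<alpha> unfolding u_def unfolding \<beta> by (auto simp: unital_hom.simps)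

lemma hom_gens_M: "unital_hom f \<Longrightarrow> f tt = tt \<Longrightarrow> f ` gens_M A B C = gens_M (f A) (f B) (f C)"
  by (simp add: gens_M_def hom_u unital_hom.simps)

lemma sub_gens_M [simp]:
  "sub S \<sigma> ` gens_M (lit d a) (lit e b) (lit f c) =
    gens_M (lit (d \<noteq> (\<sigma> a \<in> S)) (\<sigma> a)) (lit (e \<noteq> (\<sigma> b \<in> S)) (\<sigma> b)) (lit (f \<noteq> (\<sigma> c \<in> S)) (\<sigma> c))"
  by (simp add: hom_gens_M unital_hom_sub)

lemma u_lit_nonzero: "u (lit e a) \<noteq> 0" "u (lit e a) \<noteq> 1"
proof -
  \<comment> \<open>Specialising the literal to 1 turns \<open>u\<close> into 1 - t, which is
    neither 0 nor 1.\<close>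
  define f where "f = substitute (\<lambda>x. case x of T i \<Rightarrow> var (T i) | V i \<Rightarrow> if e then 0 else 1)"
  have f: "unital_hom f" "f tt = tt" "f (lit e a) = 1"
    unfolding f_def by (simp_all add: unital_hom_substitute lit_def)
  have "f (u (lit e a)) = 1 - tt"
    using hom_u[OF f(1,2)] f(3) by simp
  moreover have "f 0 = 0" "f 1 = 1"
    using f(1) by (simp_all add: unital_hom.simps)
  ultimately show "u (lit e a) \<noteq> 0" "u (lit e a) \<noteq> 1"
    by auto
qed

lemma gens_M_in:
  "V a \<in> coords 1 n \<Longrightarrow> V b \<in> coords 1 n \<Longrightarrow> V c \<in> coords 1 n \<Longrightarrow>
    gens_M (lit d a) (lit e b) (lit f c) \<subseteq> polys_in (coords 1 n)"
  by (auto simp: gens_M_def)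

lemma coords_13:
  assumes "a \<in> {1..3}" "b \<in> {1..3}" "c \<in> {1..3}" "distinct [a, b, c]"
  shows "coords 1 3 - {T 1, V a} = {V b, V c}"
  using assms by (auto simp: coords_1)

lemma graph_M:
  assumes "a \<in> {1..3}" "b \<in> {1..3}" "c \<in> {1..3}" "distinct [a, b, c]"
  shows "graph 1 3 {T 1, V a} (\<lambda>x. if x = V b then lit e b else lit f c)
      (\<lambda>x. if x = V b then u (lit d a) else 1 - u (lit d a))"
  using assms coords_13[OF assms] u_lit_nonzero[of d a]
  by unfold_locales (auto simp: lit_def split: if_splits)

lemma generic_point_M:
  assumes "a \<in> {1..3}" "b \<in> {1..3}" "c \<in> {1..3}" "distinct [a, b, c]"
  shows "generic_point 3 (gens_M (lit d a) (lit e b) (lit f c))"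
  using graph_generic_point[OF graph_M[OF assms, of e f d]] assms(4)
  by (simp add: coords_13[OF assms] gens_M_def)

abbreviation M_gens :: "qpoly set" where
  "M_gens \<equiv> gens_M (lit False 1) (lit False 2) (lit False 3)"

lemma generic_point_sub_M:
  assumes "\<sigma> permutes {1..3}"
  shows "generic_point 3 (sub S \<sigma> ` M_gens)"
  using permutes_in_image[OF assms, of 1] permutes_in_image[OF assms, of 2] permutes_in_image[OF assms, of 3]
    inj_eq[OF permutes_inj[OF assms], of 1 2] inj_eq[OF permutes_inj[OF assms], of 1 3]
    inj_eq[OF permutes_inj[OF assms], of 2 3]
  unfolding sub_gens_M by (intro generic_point_M) auto

text \<open>Both morphisms move the cubical factors up by one, so an element of the group of the
  square acts as an element of equal sign on factors 2 and 3. The hypothesis on \<open>T 1\<close>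
  says that \<open>u\<close> is the pull-back of 1 - t.\<close>

lemma pull_back_b:
  assumes \<phi>: "\<phi> = substitute \<theta>" and T: "\<theta> (T 1) = 1 - u (lit False 1)"
    and V: "\<And>i. \<theta> (V i) = var (V (i + 1))"
  shows "Alt 3 (pull_back (coord_ring 1 3) (times_cube A1 3) \<phi> (Alt 2 (prime_cycle 2 b_gens))) =
    Alt 3 (prime_cycle 3 M_gens)"
proof (rule linear_Alt_prime_cycle[OF cycle_linear_comp[OF cycle_linear_Alt cycle_linear_pull_back]])
  show "b_gens \<subseteq> polys_in (coords 1 2)"
    by (rule gens_b_in) auto
  fix S :: "nat set" and \<sigma> :: "nat \<Rightarrow> nat" assume S: "S \<subseteq> {1..2}" and \<sigma>: "\<sigma> permutes {1..2::nat}"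
  \<comment> \<open>This is \<sigma> acting on the shifted factors 2 and 3, with factor 1
    fixed.\<close>
  define \<sigma>' where "\<sigma>' = (if \<sigma> = id then id else Transposition.transpose 2 (3::nat))"
  have swap_neq_id: "Transposition.transpose 1 (2::nat) \<noteq> id"
  proof
    assume "Transposition.transpose 1 (2::nat) = id"
    then have "Transposition.transpose 1 (2::nat) 1 = id 1"
      by (simp only:)
    then show False
      by simp
  qed
  have \<sigma>'_permutes: "\<sigma>' permutes {1..3}"
    by (auto simp: \<sigma>'_def permutes_id intro!: permutes_swap_id)
  have \<sigma>'_eq: "\<sigma>' 1 = 1" "\<sigma>' 2 = \<sigma> 1 + 1" "\<sigma>' 3 = \<sigma> 2 + 1" and sign: "sign \<sigma>' = sign \<sigma>"
    using permutes_2[OF \<sigma>] swap_neq_id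
    by (elim disjE; simp add: \<sigma>'_def sign_swap_id Transposition.transpose_def)+
  have S': "Suc ` S \<subseteq> {1..3}" "card (Suc ` S) = card S"
    using S by (auto simp: card_image)
  have hom: "unital_hom \<phi>"
    unfolding \<phi> by (rule unital_hom_substitute)
  have lit: "\<phi> (lit e i) = lit e (i + 1)" for e i
    by (simp add: \<phi> V lit_def)
  have mem: "i + 1 \<in> Suc ` S \<longleftrightarrow> i \<in> S" "1 \<notin> Suc ` S" for i
    using S by (auto simp: One_nat_def)
  have "\<phi> ` sub S \<sigma> ` b_gens =
      gens_M (lit False 1) (lit (\<sigma> 1 \<in> S) (\<sigma> 1 + 1)) (lit (\<sigma> 2 \<in> S) (\<sigma> 2 + 1))"
    unfolding sub_gens_b gens_b_def gens_M_def
    by (simp add: unital_hom.simps[OF hom] lit) (simp add: \<phi> T)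
  also have "\<dots> = sub (Suc ` S) \<sigma>' ` M_gens"
    by (simp add: \<sigma>'_eq mem)
  finally have img: "\<phi> ` sub S \<sigma> ` b_gens = sub (Suc ` S) \<sigma>' ` M_gens" .
  have into: "\<phi> p \<in> polys_in (coords 1 3)" if "p \<in> polys_in (coords 1 2)" for p
    unfolding \<phi> by (rule substitute_in[OF that]) (auto simp: coords_1[of 2] T V)
  have "sub S \<sigma> ` b_gens \<subseteq> polys_in (coords 1 2)"
    using generic_point_sub_b[OF \<sigma>] by (simp add: generic_point_def)
  then have "pull_back (coord_ring 1 3) (times_cube A1 3) \<phi> (prime_cycle 2 (sub S \<sigma> ` b_gens)) =
      prime_cycle 3 (\<phi> ` sub S \<sigma> ` b_gens)"
    using pull_back_generic[OF hom into, where G = "sub S \<sigma> ` b_gens" and Y = A1] zero_in_A1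
      generic_point_sub_M[OF \<sigma>'_permutes] unfolding img by simp
  then show "Alt 3 (pull_back (coord_ring 1 3) (times_cube A1 3) \<phi> (prime_cycle 2 (sub S \<sigma> ` b_gens))) =
      scale (cube_sign S \<sigma>) (Alt 3 (prime_cycle 3 M_gens))"
    using Alt_sub[OF S'(1) \<sigma>'_permutes gens_M_in[of 1 3 2 3 False False False]]
    by (simp only: img S'(2) sign V_in_coords) simp
qed

end


section \<open>The differential\<close>

lemma sum_Pow_insert:
  assumes "finite A" and "x \<notin> A"
  shows "(\<Sum>S\<in>Pow (insert x A). g S) = (\<Sum>S\<in>Pow A. g S + g (insert x S))"
proof -
  have "inj_on (insert x) (Pow A)"
  proof (rule inj_onI)
    fix S S' assume "S \<in> Pow A" "S' \<in> Pow A" "insert x S = insert x S'"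
    moreover from this assms(2) have "x \<notin> S" "x \<notin> S'"
      by auto
    ultimately show "S = S'"
      using insert_ident by metis
  qed
  moreover have "Pow A \<inter> insert x ` Pow A = {}"
    using assms(2) by auto
  ultimately show ?thesis
    unfolding Pow_insert using assms(1)
    by (simp add: sum.union_disjoint sum.reindex sum.distrib)
qed

lemma face_map_lit [simp]:
  "face_map i \<epsilon> (lit e j) =
    (if j = i then if e = (\<epsilon> = Infty) then 1 else 0 else lit e (if j < i then j else j - 1))"
  by (cases \<epsilon>) (auto simp: face_map_def lit_def)

lemma face_map_T [simp]: "face_map i \<epsilon> (var (T j)) = var (T j)"
  by (simp add: face_map_def)

lemma unital_hom_face_map: "unital_hom (face_map i \<epsilon>)"
  unfolding face_map_def by (rule unital_hom_substitute)

lemma face_map_in: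
  assumes "i \<in> {1..n}" and "p \<in> polys_in (coords 1 n)"
  shows "face_map i \<epsilon> p \<in> polys_in (coords 1 (n - 1))"
  unfolding face_map_def
  by (rule substitute_in[OF assms(2)]) (use assms(1) in \<open>auto simp: coords_1[of n]\<close>)

context surface
begin

text \<open>If A = 0 then u is 0 or 1. In that case, and for B = 0 or C = 0, an equation reads 0 =
  1. If B = 1 the first equation says u = 1, against the second; C = 1 is symmetric.\<close>

lemma gens_M_unit:
  assumes in_coords: "A \<in> polys_in (coords 1 n)" "B \<in> polys_in (coords 1 n)" "C \<in> polys_in (coords 1 n)"
    and cases: "A = 0 \<or> B = 0 \<or> B = 1 \<or> C = 0 \<or> C = 1"
  shows "1 \<in> gen 1 n (gens_M A B C)"
proof -
  have sub: "gens_M A B C \<subseteq> polys_in (coords 1 n)"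
    using in_coords by (auto simp: gens_M_def)
  let ?I = "gen 1 n (gens_M A B C)"
  have x: "B * u A - 1 \<in> ?I" and y: "C * (1 - u A) - 1 \<in> ?I"
    by (rule gen_memI[OF sub], simp add: gens_M_def)+
  have neg: "1 \<in> ?I" if "- 1 \<in> ?I"
    using gen_mult[OF sub that, of "- 1"] by simp
  have "u A = 0 \<or> u A = 1 \<or> B = 0 \<or> B = 1 \<or> C = 0 \<or> C = 1"
    using cases u_0 by auto
  then consider "u A = 0" | "u A = 1" | "B = 0" | "B = 1" | "C = 0" | "C = 1"
    by blast
  then show ?thesis
  proof cases
    case 4
    have "(C * (1 - u A) - 1) + C * (B * u A - 1) \<in> ?I"
      by (intro gen_add[OF sub] gen_mult[OF sub] x y in_coords)
    then show ?thesis
      using neg 4 by (simp add: algebra_simps)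
  next
    case 6
    have "(B * u A - 1) + B * (C * (1 - u A) - 1) \<in> ?I"
      by (intro gen_add[OF sub] gen_mult[OF sub] x y in_coords)
    then show ?thesis
      using neg 6 by (simp add: algebra_simps)
  qed (use x y neg in auto)
qed

text \<open>The value A = 1 turns \<open>u\<close> into 1 - t and so produces the equations of b.
  Every other face sets A to 0, or B or C to a constant, where \<open>gens_M_unit\<close>
  applies.\<close>

lemma face_M:
  assumes abc: "a \<in> {1..3}" "b \<in> {1..3}" "c \<in> {1..3}" "distinct [a, b, c]"
    and i: "i \<in> {1..3}" and Y: "{0} \<in> Y"
  shows "face_pull Y 3 i \<epsilon> (prime_cycle 3 (gens_M (lit d a) (lit e b) (lit f c))) =
    (if i = a \<and> d = (\<epsilon> = Infty)
     then prime_cycle 2 (gens_b (lit e (if b < a then b else b - 1)) (lit f (if c < a then c else c - 1)))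
     else 0)"
proof -
  let ?G = "gens_M (lit d a) (lit e b) (lit f c)"
  have img: "face_map i \<epsilon> ` ?G =
      gens_M (face_map i \<epsilon> (lit d a)) (face_map i \<epsilon> (lit e b)) (face_map i \<epsilon> (lit f c))"
    by (simp add: hom_gens_M[OF unital_hom_face_map])
  have into: "face_map i \<epsilon> p \<in> polys_in (coords 1 2)" if "p \<in> polys_in (coords 1 3)" for p
    using face_map_in[OF i that] by simp
  have lit_in: "lit x j \<in> polys_in (coords 1 3)" if "j \<in> {1..3}" for x j
    using that by simp
  have G: "?G \<subseteq> polys_in (coords 1 3)"
    using abc by (intro gens_M_in) auto
  show ?thesis
  proof (cases "i = a \<and> d = (\<epsilon> = Infty)")
    case True
    let ?B = "lit e (if b < a then b else b - 1)" and ?C = "lit f (if c < a then c else c - 1)"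
    have "face_map i \<epsilon> ` ?G = gens_M 1 ?B ?C"
      unfolding img using True abc(4) by (auto simp del: hom_gens_M)
    also have "\<dots> = gens_b ?B ?C"
      by (simp add: gens_M_def gens_b_def)
    finally have eq: "face_map i \<epsilon> ` ?G = gens_b ?B ?C" .
    have gp: "generic_point 2 (gens_b ?B ?C)"
      using abc by (intro generic_point_b) auto
    show ?thesis
      using pull_back_generic[OF unital_hom_face_map into G _ Y] True gp
      unfolding face_pull_def eq by simp
  next
    case False
    have "i = a \<or> i = b \<or> i = c"
      using abc i by auto
    then have "1 \<in> gen 1 2 (face_map i \<epsilon> ` ?G)"
      unfolding img using False by (intro gens_M_unit into lit_in abc) auto
    then have "face_pull Y 3 i \<epsilon> (prime_cycle 3 ?G) = 0"
      using pull_back_unit[OF unital_hom_face_map into G] by (simp add: face_pull_def)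
    then show ?thesis
      by (simp only: False if_False)
  qed
qed

lemma differential_M:
  assumes abc: "a \<in> {1..3}" "b \<in> {1..3}" "c \<in> {1..3}" "distinct [a, b, c]" and Y: "{0} \<in> Y"
  shows "differential Y 3 (prime_cycle 3 (gens_M (lit d a) (lit e b) (lit f c))) =
    scale ((- 1) ^ (a - 1) * (if d then - 1 else 1))
      (prime_cycle 2 (gens_b (lit e (if b < a then b else b - 1)) (lit f (if c < a then c else c - 1))))"
    (is "_ = ?rhs")
proof -
  let ?z = "prime_cycle 3 (gens_M (lit d a) (lit e b) (lit f c))"
  have "scale ((- 1) ^ (i - 1)) (face_pull Y 3 i Zero ?z - face_pull Y 3 i Infty ?z) =
      (if i = a then ?rhs else 0)" if "i \<in> {1..3}" for i
    using that by (simp add: face_M[OF abc that Y])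
  then have "differential Y 3 ?z = (\<Sum>i \<in> {1..3}. if i = a then ?rhs else 0)"
    unfolding differential_def by (rule sum.cong[OF refl])
  then show ?thesis
    using abc(1) by simp
qed

text \<open>Deleting the value \<sigma> 1 from a permutation of three letters changes its sign by
  (-1) to the power \<sigma> 1 - 1, and deleting a flip at that place changes the sign again. These
  are exactly the signs in the differential, so all contributions to a translate of b agree.\<close>

lemma differential_Alt_M:
  assumes Y: "{0} \<in> Y"
  shows "differential Y 3 (Alt 3 (prime_cycle 3 M_gens)) = Alt 2 (prime_cycle 2 b_gens)"
proof -
  interpret cycle_linear "differential Y 3"
    by (rule cycle_linear_differential)
  \<comment> \<open>The curves stay folded, so that the explicit expansion below treats them as
    formal symbols.\<close>
  define K where "K = (\<lambda>e b f c. prime_cycle 2 (gens_b (lit e b) (lit f c)))"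
  have sets: "{1..3} = {1, 2, 3::nat}" "{1..2} = {1, 2::nat}"
    by auto
  have M: "M_gens \<subseteq> polys_in (coords 1 3)" and b: "b_gens \<subseteq> polys_in (coords 1 2)"
    by (rule gens_M_in gens_b_in; simp)+
  have d: "differential Y 3 (prime_cycle 3 (sub S \<sigma> ` M_gens)) =
      scale ((- 1) ^ (\<sigma> 1 - 1) * (if \<sigma> 1 \<in> S then - 1 else 1))
        (K (\<sigma> 2 \<in> S) (if \<sigma> 2 < \<sigma> 1 then \<sigma> 2 else \<sigma> 2 - 1) (\<sigma> 3 \<in> S) (if \<sigma> 3 < \<sigma> 1 then \<sigma> 3 else \<sigma> 3 - 1))"
    if "\<sigma> permutes {1..3}" for S \<sigma>
    using permutes_in_image[OF that, of 1] permutes_in_image[OF that, of 2] permutes_in_image[OF that, of 3]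
      inj_eq[OF permutes_inj[OF that], of 1 2] inj_eq[OF permutes_inj[OF that], of 1 3]
      inj_eq[OF permutes_inj[OF that], of 2 3]
    unfolding sub_gens_M K_def by (subst differential_M[OF _ _ _ _ Y]) auto
  have s: "prime_cycle 2 (sub S \<sigma> ` b_gens) = K (\<sigma> 1 \<in> S) (\<sigma> 1) (\<sigma> 2 \<in> S) (\<sigma> 2)" for S \<sigma>
    unfolding sub_gens_b K_def by simp
  have "differential Y 3 (Alt 3 (prime_cycle 3 M_gens)) = scale (1 / 48)
     (\<Sum>S \<in> Pow {1..3}. \<Sum>\<sigma> | \<sigma> permutes {1..3}. scale (cube_sign S \<sigma>)
       (scale ((- 1) ^ (\<sigma> 1 - 1) * (if \<sigma> 1 \<in> S then - 1 else 1))
        (K (\<sigma> 2 \<in> S) (if \<sigma> 2 < \<sigma> 1 then \<sigma> 2 else \<sigma> 2 - 1) (\<sigma> 3 \<in> S) (if \<sigma> 3 < \<sigma> 1 then \<sigma> 3 else \<sigma> 3 - 1))))"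
    unfolding Alt_prime_cycle[OF M] scale sum
    by (intro arg_cong2[of _ _ _ _ Defs.scale] sum.cong) (auto simp only: d mem_Collect_eq, simp add: fact_numeral)
  \<comment> \<open>Three positions of \<sigma> 1, each flipped or not, give every translate of the
    curve six times.\<close>
  also have "\<dots> = scale (1 / 8)
     (\<Sum>S \<in> Pow {1..2}. \<Sum>\<sigma> | \<sigma> permutes {1..2}. scale (cube_sign S \<sigma>) (K (\<sigma> 1 \<in> S) (\<sigma> 1) (\<sigma> 2 \<in> S) (\<sigma> 2)))"
    unfolding sets
    by (rule poly_mapping_eqI)
       (simp add: sum_Pow_insert sum_over_permutations_insert sign_compose sign_swap_id
          permutation_swap_id permutation_compose lookup_add lookup_minus
          Transposition.transpose_def algebra_simps flip: One_nat_def)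
  also have "\<dots> = Alt 2 (prime_cycle 2 b_gens)"
    unfolding Alt_prime_cycle[OF b] s by simp
  finally show ?thesis .
qed

end


section \<open>Prime ideals of a polynomial ring in one variable\<close>

abbreviation prime_set :: "'a::comm_ring_1 set \<Rightarrow> bool" where
  "prime_set P \<equiv> primeideal P (type_subring UNIV)"

lemma closed_subring_UNIV: "closed_subring UNIV"
  by (simp add: closed_subring_def)

lemma prime_set_iff:
  "prime_set P \<longleftrightarrow> 0 \<in> P \<and> 1 \<notin> P \<and> (\<forall>a \<in> P. \<forall>b \<in> P. a + b \<in> P) \<and> (\<forall>a \<in> P. \<forall>b. b * a \<in> P) \<and>
    (\<forall>a b. a * b \<in> P \<longrightarrow> a \<in> P \<or> b \<in> P)"
  by (auto simp: primeideal_type_subring_iff[OF closed_subring_UNIV] ideal_type_subring_iff[OF closed_subring_UNIV])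

lemma prime_setD:
  assumes "prime_set P"
  shows "0 \<in> P" "1 \<notin> P" "a \<in> P \<Longrightarrow> b \<in> P \<Longrightarrow> a + b \<in> P" "a \<in> P \<Longrightarrow> b * a \<in> P" "a \<in> P \<Longrightarrow> a * b \<in> P"
    "a * b \<in> P \<Longrightarrow> a \<in> P \<or> b \<in> P" "a \<in> P \<Longrightarrow> - a \<in> P" "a \<in> P \<Longrightarrow> b \<in> P \<Longrightarrow> a - b \<in> P"
proof -
  show *: "0 \<in> P" "1 \<notin> P" "\<And>a b. a \<in> P \<Longrightarrow> b \<in> P \<Longrightarrow> a + b \<in> P" "\<And>a b. a \<in> P \<Longrightarrow> b * a \<in> P"
    "a * b \<in> P \<Longrightarrow> a \<in> P \<or> b \<in> P"
    using assms unfolding prime_set_iff by blast+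
  show "a \<in> P \<Longrightarrow> a * b \<in> P"
    using *(4)[of a b] by (simp add: mult.commute)
  have uminus: "- a \<in> P" if "a \<in> P" for a
    using *(4)[OF that, of "- 1"] by simp
  show "a \<in> P \<Longrightarrow> - a \<in> P"
    by (rule uminus)
  show "a \<in> P \<Longrightarrow> b \<in> P \<Longrightarrow> a - b \<in> P"
    using *(3)[of a "- b"] uminus[of b] by simp
qed

lemma prime_set_power: "prime_set P \<Longrightarrow> a ^ n \<in> P \<Longrightarrow> a \<in> P"
  by (induction n) (auto dest: prime_setD(6) simp: prime_setD(2))

text \<open>Otherwise the leading term lies in \<open>P\<close>, and subtracting it gives an element
  of \<open>Q\<close> outside \<open>P\<close> of smaller degree, or zero.\<close>

lemma minimal_degree_lead_coeff:
  fixes P Q :: "'a::idom poly set"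
  assumes P: "prime_set P" and Q: "prime_set Q" and "P \<subseteq> Q"
    and f: "f \<in> Q" "f \<notin> P" and min: "\<And>g. g \<in> Q \<Longrightarrow> g \<notin> P \<Longrightarrow> degree f \<le> degree g"
  shows "[:lead_coeff f:] \<notin> P"
proof
  assume lc: "[:lead_coeff f:] \<in> P"
  define m where "m = monom (lead_coeff f) (degree f)"
  have "m = monom 1 (degree f) * [:lead_coeff f:]"
    by (simp add: m_def smult_monom)
  then have m: "m \<in> P"
    using prime_setD(4)[OF P lc] by simp
  then have "f - m \<in> Q" "f - m \<notin> P"
    using prime_setD(8)[OF Q, of f m] prime_setD(3)[OF P, of "f - m" m] f \<open>P \<subseteq> Q\<close> by auto
  then have "degree f \<le> degree (f - m)" "f - m \<noteq> 0"
    using min prime_setD(1)[OF P] by auto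
  moreover have "degree (f - m) \<le> degree f"
    by (intro degree_diff_le) (simp_all add: m_def degree_monom_le)
  moreover have "coeff (f - m) (degree f) = 0"
    by (simp add: m_def)
  ultimately show False
    by (metis le_antisym leading_coeff_0_iff)
qed

text \<open>Over a field this says that the affine line has dimension one. Pseudo-division by elements of
  minimal degree replaces division with remainder.\<close>

lemma no_chain_over_same_prime:
  fixes P0 P1 P2 :: "'a::idom poly set"
  assumes P0: "prime_set P0" and P1: "prime_set P1" and P2: "prime_set P2"
    and lt: "P0 \<subset> P1" "P1 \<subset> P2" and base: "\<And>a. [:a:] \<in> P2 \<Longrightarrow> [:a:] \<in> P0"
  shows False
proof -
  \<comment> \<open>Both degrees are minimal among elements outside the bottom prime
    \<open>P0\<close>, for \<open>f\<close> within \<open>P1\<close> and for \<open>h\<close> within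
    \<open>P2\<close>.\<close>
  define f where "f = arg_min degree (\<lambda>g. g \<in> P1 - P0)"
  define h where "h = arg_min degree (\<lambda>g. g \<in> P2 - P0)"
  have f: "f \<in> P1 - P0" and f_min: "\<And>g. g \<in> P1 - P0 \<Longrightarrow> degree f \<le> degree g"
    using arg_min_nat_lemma[of "\<lambda>g. g \<in> P1 - P0" _ degree] lt(1) unfolding f_def by blast+
  have h: "h \<in> P2 - P0" and h_min: "\<And>g. g \<in> P2 - P0 \<Longrightarrow> degree h \<le> degree g"
    using arg_min_nat_lemma[of "\<lambda>g. g \<in> P2 - P0" _ degree] lt unfolding h_def by blast+
  have lc: "[:lead_coeff h:] \<notin> P0"
    using minimal_degree_lead_coeff[OF P0 P2, of h] lt h h_min by auto
  then have lc_P2: "[:lead_coeff h:] \<notin> P2"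
    using base by blast
  have h0: "h \<noteq> 0"
    using h prime_setD(1)[OF P0] by auto
  \<comment> \<open>The remainder stays in \<open>P2\<close> and is zero or of degree below that of
    \<open>h\<close>, so minimality puts it into \<open>P0\<close>.\<close>
  have division: "\<exists>n q r. smult (lead_coeff h ^ n) g = h * q + r \<and> (r = 0 \<or> degree r < degree h) \<and> r \<in> P0"
    if "g \<in> P2" for g
  proof -
    obtain q r where qr: "pseudo_divmod g h = (q, r)"
      by (cases "pseudo_divmod g h")
    define n where "n = Suc (degree g) - degree h"
    have eq: "smult (lead_coeff h ^ n) g = h * q + r" and r: "r = 0 \<or> degree r < degree h"
      using pseudo_divmod[OF h0 qr] by (simp_all add: n_def)
    have "r = [:lead_coeff h ^ n:] * g - h * q"
      using eq by simp
    then have "r \<in> P2"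
      using prime_setD(4)[OF P2 that] prime_setD(5)[OF P2, of h q] prime_setD(8)[OF P2] h by blast
    then have "r \<in> P0"
      using r h_min[of r] prime_setD(1)[OF P0] by fastforce
    then show ?thesis
      using eq r by blast
  qed
  \<comment> \<open>The leading coefficient of \<open>h\<close> avoids \<open>P2\<close>, because
    all three primes have the same constants; hence it can be cancelled modulo each of them.\<close>
  have cancel: "g \<in> P" if "prime_set P" "P \<subseteq> P2" "smult (lead_coeff h ^ n) g \<in> P" for P g n
  proof -
    have "[:lead_coeff h:] ^ n * g \<in> P"
      using that(3) by (simp add: poly_const_pow)
    then show ?thesis
      using prime_setD(6)[OF that(1)] prime_set_power[OF that(1)] lc_P2 that(2) by blast
  qed
  obtain n q r where nqr: "smult (lead_coeff h ^ n) f = h * q + r"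
      "r = 0 \<or> degree r < degree h" "r \<in> P0"
    using division[of f] f lt by blast
  have "[:lead_coeff h ^ n:] * f \<in> P1"
    using prime_setD(4)[OF P1] f by blast
  moreover have "h * q = [:lead_coeff h ^ n:] * f - r"
    using nqr(1) by simp
  ultimately have "h * q \<in> P1"
    using prime_setD(8)[OF P1] nqr(3) lt(1) by auto
  then consider "h \<in> P1" | "q \<in> P1"
    using prime_setD(6)[OF P1] by blast
  then show False
  proof cases
    case 1
    have "g \<in> P1" if g: "g \<in> P2" for g
    proof -
      obtain n q r where "smult (lead_coeff h ^ n) g = h * q + r" "r \<in> P0"
        using division[OF g] by blast
      then have "smult (lead_coeff h ^ n) g \<in> P1"
        using prime_setD(3)[OF P1] prime_setD(5)[OF P1 1] lt(1) by auto
      then show ?thesis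
        using cancel[OF P1] lt by blast
    qed
    then show False
      using lt by blast
  next
    \<comment> \<open>Now \<open>q\<close> lies in \<open>P1\<close> but not in \<open>P0\<close>,
      so its degree is at least that of \<open>f\<close>. As \<open>h\<close> is not constant, the
      product h q has too large a degree.\<close>
    case 2
    have "q \<notin> P0"
    proof
      assume "q \<in> P0"
      then have "smult (lead_coeff h ^ n) f \<in> P0"
        using nqr prime_setD(3)[OF P0] prime_setD(4)[OF P0] by simp
      then show False
        using cancel[OF P0] lt f by blast
    qed
    then have q: "degree f \<le> degree q" "q \<noteq> 0"
      using 2 f_min prime_setD(1)[OF P0] by auto
    have "degree h \<noteq> 0"
    proof
      assume "degree h = 0"
      then obtain c where "h = [:c:]"
        by (rule degree_eq_zeroE)
      then show False
        using h base by auto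
    qed
    then have "degree r < degree (h * q)"
      using nqr(2) q h0 by (auto simp: degree_mult_eq)
    then have "degree (h * q + r) = degree (h * q)"
      by (rule degree_add_eq_left)
    moreover have "degree (h * q + r) \<le> degree f"
      using degree_smult_le[of "lead_coeff h ^ n" f] nqr(1) by simp
    ultimately show False
      using q h0 \<open>degree h \<noteq> 0\<close> by (simp add: degree_mult_eq)
  qed
qed

text \<open>Gauss's lemma for the extension of a prime to the polynomial ring. It will be the
  generic point of a fibre.\<close>

lemma prime_set_coeffs:
  fixes x :: "'a::comm_ring_1 set"
  assumes x: "prime_set x"
  shows "prime_set {f :: 'a poly. \<forall>i. coeff f i \<in> x}"
proof -
  note x' = prime_setD[OF x]
  define P where "P = {f :: 'a poly. \<forall>i. coeff f i \<in> x}"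
  have sum_in: "(\<Sum>i\<in>A. g i) \<in> x" if "\<And>i. i \<in> A \<Longrightarrow> g i \<in> x" for A and g :: "nat \<Rightarrow> 'a"
    using that by (induction A rule: infinite_finite_induct) (auto intro: x')
  have "0 \<in> P" "1 \<notin> P"
    using x'(1,2) by (auto simp: P_def intro!: exI[of _ 0])
  moreover have "f + g \<in> P" if "f \<in> P" "g \<in> P" for f g
    using that x'(3) by (simp add: P_def)
  moreover have "g * f \<in> P" if f: "f \<in> P" for f g
  proof -
    have "(\<Sum>j\<le>i. coeff g j * coeff f (i - j)) \<in> x" for i
      by (rule sum_in) (use f in \<open>auto simp: P_def intro: x'(4)\<close>)
    then show ?thesis
      by (simp add: P_def coeff_mult)
  qed
  moreover have "f \<in> P \<or> g \<in> P" if fg: "f * g \<in> P" for f g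
  proof (rule ccontr)
    assume contra: "\<not> (f \<in> P \<or> g \<in> P)"
    \<comment> \<open>In the coefficient of the product at m + n, every term but one has a factor in
      \<open>x\<close>.\<close>
    define m where "m = (LEAST i. coeff f i \<notin> x)"
    define n where "n = (LEAST i. coeff g i \<notin> x)"
    have "\<exists>i. coeff f i \<notin> x" "\<exists>i. coeff g i \<notin> x"
      using contra by (auto simp: P_def)
    then have m: "coeff f m \<notin> x" and n: "coeff g n \<notin> x"
      unfolding m_def n_def by - (erule LeastI_ex)+
    have m': "coeff f i \<in> x" if "i < m" for i
      using not_less_Least that unfolding m_def by blast
    have n': "coeff g i \<in> x" if "i < n" for i
      using not_less_Least that unfolding n_def by blast
    have "(\<Sum>i\<in>{..m + n} - {m}. coeff f i * coeff g (m + n - i)) \<in> x"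
    proof (rule sum_in)
      fix i assume "i \<in> {..m + n} - {m}"
      then have "i < m \<or> m + n - i < n"
        by auto
      then show "coeff f i * coeff g (m + n - i) \<in> x"
        using m' n' x'(4,5) by blast
    qed
    moreover have "coeff (f * g) (m + n) = coeff f m * coeff g n +
        (\<Sum>i\<in>{..m + n} - {m}. coeff f i * coeff g (m + n - i))"
      unfolding coeff_mult by (subst sum.remove[of _ m]) auto
    moreover have "coeff (f * g) (m + n) \<in> x"
      using fg by (simp add: P_def)
    ultimately have "coeff f m * coeff g n \<in> x"
      using x'(8) by (metis add_diff_cancel_right')
    then show False
      using x'(6) m n by blast
  qed
  ultimately have "prime_set P"
    unfolding prime_set_iff by blast
  then show ?thesis
    by (simp only: P_def)
qed

text \<open>The kernel of evaluation at \<open>y\<close> followed by reduction modulo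
  \<open>x\<close>: the point of the fibre where the variable equals \<open>y\<close>.\<close>

lemma prime_set_poly:
  assumes x: "prime_set x"
  shows "prime_set {f. poly f y \<in> x}"
  using prime_setD[OF x] unfolding prime_set_iff by simp


section \<open>Polynomials in the base coordinate and \<open>V 1\<close>\<close>

lemma unital_hom_poly_map_poly:
  assumes h: "unital_hom h"
  shows "unital_hom (\<lambda>f. poly (map_poly h f) y)"
proof
  interpret unital_hom h by fact
  show "poly (map_poly h 1) y = 1"
    by (simp add: one)
  show add: "poly (map_poly h (p + q)) y = poly (map_poly h p) y + poly (map_poly h q) y" for p q
  proof -
    have "map_poly h (p + q) = map_poly h p + map_poly h q"
      by (rule poly_eqI) (simp add: coeff_map_poly zero add)
    then show ?thesis
      by simp
  qed
  show "poly (map_poly h (p * q)) y = poly (map_poly h p) y * poly (map_poly h q) y" for p q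
    by (induction p)
       (simp_all add: mult_pCons_left add map_poly_smult map_poly_pCons zero mult algebra_simps)
qed

text \<open>The degree arguments need polynomials in one variable over Q[t]; \<open>emb1\<close> and
  \<open>emb2\<close> realise Q[t] and Q[t][V1] inside \<open>qpoly\<close>.\<close>

definition emb1 :: "rat poly \<Rightarrow> qpoly" where
  "emb1 a = poly (map_poly const a) tt"

definition emb2 :: "rat poly poly \<Rightarrow> qpoly" where
  "emb2 f = poly (map_poly emb1 f) (var (V 1))"

lemma unital_hom_emb1: "unital_hom emb1"
  unfolding emb1_def[abs_def] by (rule unital_hom_poly_map_poly[OF unital_hom_const])

lemma unital_hom_emb2: "unital_hom emb2"
  unfolding emb2_def[abs_def] by (rule unital_hom_poly_map_poly[OF unital_hom_emb1])

lemmas emb1_simps = unital_hom.simps[OF unital_hom_emb1]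
lemmas emb2_simps = unital_hom.simps[OF unital_hom_emb2]

lemma emb1_pCons: "emb1 (pCons r a) = const r + tt * emb1 a"
  by (simp add: emb1_def map_poly_pCons)

lemma emb2_pCons: "emb2 (pCons a f) = emb1 a + var (V 1) * emb2 f"
  by (simp add: emb2_def map_poly_pCons emb1_simps)

lemma emb2_const: "emb2 [:a:] = emb1 a"
  by (simp add: emb2_pCons emb2_simps)

lemma emb1_in: "T 1 \<in> C \<Longrightarrow> emb1 a \<in> polys_in C"
  by (induction a) (simp_all add: emb1_simps emb1_pCons)

lemma emb2_in: "T 1 \<in> C \<Longrightarrow> V 1 \<in> C \<Longrightarrow> emb2 f \<in> polys_in C"
  by (induction f) (simp_all add: emb2_simps emb2_pCons emb1_in)

lemma emb1_surj: "p \<in> polys_in {T 1} \<Longrightarrow> \<exists>a. p = emb1 a"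
proof (induction p rule: polys_in_induct)
  case (const r)
  show ?case
    by (intro exI[of _ "[:r:]"]) (simp add: emb1_pCons emb1_simps)
next
  case (var x)
  then show ?case
    by (intro exI[of _ "[:0, 1:]"]) (simp add: emb1_pCons emb1_simps)
qed (metis emb1_simps(3), metis emb1_simps(4))

lemma emb2_surj: "p \<in> polys_in {T 1, V 1} \<Longrightarrow> \<exists>f. p = emb2 f"
proof (induction p rule: polys_in_induct)
  case (const r)
  show ?case
    by (intro exI[of _ "[:[:r:]:]"]) (simp add: emb2_const emb1_pCons emb1_simps)
next
  case (var x)
  have "tt = emb2 [:[:0, 1:]:]" "var (V 1) = emb2 [:0, 1:]"
    by (simp_all add: emb2_const emb2_pCons emb2_simps emb1_pCons emb1_simps)
  then show ?case
    using var by blast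
qed (metis emb2_simps(3), metis emb2_simps(4))

lemma emb2_inj: "emb2 f = emb2 g \<longleftrightarrow> f = g"
proof
  define c where "c = (\<lambda>r::rat. [:[:r:]:])"
  \<comment> \<open>A retraction onto Q[t][V1], left inverse to \<open>emb2\<close>.\<close>
  define ret where "ret = eval_poly c (\<lambda>x. case x of T i \<Rightarrow> [:[:0, 1:]:] | V i \<Rightarrow> [:0, 1:])"
  have c: "unital_hom c"
    by unfold_locales (simp_all add: c_def one_pCons)
  interpret ret: unital_hom ret
    unfolding ret_def by (rule unital_hom_eval_poly[OF c])
  have ret_const: "ret (const r) = [:[:r:]:]" and ret_T: "ret tt = [:[:0, 1:]:]" and ret_V: "ret (var (V 1)) = [:0, 1:]" for r
    by (simp_all add: ret_def c) (simp add: c_def)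
  have "ret (emb1 a) = [:a:]" for a
    by (induction a) (simp_all add: emb1_simps emb1_pCons ret.simps ret_const ret_T)
  then have "ret (emb2 f) = f" for f
    by (induction f) (simp_all add: emb2_simps emb2_pCons ret.simps ret_V)
  then show "emb2 f = emb2 g \<Longrightarrow> f = g"
    by metis
qed simp


section \<open>Points of the surfaces\<close>

lemma coords_10: "coords 1 0 = {T 1}"
  by (simp add: coords_1)

context surface
begin

abbreviation M :: point where
  "M \<equiv> gen 1 3 M_gens"

definition u2 :: "rat poly poly" where
  "u2 = (if \<alpha> = 0 then [:0, [:1, -1:]:] else [:1, [:0, -1:]:])"

lemma emb2_u2: "emb2 u2 = u (var (V 1))"
proof -
  have "const (- 1) = - 1"
    using unital_hom.uminus[OF unital_hom_const, of 1] by simp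
  then show ?thesis
    using \<alpha> unfolding u_def unfolding \<beta>
    by (auto simp: u2_def emb2_pCons emb1_pCons emb2_simps emb1_simps algebra_simps)
qed

lemma M_subset: "M_gens \<subseteq> polys_in (coords 1 3)"
  by (rule gens_M_in) auto

lemma emb2_in_R3 [simp]: "emb2 f \<in> polys_in (coords 1 3)"
  by (rule emb2_in) auto

lemma emb2_in_M: "emb2 f \<in> M \<longleftrightarrow> f = 0"
  and clear_M: "p \<in> polys_in (coords 1 3) \<Longrightarrow> prime_set P \<Longrightarrow> u2 \<notin> P \<Longrightarrow> 1 - u2 \<notin> P \<Longrightarrow>
    \<exists>H f. H \<notin> P \<and> emb2 H * p - emb2 f \<in> M"
proof -
  define w where "w = (\<lambda>x. if x = V 2 then lit False 2 else lit False 3)"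
  define h where "h = (\<lambda>x. if x = V 2 then u (lit False 1) else 1 - u (lit False 1))"
  interpret graph 1 3 "{T 1, V 1}" w h
    unfolding w_def h_def by (rule graph_M) auto
  have diff: "coords 1 3 - {T 1, V 1} = {V 2, V 3}"
    by (rule coords_13) auto
  have gens: "gens = M_gens"
    unfolding gens_def diff gens_M_def by (simp add: w_def h_def)
  show "emb2 f \<in> M \<longleftrightarrow> f = 0"
    using gen_base[of "emb2 f"] emb2_in[of "{T 1, V 1}" f] emb2_inj[of f 0]
    by (simp add: gens emb2_simps)
  assume p: "p \<in> polys_in (coords 1 3)" and P: "prime_set P" "u2 \<notin> P" "1 - u2 \<notin> P"
  define S where "S = {emb2 H | H. H \<notin> P}"
  have mult: "H * K \<in> S" if "H \<in> S" "K \<in> S" for H K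
    using that prime_setD(6)[OF P(1)] emb2_simps(4) unfolding S_def by (smt (verit) mem_Collect_eq)
  have one: "1 \<in> S"
    using prime_setD(2)[OF P(1)] unfolding S_def by (auto simp: emb2_simps intro!: exI[of _ 1])
  have "emb2 u2 \<in> S" "emb2 (1 - u2) \<in> S"
    using P unfolding S_def by blast+
  then have "h c \<in> S" for c
    by (simp add: h_def emb2_simps emb2_u2 lit_def)
  moreover have "S \<subseteq> polys_in {T 1, V 1}"
    by (auto simp: S_def intro!: emb2_in)
  ultimately obtain H b where "H \<in> S" "b \<in> polys_in {T 1, V 1}" "H * p - b \<in> gen 1 3 gens"
    using clear_denominators[OF p one mult] by blast
  then show "\<exists>H f. H \<notin> P \<and> emb2 H * p - emb2 f \<in> M"
    using emb2_surj[of b] unfolding S_def gens by blast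
qed

text \<open>The points of the surface correspond to the primes \<open>P\<close> of the ring of polynomials in the base
  coordinate and \<open>V 1\<close> that contain neither \<open>u\<close> nor \<open>1 - u\<close>: on the surface every polynomial is a
  fraction \<open>f / H\<close> with \<open>H \<notin> P\<close>, and \<open>pt P\<close> collects those with \<open>f \<in> P\<close>.\<close>

definition good :: "rat poly poly set \<Rightarrow> bool" where
  "good P \<longleftrightarrow> prime_set P \<and> u2 \<notin> P \<and> 1 - u2 \<notin> P"

definition rep :: "rat poly poly \<Rightarrow> rat poly poly \<Rightarrow> qpoly \<Rightarrow> bool" where
  "rep H f p \<longleftrightarrow> emb2 H * p - emb2 f \<in> M"

definition pt :: "rat poly poly set \<Rightarrow> point" where
  "pt P = {p \<in> polys_in (coords 1 3). \<exists>H f. H \<notin> P \<and> f \<in> P \<and> rep H f p}"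

lemma ex_rep: "good P \<Longrightarrow> p \<in> polys_in (coords 1 3) \<Longrightarrow> \<exists>H f. H \<notin> P \<and> rep H f p"
  using clear_M[of p P] by (simp add: good_def rep_def)

lemma rep_emb2: "rep 1 f (emb2 f)"
  by (simp add: rep_def emb2_simps gen_0[OF M_subset])

lemma rep_add:
  assumes "rep H f p" "rep K g q"
  shows "rep (H * K) (K * f + H * g) (p + q)"
proof -
  have "emb2 K * (emb2 H * p - emb2 f) + emb2 H * (emb2 K * q - emb2 g) \<in> M"
    using assms by (intro gen_add[OF M_subset] gen_mult[OF M_subset]) (simp_all add: rep_def)
  then show ?thesis
    by (simp add: rep_def emb2_simps algebra_simps)
qed

lemma rep_mult:
  assumes "rep H f p" "rep K g q" and q: "q \<in> polys_in (coords 1 3)"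
  shows "rep (H * K) (f * g) (p * q)"
proof -
  have "(emb2 K * q) * (emb2 H * p - emb2 f) + emb2 f * (emb2 K * q - emb2 g) \<in> M"
    using assms by (intro gen_add[OF M_subset] gen_mult[OF M_subset]) (simp_all add: rep_def)
  then show ?thesis
    by (simp add: rep_def emb2_simps algebra_simps)
qed

text \<open>Membership does not depend on the fraction chosen: \<open>M\<close> meets the image of
  \<open>emb2\<close> only in 0, so two representations satisfy H g = K f, and primality of
  \<open>P\<close> transfers membership.\<close>

lemma pt_iff:
  assumes P: "good P" and p: "p \<in> polys_in (coords 1 3)" and H: "H \<notin> P" and rep: "rep H f p"
  shows "p \<in> pt P \<longleftrightarrow> f \<in> P"
proof
  assume "p \<in> pt P"
  then obtain K g where K: "K \<notin> P" "g \<in> P" "rep K g p"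
    by (auto simp: pt_def)
  have "emb2 K * (emb2 H * p - emb2 f) - emb2 H * (emb2 K * p - emb2 g) \<in> M"
    using rep K(3) by (intro gen_diff[OF M_subset gen_mult[OF M_subset] gen_mult[OF M_subset]]) (simp_all add: rep_def)
  moreover have "emb2 K * (emb2 H * p - emb2 f) - emb2 H * (emb2 K * p - emb2 g) = emb2 (H * g - K * f)"
    by (simp add: emb2_simps algebra_simps)
  ultimately have "H * g = K * f"
    by (simp add: emb2_in_M)
  then have "K * f \<in> P"
    using P K(2) prime_setD(4)[of P g H] by (simp add: good_def)
  then show "f \<in> P"
    using P K(1) prime_setD(6)[of P K f] by (auto simp: good_def)
qed (use assms in \<open>auto simp: pt_def\<close>)

lemma pt_emb2: "good P \<Longrightarrow> emb2 f \<in> pt P \<longleftrightarrow> f \<in> P"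
  by (rule pt_iff[OF _ _ _ rep_emb2]) (auto simp: good_def prime_setD(2))

lemma M_subset_pt: "good P \<Longrightarrow> M \<subseteq> pt P"
proof
  fix p assume P: "good P" and p: "p \<in> M"
  then have "rep 1 0 p"
    by (simp add: rep_def emb2_simps)
  then show "p \<in> pt P"
    using pt_iff[OF P _ _ \<open>rep 1 0 p\<close>] p P gen_subset_polys_in[OF M_subset]
    by (auto simp: good_def prime_setD(1,2))
qed

lemma pt_prime:
  assumes P: "good P"
  shows "primeideal (pt P) (coord_ring 1 3)"
proof -
  have prime: "prime_set P"
    using P by (simp add: good_def)
  note P' = prime_setD[OF prime]
  have mult_not: "H * K \<notin> P" if "H \<notin> P" "K \<notin> P" for H K
    using that P'(6) by blast
  have "0 \<in> pt P" "1 \<notin> pt P"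
    using pt_emb2[OF P, of 0] pt_emb2[OF P, of 1] P'(1,2) by (auto simp: emb2_simps)
  moreover have "p + q \<in> pt P" if pq: "p \<in> pt P" "q \<in> pt P" for p q
  proof -
    obtain H f K g where r: "H \<notin> P" "f \<in> P" "rep H f p" "K \<notin> P" "g \<in> P" "rep K g q"
      using pq by (auto simp: pt_def)
    have in_R3: "p + q \<in> polys_in (coords 1 3)"
      using pq by (simp add: pt_def)
    show ?thesis
      using pt_iff[OF P in_R3 mult_not[OF r(1,4)] rep_add[OF r(3,6)]] P'(3,4) r(2,5) by blast
  qed
  moreover have "q * p \<in> pt P" if p: "p \<in> pt P" and q: "q \<in> polys_in (coords 1 3)" for p q
  proof -
    obtain H f where r: "H \<notin> P" "f \<in> P" "rep H f p"
      using p by (auto simp: pt_def)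
    obtain K g where r': "K \<notin> P" "rep K g q"
      using ex_rep[OF P q] by blast
    have in_R3: "p * q \<in> polys_in (coords 1 3)"
      using p q by (simp add: pt_def)
    have "p * q \<in> pt P"
      using pt_iff[OF P in_R3 mult_not[OF r(1) r'(1)] rep_mult[OF r(3) r'(2) q]] P'(5)[OF r(2)] by blast
    then show ?thesis
      by (simp add: mult.commute)
  qed
  moreover have "p \<in> pt P \<or> q \<in> pt P"
    if p: "p \<in> polys_in (coords 1 3)" and q: "q \<in> polys_in (coords 1 3)" and pq: "p * q \<in> pt P" for p q
  proof -
    obtain H f where r: "H \<notin> P" "rep H f p"
      using ex_rep[OF P p] by blast
    obtain K g where r': "K \<notin> P" "rep K g q"
      using ex_rep[OF P q] by blast
    have "p * q \<in> polys_in (coords 1 3)"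
      using p q by simp
    then have "f * g \<in> P"
      using pt_iff[OF P _ mult_not[OF r(1) r'(1)] rep_mult[OF r(2) r'(2) q]] pq by blast
    then show ?thesis
      using P'(6) pt_iff[OF P p r] pt_iff[OF P q r'] by blast
  qed
  moreover have "pt P \<subseteq> polys_in (coords 1 3)"
    by (auto simp: pt_def)
  ultimately show ?thesis
    unfolding primeideal_coord_ring_iff ideal_coord_ring_iff by blast
qed

lemma pt_mono:
  assumes P: "good P" and P': "good P'" and "P \<subseteq> P'"
  shows "pt P \<subseteq> pt P'"
proof
  fix p assume p: "p \<in> pt P"
  then have in_R3: "p \<in> polys_in (coords 1 3)"
    by (simp add: pt_def)
  then obtain H f where r: "H \<notin> P'" "rep H f p"
    using ex_rep[OF P'] by blast
  then show "p \<in> pt P'"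
    using pt_iff[OF P in_R3 _ r(2)] pt_iff[OF P' in_R3 r] p \<open>P \<subseteq> P'\<close> by blast
qed

text \<open>The equations of the surface make u and 1 - u units modulo \<open>Q\<close>.\<close>

lemma contract_good:
  assumes Q: "primeideal Q (coord_ring 1 3)" and MQ: "M \<subseteq> Q"
  shows "good (emb2 -` Q)"
proof -
  note Q' = primeidealD[OF Q]
  have V_in: "var (V 2) \<in> polys_in (coords 1 3)" "var (V 3) \<in> polys_in (coords 1 3)"
    by auto
  have "prime_set (emb2 -` Q)"
    unfolding prime_set_iff using Q' by (auto simp: emb2_simps)
  moreover have "var (V 2) * emb2 u2 - 1 \<in> Q" "var (V 3) * emb2 (1 - u2) - 1 \<in> Q"
    using MQ gen_superset[OF M_subset] by (auto simp: gens_M_def lit_def emb2_u2 emb2_simps)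
  then have "emb2 u2 \<notin> Q" "emb2 (1 - u2) \<notin> Q"
    using Q'(5)[of "var (V 2) * emb2 u2" "var (V 2) * emb2 u2 - 1"] Q'(6)[OF _ V_in(1), of "emb2 u2"]
      Q'(5)[of "var (V 3) * emb2 (1 - u2)" "var (V 3) * emb2 (1 - u2) - 1"]
      Q'(6)[OF _ V_in(2), of "emb2 (1 - u2)"] Q'(3) by auto
  ultimately show ?thesis
    by (simp add: good_def)
qed

text \<open>Modulo \<open>Q\<close> the product H p is a polynomial in t and V1, and H lies outside
  \<open>Q\<close>, so the contraction of \<open>Q\<close> already decides membership.\<close>

lemma pt_contract:
  assumes Q: "primeideal Q (coord_ring 1 3)" and MQ: "M \<subseteq> Q"
  shows "pt (emb2 -` Q) = Q"
proof -
  note Q' = primeidealD[OF Q]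
  have "p \<in> pt (emb2 -` Q) \<longleftrightarrow> p \<in> Q" if p: "p \<in> polys_in (coords 1 3)" for p
  proof -
    obtain H f where r: "H \<notin> emb2 -` Q" "rep H f p"
      using ex_rep[OF contract_good[OF assms] p] by blast
    have d: "emb2 H * p - emb2 f \<in> Q"
      using r(2) MQ by (auto simp: rep_def)
    have "emb2 f \<in> Q \<longleftrightarrow> emb2 H * p \<in> Q"
      using Q'(5)[OF _ d, of "emb2 H * p"] Q'(4)[OF d, of "emb2 f"] by auto
    also have "\<dots> \<longleftrightarrow> p \<in> Q"
      using Q'(8)[OF _ p, of "emb2 H"] Q'(6)[of p "emb2 H"] r(1) by auto
    finally show ?thesis
      using pt_iff[OF contract_good[OF assms] p r] by simp
  qed
  then show ?thesis
    using Q'(1) by (auto simp: pt_def)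
qed

text \<open>Contraction is injective by \<open>pt_contract\<close>, so chains of points of the
  surface become chains of equal length in Q[t][V1].\<close>

lemma contract_strict_mono:
  assumes "primeideal Q (coord_ring 1 3)" "M \<subseteq> Q" "primeideal Q' (coord_ring 1 3)" "M \<subseteq> Q'" "Q \<subset> Q'"
  shows "emb2 -` Q \<subset> emb2 -` Q'"
proof
  show "emb2 -` Q \<subseteq> emb2 -` Q'"
    using assms(5) by auto
  show "emb2 -` Q \<noteq> emb2 -` Q'"
  proof
    assume "emb2 -` Q = emb2 -` Q'"
    then have "pt (emb2 -` Q) = pt (emb2 -` Q')"
      by (rule arg_cong)
    then have "Q = Q'"
      by (simp only: pt_contract[OF assms(1,2)] pt_contract[OF assms(3,4)])
    then show False
      using assms(5) by blast
  qed
qed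

lemma emb1_in_proj_base: "emb1 a \<in> proj_base Q \<longleftrightarrow> emb1 a \<in> Q"
  by (auto simp: proj_base_def coords_10 intro!: emb1_in)

lemma proj_base_eqI:
  assumes "x \<subseteq> polys_in {T 1}" and "\<And>a. emb1 a \<in> Q \<longleftrightarrow> emb1 a \<in> x"
  shows "proj_base Q = x"
  using assms emb1_surj unfolding proj_base_def coords_10 carrier_coord_ring by blast

end


section \<open>Equidimensionality\<close>

lemma dim_closure_eq_0:
  assumes "W \<in> S" and "\<And>Q. Q \<in> S \<Longrightarrow> Q = W"
  shows "dim_closure S W = enat 0"
proof -
  have "{enat k | k c. c 0 = W \<and> (\<forall>i \<le> k. c i \<in> S) \<and> (\<forall>i < k. c i \<subset> c (Suc i))} = {enat 0}"
  proof (intro equalityI subsetI)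
    fix n assume "n \<in> {enat k | k c. c 0 = W \<and> (\<forall>i \<le> k. c i \<in> S) \<and> (\<forall>i < k. c i \<subset> c (Suc i))}"
    then obtain k c where c: "n = enat k" "c 0 = W" "\<forall>i \<le> k. c i \<in> S" "\<forall>i < k. c i \<subset> c (Suc i)"
      by blast
    have "k = 0"
    proof (rule ccontr)
      assume "k \<noteq> 0"
      then have "c 0 \<subset> c (Suc 0)" "c (Suc 0) \<in> S"
        using c by auto
      then show False
        using assms(2) c(2) by blast
    qed
    then show "n \<in> {enat 0}"
      using c by simp
  next
    fix n assume "n \<in> {enat 0}"
    then show "n \<in> {enat k | k c. c 0 = W \<and> (\<forall>i \<le> k. c i \<in> S) \<and> (\<forall>i < k. c i \<subset> c (Suc i))}"
      using assms(1) by (intro CollectI exI[of _ 0] exI[of _ "\<lambda>_. W"]) simp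
  qed
  then show ?thesis
    by (simp add: dim_closure_def)
qed

lemma dim_closure_eq_1:
  assumes S: "W \<in> S" "Q \<in> S" "W \<subset> Q"
    and no_chain: "\<And>P0 P1 P2. P0 \<in> S \<Longrightarrow> P1 \<in> S \<Longrightarrow> P2 \<in> S \<Longrightarrow> P0 \<subset> P1 \<Longrightarrow> P1 \<subset> P2 \<Longrightarrow> False"
  shows "dim_closure S W = enat 1"
  unfolding dim_closure_def
proof (rule antisym)
  let ?D = "{enat k | k c. c 0 = W \<and> (\<forall>i \<le> k. c i \<in> S) \<and> (\<forall>i < k. c i \<subset> c (Suc i))}"
  show "Sup ?D \<le> enat 1"
  proof (rule Sup_least)
    fix n assume "n \<in> ?D"
    then obtain k c where c: "n = enat k" "\<forall>i \<le> k. c i \<in> S" "\<forall>i < k. c i \<subset> c (Suc i)"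
      by blast
    have "k \<le> 1"
    proof (rule ccontr)
      assume k: "\<not> k \<le> 1"
      then have "0 < k" "Suc 0 < k" "Suc (Suc 0) \<le> k"
        by auto
      then show False
        using no_chain[of "c 0" "c (Suc 0)" "c (Suc (Suc 0))"] c by simp
    qed
    then show "n \<le> enat 1"
      by (simp add: c)
  qed
  have "enat 1 \<in> ?D"
    using S by (intro CollectI exI[of _ 1] exI[of _ "\<lambda>i. if i = 0 then W else Q"]) auto
  then show "enat 1 \<le> Sup ?D"
    by (rule Sup_upper)
qed

lemma prime_set_emb1_vimage:
  assumes "primeideal x (coord_ring 1 0)"
  shows "prime_set (emb1 -` x)"
proof -
  have "emb1 a \<in> polys_in (coords 1 0)" for a
    by (rule emb1_in) simp
  then show ?thesis
    unfolding prime_set_iff using primeidealD[OF assms] by (auto simp: emb1_simps)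
qed

context surface
begin

lemma locus_M_iff:
  "Q \<in> locus Y 3 M \<longleftrightarrow> primeideal Q (coord_ring 1 3) \<and> proj_base Q \<in> Y \<and> M \<subseteq> Q"
  by (auto simp: locus_def times_cube_def Spec_def)

lemma emb1_mem_iff: "proj_base Q = x \<Longrightarrow> emb1 a \<in> Q \<longleftrightarrow> emb1 a \<in> x"
  using emb1_in_proj_base by blast

text \<open>Via \<open>pt\<close> the fibre consists of the primes of Q[t][V1] over
  \<open>x'\<close> that avoid \<open>u2\<close> and \<open>1 - u2\<close>. The component
  \<open>W\<close> shows that there is one; it must then be the extension of \<open>x'\<close>, and
  one more point makes the dimension positive.\<close>

lemma dim_fiber_M:
  assumes x: "primeideal x (coord_ring 1 0)" "x \<in> Y"
    and W: "W \<in> irred_components (fiber_pts (locus Y 3 M) x)"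
  shows "dim_closure (fiber_pts (locus Y 3 M) x) W = enat 1"
proof -
  define F where "F = fiber_pts (locus Y 3 M) x"
  have F_iff: "Q \<in> F \<longleftrightarrow> primeideal Q (coord_ring 1 3) \<and> M \<subseteq> Q \<and> proj_base Q = x" for Q
    using x(2) by (auto simp: F_def fiber_pts_def locus_M_iff)
  define x' where "x' = emb1 -` x"
  have x': "prime_set x'"
    unfolding x'_def by (rule prime_set_emb1_vimage[OF x(1)])
  note x'D = prime_setD[OF x']
  have x_sub: "x \<subseteq> polys_in {T 1}"
    using primeidealD(1)[OF x(1)] by (simp add: coords_10)
  have WF: "W \<in> F" and W_min: "\<And>P. P \<in> F \<Longrightarrow> P \<subseteq> W \<Longrightarrow> P = W"
    using W unfolding irred_components_def F_def by auto
  have W_prime: "primeideal W (coord_ring 1 3)" and MW: "M \<subseteq> W" and W_x: "proj_base W = x"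
    using WF by (auto simp: F_iff)
  define W' where "W' = emb2 -` W"
  have W': "good W'" "pt W' = W"
    unfolding W'_def using contract_good pt_contract W_prime MW by auto
  then have W'_prime: "prime_set W'"
    by (simp add: good_def)
  \<comment> \<open>The extension of \<open>x'\<close> lies below every prime over
    \<open>x'\<close>. Being contained in \<open>W'\<close>, it avoids \<open>u2\<close> and
    \<open>1 - u2\<close> as well.\<close>
  define P where "P = {f. \<forall>i. coeff f i \<in> x'}"
  have "f \<in> W'" if "f \<in> P" for f
    using that
  proof (induction f)
    case 0
    show ?case
      by (rule prime_setD(1)[OF W'_prime])
  next
    case (pCons a f)
    have coeffs: "coeff (pCons a f) i \<in> x'" for i
      using pCons.prems by (simp add: P_def)
    have "coeff f i \<in> x'" for i
      using coeffs[of "Suc i"] by simp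
    then have "a \<in> x'" "f \<in> P"
      using coeffs[of 0] by (simp_all add: P_def)
    then have "[:a:] \<in> W'"
      using emb1_mem_iff[OF W_x, of a] by (simp add: W'_def x'_def emb2_const)
    moreover have "[:0, 1:] * f \<in> W'"
      by (rule prime_setD(4)[OF W'_prime pCons.IH[OF \<open>f \<in> P\<close>]])
    ultimately have "[:a:] + [:0, 1:] * f \<in> W'"
      by (rule prime_setD(3)[OF W'_prime])
    then show ?case
      by simp
  qed
  then have P_W': "P \<subseteq> W'"
    by blast
  have P: "good P"
    using W'(1) P_W' prime_set_coeffs[OF x'] unfolding good_def P_def by blast
  have const_P: "[:a:] \<in> P \<longleftrightarrow> a \<in> x'" for a
    using x'D(1) by (auto simp: P_def coeff_pCons split: nat.splits)
  have "proj_base (pt P) = x"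
    using const_P by (intro proj_base_eqI x_sub) (simp add: pt_emb2[OF P] x'_def flip: emb2_const)
  then have "pt P \<in> F"
    by (simp add: F_iff pt_prime[OF P] M_subset_pt[OF P])
  then have W_eq: "W = pt P"
    using W_min[of "pt P"] pt_mono[OF P W'(1) P_W'] W'(2) by simp
  have be: "u2 \<notin> P" "1 - u2 \<notin> P"
    using P by (auto simp: good_def)
  have two: "(1 + 1 :: rat poly) \<notin> x'"
  proof
    assume "1 + 1 \<in> x'"
    then have "[:1/2:] * (1 + 1) \<in> x'"
      by (rule x'D(4))
    then show False
      using x'D(2) by (simp add: one_pCons)
  qed
  have "\<exists>y :: rat poly. poly u2 y \<notin> x' \<and> 1 - poly u2 y \<notin> x'"
  proof -
    \<comment> \<open>Here \<open>u2\<close> is c + s V1. A slope in \<open>x'\<close> would make u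
      or 1 - u vanish on the whole fibre.\<close>
    define s :: "rat poly" where "s = (if \<alpha> = 0 then [:1, -1:] else [:0, -1:])"
    have "s \<notin> x'"
    proof
      assume "s \<in> x'"
      then have "u2 \<in> P \<or> 1 - u2 \<in> P"
        using x'D(1) x'D(7)[of s] by (auto simp: P_def s_def u2_def one_pCons coeff_pCons split: nat.splits if_splits)
      then show False
        using be by blast
    qed
    then have "- s \<notin> x'"
      using x'D(7)[of "- s"] by auto
    obtain c :: "rat poly" where c: "c = 0 \<or> c = 1" "u2 = [:c, s:]"
      unfolding u2_def s_def by (cases "\<alpha> = 0") auto
    have "1 - s \<notin> x' \<or> 1 + s \<notin> x'"
      using two x'D(3)[of "1 - s" "1 + s"] by auto
    \<comment> \<open>At y = 1 and y = -1 the two quantities are, up to sign, \<open>s\<close> and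
      one of 1 - s, 1 + s. The last two add up to 2, a unit, so they cannot both lie in
      \<open>x'\<close>.\<close>
    then have "\<exists>y. c + y * s \<notin> x' \<and> 1 - (c + y * s) \<notin> x'"
      using c(1) \<open>s \<notin> x'\<close> \<open>- s \<notin> x'\<close> by (auto intro: exI[of _ 1] exI[of _ "- 1"])
    then show ?thesis
      by (simp add: c(2))
  qed
  then obtain y where y: "poly u2 y \<notin> x'" "1 - poly u2 y \<notin> x'"
    by blast
  \<comment> \<open>The point V1 = y of the fibre; V1 - y belongs to it but not to the generic
    point.\<close>
  define P1 where "P1 = {f. poly f y \<in> x'}"
  have P1: "good P1"
    using prime_set_poly[OF x', of y] y by (simp add: good_def P1_def)
  have const_P1: "[:a:] \<in> P1 \<longleftrightarrow> a \<in> x'" for a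
    by (simp add: P1_def)
  have "proj_base (pt P1) = x"
    using const_P1 by (intro proj_base_eqI x_sub) (simp add: pt_emb2[OF P1] x'_def flip: emb2_const)
  then have P1_F: "pt P1 \<in> F"
    by (simp add: F_iff pt_prime[OF P1] M_subset_pt[OF P1])
  have "P \<subseteq> P1"
  proof
    fix f assume f: "f \<in> P"
    have "(\<Sum>i\<in>A. coeff f i * y ^ i) \<in> x'" for A
      by (induction A rule: infinite_finite_induct) (use f x'D in \<open>auto simp: P_def\<close>)
    then show "f \<in> P1"
      by (simp add: P1_def poly_altdef)
  qed
  then have "pt P \<subseteq> pt P1"
    by (rule pt_mono[OF P P1])
  moreover have "[:- y, 1:] \<in> P1" "[:- y, 1:] \<notin> P"
    using x'D(1,2) by (auto simp: P1_def P_def intro!: exI[of _ 1]) (auto simp: coeff_pCons One_nat_def)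
  then have "emb2 [:- y, 1:] \<in> pt P1" "emb2 [:- y, 1:] \<notin> pt P"
    by (simp_all add: pt_emb2 P P1)
  ultimately have "W \<subset> pt P1"
    using W_eq by blast
  moreover have False if chain: "P0 \<in> F" "P1 \<in> F" "P2 \<in> F" "P0 \<subset> P1" "P1 \<subset> P2" for P0 P1 P2
  proof (rule no_chain_over_same_prime)
    show "prime_set (emb2 -` P0)" "prime_set (emb2 -` P1)" "prime_set (emb2 -` P2)"
      using chain contract_good by (auto simp: F_iff good_def)
    show "emb2 -` P0 \<subset> emb2 -` P1" "emb2 -` P1 \<subset> emb2 -` P2"
      using chain unfolding F_iff by (intro contract_strict_mono; blast)+
    fix a assume "[:a:] \<in> emb2 -` P2"
    then show "[:a:] \<in> emb2 -` P0"
      using chain emb1_mem_iff[of P0 x a] emb1_mem_iff[of P2 x a] by (simp add: emb2_const F_iff)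
  qed
  ultimately show ?thesis
    using dim_closure_eq_1[OF WF P1_F] unfolding F_def by blast
qed

lemma equidimensional_M:
  assumes Y: "{0} \<in> Y" "Y \<subseteq> A1"
  shows "equidimensional Y (locus Y 3 M) 1"
  unfolding equidimensional_def
proof (intro conjI ballI)
  fix W assume W: "W \<in> irred_components (locus Y 3 M)"
  have gp: "generic_point 3 M_gens"
    by (rule generic_point_M) auto
  then have "M \<in> locus Y 3 M"
    using Y(1) by (simp add: locus_M_iff generic_point_def)
  moreover have "M \<subseteq> W"
    using W locus_M_iff[of W Y] unfolding irred_components_def by blast
  ultimately have "W = M"
    using W unfolding irred_components_def by blast
  then show "dominates_base W"
    using gp by (simp add: dominates_base_def generic_point_def)
next
  fix x W assume x: "x \<in> Y" and W: "W \<in> irred_components (fiber_pts (locus Y 3 M) x)"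
  have "primeideal x (coord_ring 1 0)"
    using x Y(2) by (auto simp: A1_def Spec_def)
  from dim_fiber_M[OF this x W]
  show "\<exists>d. dim_closure (fiber_pts (locus Y 3 M) x) W = enat d \<and> int d = 1"
    by auto
qed

text \<open>By the factor theorem a polynomial agrees with its value at 1 modulo V1 - 1, so
  constants decide membership.\<close>

lemma linear_factor_mem:
  assumes "prime_set P" and "[:- 1, 1:] \<in> P"
  shows "f \<in> P \<longleftrightarrow> [:poly f 1:] \<in> P"
proof -
  have "[:- 1, 1:] dvd f - [:poly f 1:]"
    by (simp flip: poly_eq_0_iff_dvd)
  then have d: "f - [:poly f 1:] \<in> P"
    using prime_setD(5)[OF assms] by (auto elim!: dvdE)
  show ?thesis
    using prime_setD(3)[OF assms(1) d, of "[:poly f 1:]"] prime_setD(8)[OF assms(1) _ d, of f] by auto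
qed

text \<open>On V1 = 1 the remaining coordinates are rational functions of t, so the projection to
  the base is injective on points and nonempty fibres are single points.\<close>

lemma equidimensional_face:
  assumes Y: "{0} \<in> Y" "Y \<subseteq> A1" and F: "dom F = {1}" "F 1 = Some Zero"
  shows "equidimensional Y (locus Y 3 M \<inter> times_face Y 3 F) 0"
proof -
  define S where "S = locus Y 3 M \<inter> times_face Y 3 F"
  have F_iff: "F i = Some e \<longleftrightarrow> i = 1 \<and> e = Zero" for i e
    using F by (cases "i = 1") (auto simp: dom_def)
  have V1: "emb2 [:- 1, 1:] = var (V 1) - 1"
    using unital_hom.uminus[OF unital_hom_const, of 1]
    by (simp add: emb2_pCons emb2_simps emb1_simps)
  have S_iff: "Q \<in> S \<longleftrightarrow> primeideal Q (coord_ring 1 3) \<and> proj_base Q \<in> Y \<and> M \<subseteq> Q \<and> emb2 [:- 1, 1:] \<in> Q" for Q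
    by (auto simp: S_def times_face_def locus_M_iff times_cube_def Spec_def F_iff V1)
  \<comment> \<open>The generic point of V1 = 1. It avoids \<open>u2\<close> and
    \<open>1 - u2\<close>, whose values there are 1 - t and t.\<close>
  define P :: "rat poly poly set" where "P = {f. poly f 1 \<in> {0}}"
  have "prime_set ({0} :: rat poly set)"
    by (auto simp: prime_set_iff)
  from prime_set_poly[OF this, of 1] have P: "good P"
    by (auto simp: good_def P_def u2_def one_pCons)
  have P_base: "proj_base (pt P) = {0}"
  proof (rule proj_base_eqI)
    fix a
    have "emb1 a = 0 \<longleftrightarrow> a = 0"
      using emb2_inj[of "[:a:]" 0] by (simp add: emb2_const emb2_simps)
    then show "emb1 a \<in> pt P \<longleftrightarrow> emb1 a \<in> {0}"
      using pt_emb2[OF P, of "[:a:]"] by (simp add: P_def emb2_const)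
  qed simp
  have P_S: "pt P \<in> S"
    using Y(1) by (simp add: S_iff pt_prime[OF P] M_subset_pt[OF P] P_base pt_emb2[OF P]) (simp add: P_def)
  have contract: "good (emb2 -` Q)" "pt (emb2 -` Q) = Q" "[:- 1, 1:] \<in> emb2 -` Q" "prime_set (emb2 -` Q)"
    if "Q \<in> S" for Q
    using that contract_good[of Q] pt_contract[of Q] by (auto simp: S_iff good_def)
  have P_least: "pt P \<subseteq> Q" if Q: "Q \<in> S" for Q
  proof -
    have "P \<subseteq> emb2 -` Q"
    proof
      fix f assume "f \<in> P"
      then have "[:poly f 1:] \<in> emb2 -` Q"
        using prime_setD(1)[OF contract(4)[OF Q]] by (simp add: P_def)
      then show "f \<in> emb2 -` Q"
        using linear_factor_mem[OF contract(4)[OF Q] contract(3)[OF Q]] by blast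
    qed
    from pt_mono[OF P contract(1)[OF Q] this] show ?thesis
      by (simp only: contract(2)[OF Q])
  qed
  have unique: "Q = W" if Q: "Q \<in> fiber_pts S x" and W: "W \<in> fiber_pts S x" for Q W x
  proof -
    have QS: "Q \<in> S" "proj_base Q = x" and WS: "W \<in> S" "proj_base W = x"
      using Q W by (auto simp: fiber_pts_def)
    have "f \<in> emb2 -` Q \<longleftrightarrow> f \<in> emb2 -` W" for f
      using linear_factor_mem[OF contract(4)[OF QS(1)] contract(3)[OF QS(1)], of f]
        linear_factor_mem[OF contract(4)[OF WS(1)] contract(3)[OF WS(1)], of f]
        emb1_mem_iff[OF QS(2)] emb1_mem_iff[OF WS(2)] by (simp add: emb2_const)
    then have "emb2 -` Q = emb2 -` W"
      by blast
    then have "pt (emb2 -` Q) = pt (emb2 -` W)"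
      by (rule arg_cong)
    then show ?thesis
      by (simp only: contract(2)[OF QS(1)] contract(2)[OF WS(1)])
  qed
  have "equidimensional Y S 0"
    unfolding equidimensional_def
  proof (intro conjI ballI)
    fix W assume "W \<in> irred_components S"
    then have "W \<in> S" "\<And>Q. Q \<in> S \<Longrightarrow> Q \<subseteq> W \<Longrightarrow> Q = W"
      unfolding irred_components_def by blast+
    then have "W = pt P"
      using P_S P_least by metis
    then show "dominates_base W"
      by (simp add: dominates_base_def P_base)
  next
    fix x W assume "W \<in> irred_components (fiber_pts S x)"
    then have "W \<in> fiber_pts S x"
      by (simp add: irred_components_def)
    then have "dim_closure (fiber_pts S x) W = enat 0"
      using unique by (intro dim_closure_eq_0)
    then show "\<exists>d. dim_closure (fiber_pts S x) W = enat d \<and> int d = 0"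
      by auto
  qed
  then show ?thesis
    by (simp only: S_def)
qed

text \<open>Equidimensionality speaks of sets of points, so the contradictions of
  \<open>gens_M_unit\<close> are derived again inside a prime: V1 = 0, or a constant value of V2 or
  V3, is incompatible with u and 1 - u being units.\<close>

lemma face_empty:
  assumes Q: "primeideal Q (coord_ring 1 3)" "M \<subseteq> Q"
    and i: "i \<in> {1..3}" and mem: "var (V i) - const (tau \<epsilon>) \<in> Q"
  shows "i = 1 \<and> \<epsilon> = Zero"
proof (rule ccontr)
  assume contra: "\<not> ?thesis"
  note Q' = primeidealD[OF Q(1)]
  let ?u = "emb2 u2"
  have in_R3: "?u \<in> polys_in (coords 1 3)" "1 - ?u \<in> polys_in (coords 1 3)"
      "var (V 2) \<in> polys_in (coords 1 3)" "var (V 3) \<in> polys_in (coords 1 3)"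
    by auto
  have x: "var (V 2) * ?u - 1 \<in> Q" and y: "var (V 3) * (1 - ?u) - 1 \<in> Q"
    using Q(2) gen_superset[OF M_subset] by (auto simp: gens_M_def lit_def emb2_u2)
  have neg: False if "- 1 \<in> Q"
    using Q'(5)[OF Q'(2) that] Q'(3) by simp
  have u: "?u \<notin> Q" "1 - ?u \<notin> Q"
    using contract_good[OF Q] by (auto simp: good_def emb2_simps)
  from contra i consider "i = 1" "\<epsilon> = Infty" | "i = 2" "\<epsilon> = Zero" | "i = 2" "\<epsilon> = Infty"
    | "i = 3" "\<epsilon> = Zero" | "i = 3" "\<epsilon> = Infty"
    by (cases \<epsilon>) fastforce+
  then show False
  proof cases
    case 1
    then have "[:0, 1:] \<in> emb2 -` Q"
      using mem by (simp add: emb2_pCons emb2_simps emb1_simps)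
    moreover have "prime_set (emb2 -` Q)"
      using contract_good[OF Q] by (simp add: good_def)
    ultimately have *: "s * [:0, 1:] \<in> emb2 -` Q" for s
      by (intro prime_setD(4))
    \<comment> \<open>One of u and 1 - u is divisible by V1: either u = (1 - t) V1 or 1 - u = t
      V1.\<close>
    have "u2 = [:[:1, -1:]:] * [:0, 1:] \<or> 1 - u2 = [:[:0, 1:]:] * [:0, 1:]"
      unfolding u2_def by (cases "\<alpha> = 0") (simp_all add: one_pCons)
    then have "u2 \<in> emb2 -` Q \<or> 1 - u2 \<in> emb2 -` Q"
      using * by metis
    then show False
      using contract_good[OF Q] by (auto simp: good_def)
  next
    case 2
    then have "(var (V 2) * ?u - 1) - ?u * (var (V 2) - 1) \<in> Q"
      using mem Q'(5)[OF x Q'(6)[OF _ in_R3(1)]] by simp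
    then have "?u - 1 \<in> Q"
      by (simp add: algebra_simps)
    then have "0 - (?u - 1) \<in> Q"
      by (rule Q'(5)[OF Q'(2)])
    then show False
      using u by simp
  next
    case 3
    then have "var (V 2) \<in> Q"
      using mem by simp
    from Q'(5)[OF x Q'(6)[OF this in_R3(1)]] show False
      using neg by (simp add: algebra_simps)
  next
    case 4
    then have "(var (V 3) * (1 - ?u) - 1) - (1 - ?u) * (var (V 3) - 1) \<in> Q"
      using mem Q'(5)[OF y Q'(6)[OF _ in_R3(2)]] by simp
    then have "- ?u \<in> Q"
      by (simp add: algebra_simps)
    then have "0 - - ?u \<in> Q"
      by (rule Q'(5)[OF Q'(2)])
    then show False
      using u by simp
  next
    case 5
    then have "var (V 3) \<in> Q"
      using mem by simp
    from Q'(5)[OF y Q'(6)[OF this in_R3(2)]] show False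
      using neg by (simp add: algebra_simps)
  qed
qed

text \<open>The whole cube and the face V1 = 1 have dimensions 3 and 2, hence relative dimensions 1
  and 0. Any other face imposes a condition excluded by \<open>face_empty\<close>.\<close>

lemma M_in_Zeq:
  assumes Y: "{0} \<in> Y" "Y \<subseteq> A1"
  shows "M \<in> Zeq Y 2 3"
  unfolding Zeq_def
proof (intro CollectI conjI ballI)
  show "M \<in> times_cube Y 3"
    by (rule generic_point_in_times_cube[OF generic_point_M Y(1)]) auto
  fix F assume F: "F \<in> faces 3"
  let ?S = "locus Y 3 M \<inter> times_face Y 3 F"
  consider "dom F = {}" | "dom F = {1}" "F 1 = Some Zero" | i \<epsilon> where "F i = Some \<epsilon>" "\<not> (i = 1 \<and> \<epsilon> = Zero)"
  proof (cases "\<exists>i \<epsilon>. F i = Some \<epsilon> \<and> \<not> (i = 1 \<and> \<epsilon> = Zero)")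
    case False
    then have *: "i = 1 \<and> \<epsilon> = Zero" if "F i = Some \<epsilon>" for i \<epsilon>
      using that by blast
    show ?thesis
    proof (cases "F 1")
      case None
      have "F i = None" for i
        using *[of i] None by (cases "F i") auto
      then show ?thesis
        using that(1) by (simp add: dom_def)
    next
      case (Some \<epsilon>)
      then show ?thesis
        using * that(2) by (auto simp: dom_def)
    qed
  qed (use that(3) in blast)
  then show "?S = {} \<or> equidimensional Y ?S (int (face_dim 3 F) - int 2)"
  proof cases
    case 1
    then have "F i = None" for i
      by (auto simp: dom_def)
    then have "?S = locus Y 3 M"
      by (auto simp: times_face_def locus_def)
    then show ?thesis
      using equidimensional_M[OF Y] 1 by (simp add: face_dim_def)
  next
    case 2
    then show ?thesis
      using equidimensional_face[OF Y 2] by (simp add: face_dim_def)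
  next
    case (3 i \<epsilon>)
    have "i \<in> {1..3}"
      using 3(1) F by (auto simp: faces_def)
    have "Q \<notin> ?S" for Q
    proof
      assume "Q \<in> ?S"
      then have "primeideal Q (coord_ring 1 3)" "M \<subseteq> Q" "var (V i) - const (tau \<epsilon>) \<in> Q"
        using 3(1) unfolding times_face_def by (simp_all add: locus_M_iff)
      from face_empty[OF this(1,2) \<open>i \<in> {1..3}\<close> this(3)] show False
        using 3(2) by blast
    qed
    then have "?S = {}"
      by blast
    then show ?thesis
      by simp
  qed
qed

lemma Alt_M_in_Neq:
  assumes Y: "{0} \<in> Y" "Y \<subseteq> A1"
  shows "Alt 3 (prime_cycle 3 M_gens) \<in> Neq Y 2 1"
proof -
  have "Poly_Mapping.keys (prime_cycle 3 M_gens) \<subseteq> Zeq Y 2 3"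
    using M_in_Zeq[OF Y] by simp
  then show ?thesis
    by (auto simp: Neq_def)
qed

section \<open>Restriction to an open base and empty fibres\<close>

lemma restrict_Alt_M: "{0} \<in> Y \<Longrightarrow> restrict_to Y 3 (Alt 3 (prime_cycle 3 M_gens)) = Alt 3 (prime_cycle 3 M_gens)"
  by (rule restrict_Alt[OF M_subset generic_point_sub_M])

text \<open>Coinciding translates may cancel, which only shrinks the support; an inclusion suffices
  for checking every subvariety that occurs.\<close>

lemma keys_Alt_M:
  assumes "Z \<in> Poly_Mapping.keys (Alt 3 (prime_cycle 3 M_gens))"
  shows "\<exists>S \<sigma>. \<sigma> permutes {1..3} \<and> Z = gen 1 3 (sub S \<sigma> ` M_gens)"
proof -
  have keys_scale: "Poly_Mapping.keys (scale q z) \<subseteq> Poly_Mapping.keys z" for q z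
    by (auto simp: in_keys_iff)
  have "Z \<in> (\<Union>S \<in> Pow {1..3}. Poly_Mapping.keys
      (\<Sum>\<sigma> | \<sigma> permutes {1..3}. scale (cube_sign S \<sigma>) (prime_cycle 3 (sub S \<sigma> ` M_gens))))"
    using assms unfolding Alt_prime_cycle[OF M_subset]
    by (rule subsetD[OF subset_trans[OF keys_scale Poly_Mapping.keys_sum]])
  then obtain S where "Z \<in> Poly_Mapping.keys
      (\<Sum>\<sigma> | \<sigma> permutes {1..3}. scale (cube_sign S \<sigma>) (prime_cycle 3 (sub S \<sigma> ` M_gens)))"
    by blast
  then have "Z \<in> (\<Union>\<sigma> \<in> {\<sigma>. \<sigma> permutes {1..3}}. Poly_Mapping.keys
      (scale (cube_sign S \<sigma>) (prime_cycle 3 (sub S \<sigma> ` M_gens))))"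
    by (rule subsetD[OF Poly_Mapping.keys_sum])
  then obtain \<sigma> where "\<sigma> permutes {1..3}" "Z \<in> Poly_Mapping.keys (prime_cycle 3 (sub S \<sigma> ` M_gens))"
    using subsetD[OF keys_scale] by blast
  then show ?thesis
    by auto
qed

text \<open>The function \<open>k\<close> vanishes at \<open>x\<close> and divides u or 1 - u, which
  are units on the surface. The hypothesis ranges over all \<open>A\<close> because in a translate
  another literal takes the place of V1.\<close>

lemma empty_fiber_M:
  assumes k: "k \<in> x" and u: "(\<forall>A. u A = k * A) \<or> (\<forall>A. 1 - u A = k * A)"
  shows "empty_fiber A1 3 x (Alt 3 (prime_cycle 3 M_gens))"
proof -
  \<comment> \<open>Only \<open>x \<subseteq> Q\<close> is assumed, which covers both the points of
    the fibre and the scheme cut out by \<open>Z \<union> x\<close>.\<close>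
  have no_point: False
    if Z: "Z \<in> Poly_Mapping.keys (Alt 3 (prime_cycle 3 M_gens))"
      and Q: "Q \<in> times_cube A1 3" "Z \<subseteq> Q" "x \<subseteq> Q" for Z Q
  proof -
    obtain S \<sigma> where \<sigma>: "\<sigma> permutes {1..3}" and Z_eq: "Z = gen 1 3 (sub S \<sigma> ` M_gens)"
      using keys_Alt_M[OF Z] by blast
    have sub: "sub S \<sigma> ` M_gens \<subseteq> polys_in (coords 1 3)"
      using generic_point_sub_M[OF \<sigma>] by (simp add: generic_point_def)
    have "primeideal Q (coord_ring 1 3)"
      using Q(1) by (simp add: times_cube_def Spec_def)
    note Q' = primeidealD[OF this]
    define A B C where ABC: "A = lit (\<sigma> 1 \<in> S) (\<sigma> 1)" "B = lit (\<sigma> 2 \<in> S) (\<sigma> 2)" "C = lit (\<sigma> 3 \<in> S) (\<sigma> 3)"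
    have in_R3: "A \<in> polys_in (coords 1 3)" "B \<in> polys_in (coords 1 3)" "C \<in> polys_in (coords 1 3)"
      using permutes_in_image[OF \<sigma>, of 1] permutes_in_image[OF \<sigma>, of 2] permutes_in_image[OF \<sigma>, of 3]
      by (auto simp: ABC)
    have "sub S \<sigma> ` M_gens = gens_M A B C"
      by (simp add: ABC)
    then have x: "B * u A - 1 \<in> Q" and y: "C * (1 - u A) - 1 \<in> Q"
      using Q(2) gen_superset[OF sub] unfolding Z_eq gens_M_def by auto
    have kQ: "D * (k * A) \<in> Q" if "D \<in> polys_in (coords 1 3)" for D
      using Q'(6)[OF Q'(7)[OF _ in_R3(1)] that, of k] k Q(3) by auto
    from u show False
    proof
      assume "\<forall>A. u A = k * A"
      then have "B * (k * A) - (B * u A - 1) \<in> Q" "B * u A = B * (k * A)"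
        using Q'(5)[OF kQ[OF in_R3(2)] x] by auto
      then show False
        using Q'(3) by simp
    next
      assume "\<forall>A. 1 - u A = k * A"
      then have "C * (k * A) - (C * (1 - u A) - 1) \<in> Q" "C * (1 - u A) = C * (k * A)"
        using Q'(5)[OF kQ[OF in_R3(3)] y] by auto
      then show False
        using Q'(3) by simp
    qed
  qed
  have "fiber_pts (locus A1 3 Z) x = {}" if "Z \<in> Poly_Mapping.keys (Alt 3 (prime_cycle 3 M_gens))" for Z
    using no_point[OF that] by (auto simp: fiber_pts_def locus_def proj_base_def)
  moreover have "scheme_cycle (coord_ring 1 3) (times_cube A1 3) (Z \<union> x) = 0"
    if "Z \<in> Poly_Mapping.keys (Alt 3 (prime_cycle 3 M_gens))" for Z
    by (rule scheme_cycle_empty) (use no_point[OF that] in auto)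
  then have "fiber_cycle A1 3 x (Alt 3 (prime_cycle 3 M_gens)) = 0"
    unfolding fiber_cycle_def lin_ext_def by (intro sum.neutral) auto
  ultimately show ?thesis
    by (simp add: empty_fiber_def)
qed

end


text \<open>The multiplication sends t to t V1, so 1 - t becomes 1 - t V1; the twisted one sends 1 -
  t to (1 - t) V1. These pull-backs of 1 - t are the two choices of u.\<close>

lemma mu_surface: "surface 1 (- tt)" and nu_surface: "surface 0 (1 - tt)"
  by unfold_locales auto

lemma twisted_mult_map_eq:
  "twisted_mult_map = substitute (\<lambda>x. case x of T i \<Rightarrow> 1 - (1 - var (T i)) * var (V 1) | V i \<Rightarrow> var (V (i + 1)))"
proof
  fix p
  have homs: "unital_hom theta_map" "unital_hom mult_map"
    unfolding theta_map_def mult_map_def by (rule unital_hom_substitute)+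
  have hom: "unital_hom (\<lambda>p. theta_map (mult_map (theta_map p)))"
    by (rule unital_hom_comp[OF homs(1) unital_hom_comp[OF homs(2,1)]])
  show "twisted_mult_map p = substitute (\<lambda>x. case x of T i \<Rightarrow> 1 - (1 - var (T i)) * var (V 1) | V i \<Rightarrow> var (V (i + 1))) p"
    unfolding twisted_mult_map_def comp_apply
    by (rule unital_hom_eqI[OF hom unital_hom_substitute polys_in_UNIV])
       (auto simp: theta_map_def mult_map_def split: coord.splits)
qed

theorem lemma3p14:
  fixes Lbar0 Lbar1 L0 L1 bbar b Lbar01 Lbar101 L01 L101 :: cycle
  assumes "Lbar0 = param [t]" and "Lbar1 = param [1 - t]"
    and "L0 = restrict_to X 1 Lbar0" and "L1 = restrict_to X 1 Lbar1"
    and "bbar = cycle_product A1 1 1 Lbar0 Lbar1" and "b = cycle_product X 1 1 L0 L1"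
    and "Lbar01 = mu_pull 2 bbar" and "Lbar101 = nu_pull 2 bbar"
    and "L01 = restrict_to X 3 Lbar01" and "L101 = restrict_to X 3 Lbar101"
  shows
    "(L01 \<in> Neq X 2 1 \<and> L101 \<in> Neq X 2 1 \<and> Lbar01 \<in> Neq A1 2 1 \<and> Lbar101 \<in> Neq A1 2 1) \<and>
     (differential X 3 L01 = b \<and> differential X 3 L101 = b \<and>
      differential A1 3 Lbar01 = bbar \<and> differential A1 3 Lbar101 = bbar) \<and>
     (restrict_to X 3 Lbar01 = L01 \<and> empty_fiber A1 3 (rational_point 0) Lbar01 \<and>
      restrict_to X 3 Lbar101 = L101 \<and> empty_fiber A1 3 (rational_point 1) Lbar101)"
proof -
  interpret mu: surface 1 "- tt"
    by (rule mu_surface)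
  interpret nu: surface 0 "1 - tt"
    by (rule nu_surface)
  have X_A1: "X \<subseteq> A1"
    by (auto simp: X_def)
  have bbar: "bbar = Alt 2 (prime_cycle 2 b_gens)" and b: "b = Alt 2 (prime_cycle 2 b_gens)"
    using product_L0_L1[OF zero_in_A1] product_L0_L1[OF zero_in_X] restrict_L0[OF zero_in_X] assms(1-6)
    by simp_all
  have Lbar01: "Lbar01 = Alt 3 (prime_cycle 3 mu.M_gens)"
    using mu.pull_back_b[OF mult_map_def] assms(7)
    by (simp add: mu_pull_def bbar mu.u_def lit_def)
  have Lbar101: "Lbar101 = Alt 3 (prime_cycle 3 nu.M_gens)"
    using nu.pull_back_b[OF twisted_mult_map_eq] assms(8)
    by (simp add: nu_pull_def bbar nu.u_def lit_def)
  have L01: "L01 = Alt 3 (prime_cycle 3 mu.M_gens)" and L101: "L101 = Alt 3 (prime_cycle 3 nu.M_gens)"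
    using mu.restrict_Alt_M[OF zero_in_X] nu.restrict_Alt_M[OF zero_in_X] assms(9,10) Lbar01 Lbar101
    by simp_all
  have mem: "tt \<in> rational_point 0" "1 - tt \<in> rational_point 1"
    using unital_hom_eval_poly[OF unital_hom_id]
    by (auto simp: rational_point_def unital_hom_id unital_hom.simps)
  have mu_fiber: "empty_fiber A1 3 (rational_point 0) Lbar01"
    unfolding Lbar01 by (rule mu.empty_fiber_M[OF mem(1)]) (simp add: mu.u_def)
  have nu_fiber: "empty_fiber A1 3 (rational_point 1) Lbar101"
    unfolding Lbar101 by (rule nu.empty_fiber_M[OF mem(2)]) (simp add: nu.u_def)
  have "L01 \<in> Neq X 2 1 \<and> L101 \<in> Neq X 2 1 \<and> Lbar01 \<in> Neq A1 2 1 \<and> Lbar101 \<in> Neq A1 2 1"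
    unfolding L01 L101 Lbar01 Lbar101
    by (intro conjI mu.Alt_M_in_Neq nu.Alt_M_in_Neq zero_in_X zero_in_A1 X_A1 order_refl)
  moreover have "differential X 3 L01 = b \<and> differential X 3 L101 = b \<and>
      differential A1 3 Lbar01 = bbar \<and> differential A1 3 Lbar101 = bbar"
    unfolding L01 L101 Lbar01 Lbar101 b bbar
    by (intro conjI mu.differential_Alt_M nu.differential_Alt_M zero_in_X zero_in_A1)
  ultimately show ?thesis
    using mu_fiber nu_fiber assms(9,10) by blast
qed

end
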